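(* Let $G$ be a group, $g\in G$, and let $(\mathcal B,\langle\!\langle-\rangle\!\rangle)$ be a shadowed bicategory equipped with $G$-twisting data. Assume that each hom-category $\mathcal B^{G\text{-tw}}(A,B)$ is additive, that horizontal composition distributes over biproducts, and that the target $\mathcal T$ of ${}^g\langle\!\langle-\rangle\!\rangle$ is additive and the twisted shadow preserves biproducts. If $X,Y\in\mathcal B^{G\text{-tw}}(A,B)$ are left dualizable and $f_X\colon X\Rightarrow X$, $f_Y\colon Y\Rightarrow Y$ are 2-cells in $\mathcal B^{G\text{-tw}}$, then $X\oplus Y$ is left dualizable and $$\operatorname{tr}^g(f_X\oplus f_Y)=\operatorname{tr}^g(f_X)+\operatorname{tr}^g(f_Y).$$
   Context: **Bicategories.** For 1-cells $M\colon A\to B$, $N\colon B\to C$ the horizontal composite is written $M\odot N\colon A\to C$ (first $M$, then $N$); $U_A$ is the unit 1-cell; associators and unitors $\mathfrak a,\mathfrak l,\mathfrak r$ are suppressed where harmless. $\mathrm{Pic}_{\mathcal B}(A)$ is the monoidal groupoid (under $\odot$) of invertible 1-cells $A\to A$ and invertible 2-cells. **$G$-twisting data**: for each 0-cell $A$ a strong monoidal functor $\Theta_A\colon G\to\mathrm{Pic}_{\mathcal B}(A)$ with structure 2-cells $\mu^A_{g,h}\colon\Theta_A(g)\odot\Theta_A(h)\Rightarrow\Theta_A(gh)$, $\eta^A\colon U_A\Rightarrow\Theta_A(e)$. For $M\colon A\to B$: ${}^gM=\Theta_A(g^{-1})\odot M$, $M^g=M\odot\Theta_B(g)$; ${}^gf=\mathrm{id}\odot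 f$ for a 2-cell $f$. **Bicategory of $G$-twists $\mathcal B^{G\text{-tw}}$.** Same 0-cells. A 1-cell $A\to B$ is $(M,\tau)$ with $M\colon A\to B$ in $\mathcal B$ and invertible 2-cells $\tau_g\colon\Theta_A(g)\odot M\Rightarrow M\odot\Theta_B(g)$, $g\in G$, such that $\tau_e$ is the canonical isomorphism given by $\eta^A,\eta^B$ and unitors, and $\tau_{gh}=(\mathrm{id}_M\odot\mu^B_{g,h})(\tau_g\odot\mathrm{id})(\mathrm{id}\odot\tau_h)((\mu^A_{g,h})^{-1}\odot\mathrm{id}_M)$. A 2-cell $(M,\tau)\Rightarrow(N,\sigma)$ is a 2-cell $f\colon M\Rightarrow N$ with $\sigma_g(\mathrm{id}\odot f)=(f\odot\mathrm{id})\tau_g$ for all $g$. Composite: $(M\odot N,\tau\star\sigma)$, $(\tau\star\sigma)_g=(\mathrm{id}_M\odot\sigma_g)(\tau_g\odot\mathrm{id}_N)$. Unit: $U_A$ with $\mathfrak l^{-1}\mathfrak r$. Transport map: $g_M=(\tau_{g^{-1}})^{-1}\colon M^{g^{-1}}\Rightarrow{}^gM$. **Shadows.** A shadow on $\mathcal B$ with values in a category $\mathcal T$ is a family of functors $\langle\!\langle-\rangle\!\rangle_R\colon\mathcal B(R,R)\to\mathcal T$ with natural isomorphisms $\theta_{M,N}\colon\langle\!\langle M\odot N\rangle\!\rangle_R\cong\langle\!\langle N\odot M\rangle\!\rangle_S$ ($M\colon R\to S$, $N\colon S\to R$) such that, up to associators, $\theta_{M\odot N,P}=\theta_{N,P\odot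 M}\circ\theta_{M,N\odot P}$, and $\langle\!\langle\mathfrak l\rangle\!\rangle\circ\theta_{M,U_R}=\langle\!\langle\mathfrak r\rangle\!\rangle$, $\langle\!\langle\mathfrak r\rangle\!\rangle\circ\theta_{U_R,M}=\langle\!\langle\mathfrak l\rangle\!\rangle$. **Twisted shadow.** ${}^g\langle\!\langle(M,\tau)\rangle\!\rangle_R=\langle\!\langle{}^gM\rangle\!\rangle_R$, ${}^g\langle\!\langle f\rangle\!\rangle=\langle\!\langle{}^gf\rangle\!\rangle$. Twisted cyclicity ${}^g\theta_{M,N}$: $\langle\!\langle\Theta_R(g^{-1})\odot M\odot N\rangle\!\rangle_R\xrightarrow{\theta}\langle\!\langle N\odot\Theta_R(g^{-1})\odot M\rangle\!\rangle_S\xrightarrow{g_N\odot\mathrm{id}}\langle\!\langle\Theta_S(g^{-1})\odot N\odot M\rangle\!\rangle_S$. **Twisted trace.** $X\colon A\to B$ is left dualizable with left dual ${}^*X\colon B\to A$ if there are 2-cells $\bar\eta\colon U_B\Rightarrow{}^*X\odot X$, $\bar\epsilon\colon X\odot{}^*X\Rightarrow U_A$ (in $\mathcal B^{G\text{-tw}}$) satisfying the triangle identities. For $f\colon X\Rightarrow X$, $\operatorname{tr}^g(f)\colon{}^g\langle\!\langle U_B\rangle\!\rangle_B\to{}^g\langle\!\langle U_A\rangle\!\rangle_A$ is ${}^g\langle\!\langle U_B\rangle\!\rangle\xrightarrow{\bar\eta}{}^g\langle\!\langle{}^*X\odot X\rangle\!\rangle\xrightarrow{\mathrm{id}\odot f}{}^g\langle\!\langle{}^*X\odot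 X\rangle\!\rangle\xrightarrow{{}^g\theta}{}^g\langle\!\langle X\odot{}^*X\rangle\!\rangle\xrightarrow{\bar\epsilon}{}^g\langle\!\langle U_A\rangle\!\rangle$. *)

theory Defs
  imports "HOL-Algebra.Group"
begin

section \<open>Categories and additive categories\<close>

text \<open>
  Composition is written in the usual (right to left) order. Hom-sets are not required to be
  disjoint, and composition and identities do not mention the objects.
\<close>

record ('o, 'a) category =
  Ob :: "'o set"
  Hom :: "'o \<Rightarrow> 'o \<Rightarrow> 'a set"
  Id :: "'o \<Rightarrow> 'a"
  Comp :: "'a \<Rightarrow> 'a \<Rightarrow> 'a" (infixl "\<bullet>\<index>" 65)

locale category =
  fixes C :: "('o, 'a) category" (structure)
  assumes Id_closed: "X \<in> Ob C \<Longrightarrow> Id C X \<in> Hom C X X"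
    and Comp_closed: "\<lbrakk>X \<in> Ob C; Y \<in> Ob C; Z \<in> Ob C; f \<in> Hom C X Y; h \<in> Hom C Y Z\<rbrakk>
      \<Longrightarrow> h \<bullet> f \<in> Hom C X Z"
    and Comp_Id: "\<lbrakk>X \<in> Ob C; Y \<in> Ob C; f \<in> Hom C X Y\<rbrakk> \<Longrightarrow> f \<bullet> Id C X = f"
    and Id_Comp: "\<lbrakk>X \<in> Ob C; Y \<in> Ob C; f \<in> Hom C X Y\<rbrakk> \<Longrightarrow> Id C Y \<bullet> f = f"
    and Comp_assoc: "\<lbrakk>X \<in> Ob C; Y \<in> Ob C; Z \<in> Ob C; V \<in> Ob C;
        f \<in> Hom C X Y; h \<in> Hom C Y Z; k \<in> Hom C Z V\<rbrakk> \<Longrightarrow> (k \<bullet> h) \<bullet> f = k \<bullet> (h \<bullet> f)"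

definition is_inverse :: "('o, 'a) category \<Rightarrow> 'o \<Rightarrow> 'o \<Rightarrow> 'a \<Rightarrow> 'a \<Rightarrow> bool" where
  "is_inverse C X Y f h \<longleftrightarrow> f \<in> Hom C X Y \<and> h \<in> Hom C Y X
     \<and> h \<bullet>\<^bsub>C\<^esub> f = Id C X \<and> f \<bullet>\<^bsub>C\<^esub> h = Id C Y"

definition is_iso :: "('o, 'a) category \<Rightarrow> 'o \<Rightarrow> 'o \<Rightarrow> 'a \<Rightarrow> bool" where
  "is_iso C X Y f \<longleftrightarrow> (\<exists>h. is_inverse C X Y f h)"

definition the_inverse :: "('o, 'a) category \<Rightarrow> 'o \<Rightarrow> 'o \<Rightarrow> 'a \<Rightarrow> 'a" where
  "the_inverse C X Y f = (THE h. is_inverse C X Y f h)"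

definition is_functor ::
  "('o, 'a) category \<Rightarrow> ('p, 'b) category \<Rightarrow> ('o \<Rightarrow> 'p) \<Rightarrow> ('a \<Rightarrow> 'b) \<Rightarrow> bool" where
  "is_functor C D Fo Fa \<longleftrightarrow>
     (\<forall>X\<in>Ob C. Fo X \<in> Ob D) \<and>
     (\<forall>X\<in>Ob C. \<forall>Y\<in>Ob C. \<forall>f\<in>Hom C X Y. Fa f \<in> Hom D (Fo X) (Fo Y)) \<and>
     (\<forall>X\<in>Ob C. Fa (Id C X) = Id D (Fo X)) \<and>
     (\<forall>X\<in>Ob C. \<forall>Y\<in>Ob C. \<forall>Z\<in>Ob C. \<forall>f\<in>Hom C X Y. \<forall>h\<in>Hom C Y Z.
        Fa (h \<bullet>\<^bsub>C\<^esub> f) = Fa h \<bullet>\<^bsub>D\<^esub> Fa f)"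

text \<open>
  The sum \<open>add X Y f h\<close> and the zero morphism \<open>zero X Y\<close> carry the objects as arguments,
  since a morphism may belong to several hom-sets.
\<close>

locale preadditive_category = category C
  for C :: "('o, 'a) category" (structure) +
  fixes add :: "'o \<Rightarrow> 'o \<Rightarrow> 'a \<Rightarrow> 'a \<Rightarrow> 'a"
    and zero :: "'o \<Rightarrow> 'o \<Rightarrow> 'a"
  assumes hom_group: "\<lbrakk>X \<in> Ob C; Y \<in> Ob C\<rbrakk>
      \<Longrightarrow> comm_group \<lparr>carrier = Hom C X Y, mult = add X Y, one = zero X Y\<rparr>"
    and Comp_add: "\<lbrakk>X \<in> Ob C; Y \<in> Ob C; Z \<in> Ob C; f \<in> Hom C X Y; f' \<in> Hom C X Y; h \<in> Hom C Y Z\<rbrakk>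
      \<Longrightarrow> h \<bullet> add X Y f f' = add X Z (h \<bullet> f) (h \<bullet> f')"
    and add_Comp: "\<lbrakk>X \<in> Ob C; Y \<in> Ob C; Z \<in> Ob C; f \<in> Hom C X Y; h \<in> Hom C Y Z; h' \<in> Hom C Y Z\<rbrakk>
      \<Longrightarrow> add Y Z h h' \<bullet> f = add X Z (h \<bullet> f) (h' \<bullet> f)"

definition is_zero_object :: "('o, 'a) category \<Rightarrow> 'o \<Rightarrow> bool" where
  "is_zero_object C Z \<longleftrightarrow> Z \<in> Ob C \<and>
     (\<forall>X\<in>Ob C. (\<exists>!f. f \<in> Hom C X Z) \<and> (\<exists>!f. f \<in> Hom C Z X))"

text \<open>\<open>is_biproduct C add zero X Y Z i j p q\<close>: the object \<open>Z\<close> with injections \<open>i\<close>, \<open>j\<close> and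
  projections \<open>p\<close>, \<open>q\<close> is a biproduct of \<open>X\<close> and \<open>Y\<close>.\<close>

definition is_biproduct ::
  "('o, 'a) category \<Rightarrow> ('o \<Rightarrow> 'o \<Rightarrow> 'a \<Rightarrow> 'a \<Rightarrow> 'a) \<Rightarrow> ('o \<Rightarrow> 'o \<Rightarrow> 'a) \<Rightarrow>
   'o \<Rightarrow> 'o \<Rightarrow> 'o \<Rightarrow> 'a \<Rightarrow> 'a \<Rightarrow> 'a \<Rightarrow> 'a \<Rightarrow> bool" where
  "is_biproduct C add zero X Y Z i j p q \<longleftrightarrow>
     X \<in> Ob C \<and> Y \<in> Ob C \<and> Z \<in> Ob C \<and>
     i \<in> Hom C X Z \<and> j \<in> Hom C Y Z \<and> p \<in> Hom C Z X \<and> q \<in> Hom C Z Y \<and>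
     p \<bullet>\<^bsub>C\<^esub> i = Id C X \<and> q \<bullet>\<^bsub>C\<^esub> j = Id C Y \<and>
     p \<bullet>\<^bsub>C\<^esub> j = zero Y X \<and> q \<bullet>\<^bsub>C\<^esub> i = zero X Y \<and>
     add Z Z (i \<bullet>\<^bsub>C\<^esub> p) (j \<bullet>\<^bsub>C\<^esub> q) = Id C Z"

locale additive_category = preadditive_category +
  assumes has_zero_object: "\<exists>Z. is_zero_object C Z"
    and has_biproducts: "\<lbrakk>X \<in> Ob C; Y \<in> Ob C\<rbrakk>
      \<Longrightarrow> \<exists>Z i j p q. is_biproduct C add zero X Y Z i j p q"

text \<open>The endomorphism \<open>f \<oplus> h\<close> of a biproduct \<open>Z\<close> of \<open>X\<close> and \<open>Y\<close> with structure maps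
  \<open>i\<close>, \<open>j\<close>, \<open>p\<close>, \<open>q\<close>, for endomorphisms \<open>f\<close> of \<open>X\<close> and \<open>h\<close> of \<open>Y\<close>.\<close>

definition biproduct_endo ::
  "('o, 'a) category \<Rightarrow> ('o \<Rightarrow> 'o \<Rightarrow> 'a \<Rightarrow> 'a \<Rightarrow> 'a) \<Rightarrow>
   'o \<Rightarrow> 'a \<Rightarrow> 'a \<Rightarrow> 'a \<Rightarrow> 'a \<Rightarrow> 'a \<Rightarrow> 'a \<Rightarrow> 'a" where
  "biproduct_endo C add Z i j p q f h =
     add Z Z (i \<bullet>\<^bsub>C\<^esub> f \<bullet>\<^bsub>C\<^esub> p) (j \<bullet>\<^bsub>C\<^esub> h \<bullet>\<^bsub>C\<^esub> q)"

text \<open>Preservation of binary biproduct diagrams (as \<open>zero X Y\<close> occurs in such a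
  diagram, this includes preservation of zero morphisms, hence of zero objects).\<close>

definition preserves_biproducts ::
  "('o, 'a) category \<Rightarrow> ('o \<Rightarrow> 'o \<Rightarrow> 'a \<Rightarrow> 'a \<Rightarrow> 'a) \<Rightarrow> ('o \<Rightarrow> 'o \<Rightarrow> 'a) \<Rightarrow>
   ('p, 'b) category \<Rightarrow> ('p \<Rightarrow> 'p \<Rightarrow> 'b \<Rightarrow> 'b \<Rightarrow> 'b) \<Rightarrow> ('p \<Rightarrow> 'p \<Rightarrow> 'b) \<Rightarrow>
   ('o \<Rightarrow> 'p) \<Rightarrow> ('a \<Rightarrow> 'b) \<Rightarrow> bool" where
  "preserves_biproducts C addC zeroC D addD zeroD Fo Fa \<longleftrightarrow>
     (\<forall>X Y Z i j p q. is_biproduct C addC zeroC X Y Z i j p q \<longrightarrow>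
        is_biproduct D addD zeroD (Fo X) (Fo Y) (Fo Z) (Fa i) (Fa j) (Fa p) (Fa q))"

section \<open>Bicategories\<close>

text \<open>
  \<open>Cells2 B M N\<close> is the set of 2-cells from \<open>M\<close> to \<open>N\<close>; these sets need not be disjoint, so
  that the 2-cells of the bicategory of twists below can be 2-cells of the base bicategory.
  Horizontal composition is in diagrammatic order, \<open>\<odot>\<close> on 1-cells and \<open>\<star>\<close> on 2-cells;
  vertical composition \<open>\<cdot>\<close> is from right to left.
\<close>

record ('o, 'm, 'c) bicategory =
  Cells0 :: "'o set"
  Cells1 :: "'m set"
  Src :: "'m \<Rightarrow> 'o"
  Trg :: "'m \<Rightarrow> 'o"
  Cells2 :: "'m \<Rightarrow> 'm \<Rightarrow> 'c set"
  Id2 :: "'m \<Rightarrow> 'c"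
  VComp :: "'c \<Rightarrow> 'c \<Rightarrow> 'c" (infixl "\<cdot>\<index>" 65)
  Unit1 :: "'o \<Rightarrow> 'm"
  HComp1 :: "'m \<Rightarrow> 'm \<Rightarrow> 'm" (infixl "\<odot>\<index>" 70)
  HComp2 :: "'c \<Rightarrow> 'c \<Rightarrow> 'c" (infixl "\<star>\<index>" 70)
  Assoc :: "'m \<Rightarrow> 'm \<Rightarrow> 'm \<Rightarrow> 'c"
  LUnit :: "'m \<Rightarrow> 'c"
  RUnit :: "'m \<Rightarrow> 'c"

definition hom1 :: "('o, 'm, 'c) bicategory \<Rightarrow> 'o \<Rightarrow> 'o \<Rightarrow> 'm set" where
  "hom1 B A C = {M \<in> Cells1 B. Src B M = A \<and> Trg B M = C}"

definition hom_category :: "('o, 'm, 'c) bicategory \<Rightarrow> 'o \<Rightarrow> 'o \<Rightarrow> ('m, 'c) category" where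
  "hom_category B A C = \<lparr>Ob = hom1 B A C, Hom = Cells2 B, Id = Id2 B, Comp = VComp B\<rparr>"

definition iso2 :: "('o, 'm, 'c) bicategory \<Rightarrow> 'm \<Rightarrow> 'm \<Rightarrow> 'c \<Rightarrow> bool" where
  "iso2 B M N f \<longleftrightarrow> is_iso (hom_category B (Src B M) (Trg B M)) M N f"

definition inv2 :: "('o, 'm, 'c) bicategory \<Rightarrow> 'm \<Rightarrow> 'm \<Rightarrow> 'c \<Rightarrow> 'c" where
  "inv2 B M N f = the_inverse (hom_category B (Src B M) (Trg B M)) M N f"

definition Assoc_inv :: "('o, 'm, 'c) bicategory \<Rightarrow> 'm \<Rightarrow> 'm \<Rightarrow> 'm \<Rightarrow> 'c" where
  "Assoc_inv B M N P = inv2 B (M \<odot>\<^bsub>B\<^esub> N \<odot>\<^bsub>B\<^esub> P) (M \<odot>\<^bsub>B\<^esub> (N \<odot>\<^bsub>B\<^esub> P)) (Assoc B M N P)"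

definition LUnit_inv :: "('o, 'm, 'c) bicategory \<Rightarrow> 'm \<Rightarrow> 'c" where
  "LUnit_inv B M = inv2 B (Unit1 B (Src B M) \<odot>\<^bsub>B\<^esub> M) M (LUnit B M)"

definition RUnit_inv :: "('o, 'm, 'c) bicategory \<Rightarrow> 'm \<Rightarrow> 'c" where
  "RUnit_inv B M = inv2 B (M \<odot>\<^bsub>B\<^esub> Unit1 B (Trg B M)) M (RUnit B M)"

locale bicategory =
  fixes B :: "('o, 'm, 'c) bicategory" (structure)
  assumes Src_closed: "M \<in> Cells1 B \<Longrightarrow> Src B M \<in> Cells0 B"
    and Trg_closed: "M \<in> Cells1 B \<Longrightarrow> Trg B M \<in> Cells0 B"
    and Cells2_parallel: "f \<in> Cells2 B M N
      \<Longrightarrow> M \<in> Cells1 B \<and> N \<in> Cells1 B \<and> Src B M = Src B N \<and> Trg B M = Trg B N"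
    and category_hom: "\<lbrakk>A \<in> Cells0 B; C \<in> Cells0 B\<rbrakk> \<Longrightarrow> category (hom_category B A C)"
    and Unit1_closed: "A \<in> Cells0 B \<Longrightarrow> Unit1 B A \<in> hom1 B A A"
    and HComp1_closed: "\<lbrakk>M \<in> hom1 B A C; N \<in> hom1 B C D\<rbrakk> \<Longrightarrow> M \<odot> N \<in> hom1 B A D"
    and HComp2_closed: "\<lbrakk>f \<in> Cells2 B M M'; h \<in> Cells2 B N N'; Trg B M = Src B N\<rbrakk>
      \<Longrightarrow> f \<star> h \<in> Cells2 B (M \<odot> N) (M' \<odot> N')"
    and HComp2_Id: "\<lbrakk>M \<in> Cells1 B; N \<in> Cells1 B; Trg B M = Src B N\<rbrakk>
      \<Longrightarrow> Id2 B M \<star> Id2 B N = Id2 B (M \<odot> N)"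
    and interchange: "\<lbrakk>f \<in> Cells2 B M M'; f' \<in> Cells2 B M' M''; h \<in> Cells2 B N N';
        h' \<in> Cells2 B N' N''; Trg B M = Src B N\<rbrakk>
      \<Longrightarrow> (f' \<cdot> f) \<star> (h' \<cdot> h) = (f' \<star> h') \<cdot> (f \<star> h)"
    and Assoc_iso: "\<lbrakk>M \<in> Cells1 B; N \<in> Cells1 B; P \<in> Cells1 B; Trg B M = Src B N; Trg B N = Src B P\<rbrakk>
      \<Longrightarrow> iso2 B (M \<odot> N \<odot> P) (M \<odot> (N \<odot> P)) (Assoc B M N P)"
    and LUnit_iso: "M \<in> Cells1 B \<Longrightarrow> iso2 B (Unit1 B (Src B M) \<odot> M) M (LUnit B M)"
    and RUnit_iso: "M \<in> Cells1 B \<Longrightarrow> iso2 B (M \<odot> Unit1 B (Trg B M)) M (RUnit B M)"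
    and Assoc_natural: "\<lbrakk>f \<in> Cells2 B M M'; h \<in> Cells2 B N N'; k \<in> Cells2 B P P';
        Trg B M = Src B N; Trg B N = Src B P\<rbrakk>
      \<Longrightarrow> Assoc B M' N' P' \<cdot> (f \<star> h \<star> k) = (f \<star> (h \<star> k)) \<cdot> Assoc B M N P"
    and LUnit_natural: "f \<in> Cells2 B M M'
      \<Longrightarrow> LUnit B M' \<cdot> (Id2 B (Unit1 B (Src B M)) \<star> f) = f \<cdot> LUnit B M"
    and RUnit_natural: "f \<in> Cells2 B M M'
      \<Longrightarrow> RUnit B M' \<cdot> (f \<star> Id2 B (Unit1 B (Trg B M))) = f \<cdot> RUnit B M"
    and pentagon: "\<lbrakk>M \<in> Cells1 B; N \<in> Cells1 B; P \<in> Cells1 B; Q \<in> Cells1 B;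
        Trg B M = Src B N; Trg B N = Src B P; Trg B P = Src B Q\<rbrakk>
      \<Longrightarrow> (Id2 B M \<star> Assoc B N P Q) \<cdot> Assoc B M (N \<odot> P) Q \<cdot> (Assoc B M N P \<star> Id2 B Q)
          = Assoc B M N (P \<odot> Q) \<cdot> Assoc B (M \<odot> N) P Q"
    and triangle: "\<lbrakk>M \<in> Cells1 B; N \<in> Cells1 B; Trg B M = Src B N\<rbrakk>
      \<Longrightarrow> (Id2 B M \<star> LUnit B N) \<cdot> Assoc B M (Unit1 B (Trg B M)) N = RUnit B M \<star> Id2 B N"

definition invertible1 :: "('o, 'm, 'c) bicategory \<Rightarrow> 'm \<Rightarrow> bool" where
  "invertible1 B M \<longleftrightarrow> M \<in> Cells1 B \<and>
     (\<exists>N \<in> hom1 B (Trg B M) (Src B M).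
        (\<exists>u. iso2 B (M \<odot>\<^bsub>B\<^esub> N) (Unit1 B (Src B M)) u) \<and>
        (\<exists>v. iso2 B (N \<odot>\<^bsub>B\<^esub> M) (Unit1 B (Trg B M)) v))"

definition is_left_dual ::
  "('o, 'm, 'c) bicategory \<Rightarrow> 'm \<Rightarrow> 'm \<Rightarrow> 'c \<Rightarrow> 'c \<Rightarrow> bool" where
  "is_left_dual B X X' \<eta> \<epsilon> \<longleftrightarrow>
     X \<in> Cells1 B \<and> X' \<in> hom1 B (Trg B X) (Src B X) \<and>
     \<eta> \<in> Cells2 B (Unit1 B (Trg B X)) (X' \<odot>\<^bsub>B\<^esub> X) \<and>
     \<epsilon> \<in> Cells2 B (X \<odot>\<^bsub>B\<^esub> X') (Unit1 B (Src B X)) \<and>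
     LUnit B X \<cdot>\<^bsub>B\<^esub> (\<epsilon> \<star>\<^bsub>B\<^esub> Id2 B X) \<cdot>\<^bsub>B\<^esub> Assoc_inv B X X' X \<cdot>\<^bsub>B\<^esub> (Id2 B X \<star>\<^bsub>B\<^esub> \<eta>) = RUnit B X \<and>
     RUnit B X' \<cdot>\<^bsub>B\<^esub> (Id2 B X' \<star>\<^bsub>B\<^esub> \<epsilon>) \<cdot>\<^bsub>B\<^esub> Assoc B X' X X' \<cdot>\<^bsub>B\<^esub> (\<eta> \<star>\<^bsub>B\<^esub> Id2 B X') = LUnit B X'"

definition left_dualizable :: "('o, 'm, 'c) bicategory \<Rightarrow> 'm \<Rightarrow> bool" where
  "left_dualizable B X \<longleftrightarrow> (\<exists>X' \<eta> \<epsilon>. is_left_dual B X X' \<eta> \<epsilon>)"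

text \<open>\<open>add A C\<close> and \<open>zero A C\<close> are the additive structure of the hom-category from \<open>A\<close> to \<open>C\<close>.\<close>

definition homs_additive ::
  "('o, 'm, 'c) bicategory \<Rightarrow> ('o \<Rightarrow> 'o \<Rightarrow> 'm \<Rightarrow> 'm \<Rightarrow> 'c \<Rightarrow> 'c \<Rightarrow> 'c) \<Rightarrow>
   ('o \<Rightarrow> 'o \<Rightarrow> 'm \<Rightarrow> 'm \<Rightarrow> 'c) \<Rightarrow> bool" where
  "homs_additive B add zero \<longleftrightarrow>
     (\<forall>A\<in>Cells0 B. \<forall>C\<in>Cells0 B. additive_category (hom_category B A C) (add A C) (zero A C))"

definition hcomp_distributes ::
  "('o, 'm, 'c) bicategory \<Rightarrow> ('o \<Rightarrow> 'o \<Rightarrow> 'm \<Rightarrow> 'm \<Rightarrow> 'c \<Rightarrow> 'c \<Rightarrow> 'c) \<Rightarrow>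
   ('o \<Rightarrow> 'o \<Rightarrow> 'm \<Rightarrow> 'm \<Rightarrow> 'c) \<Rightarrow> bool" where
  "hcomp_distributes B add zero \<longleftrightarrow>
     (\<forall>A\<in>Cells0 B. \<forall>C\<in>Cells0 B. \<forall>D\<in>Cells0 B.
        (\<forall>M\<in>hom1 B A C.
           preserves_biproducts (hom_category B C D) (add C D) (zero C D)
             (hom_category B A D) (add A D) (zero A D)
             (\<lambda>N. M \<odot>\<^bsub>B\<^esub> N) (\<lambda>f. Id2 B M \<star>\<^bsub>B\<^esub> f)) \<and>
        (\<forall>N\<in>hom1 B C D.
           preserves_biproducts (hom_category B A C) (add A C) (zero A C)
             (hom_category B A D) (add A D) (zero A D)
             (\<lambda>M. M \<odot>\<^bsub>B\<^esub> N) (\<lambda>f. f \<star>\<^bsub>B\<^esub> Id2 B N)))"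

section \<open>Shadows\<close>

record ('o, 'm, 'c, 't, 'u) shadow =
  ShOb :: "'o \<Rightarrow> 'm \<Rightarrow> 't"
  ShArr :: "'o \<Rightarrow> 'c \<Rightarrow> 'u"
  ShTheta :: "'m \<Rightarrow> 'm \<Rightarrow> 'u"

locale shadow = bicategory B + T: category T
  for B :: "('o, 'm, 'c) bicategory" (structure) and T :: "('t, 'u) category" +
  fixes S :: "('o, 'm, 'c, 't, 'u) shadow"
  assumes Sh_functor: "R \<in> Cells0 B \<Longrightarrow> is_functor (hom_category B R R) T (ShOb S R) (ShArr S R)"
    and theta_iso: "\<lbrakk>M \<in> hom1 B R Q; N \<in> hom1 B Q R\<rbrakk>
      \<Longrightarrow> is_iso T (ShOb S R (M \<odot> N)) (ShOb S Q (N \<odot> M)) (ShTheta S M N)"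
    and theta_natural: "\<lbrakk>M \<in> hom1 B R Q; N \<in> hom1 B Q R; f \<in> Cells2 B M M'; h \<in> Cells2 B N N'\<rbrakk>
      \<Longrightarrow> ShTheta S M' N' \<bullet>\<^bsub>T\<^esub> ShArr S R (f \<star> h) = ShArr S Q (h \<star> f) \<bullet>\<^bsub>T\<^esub> ShTheta S M N"
    and theta_assoc: "\<lbrakk>M \<in> hom1 B R Q; N \<in> hom1 B Q V; P \<in> hom1 B V R\<rbrakk>
      \<Longrightarrow> ShTheta S (M \<odot> N) P =
          ShArr S V (Assoc B P M N) \<bullet>\<^bsub>T\<^esub> ShTheta S N (P \<odot> M) \<bullet>\<^bsub>T\<^esub> ShArr S Q (Assoc B N P M)
            \<bullet>\<^bsub>T\<^esub> ShTheta S M (N \<odot> P) \<bullet>\<^bsub>T\<^esub> ShArr S R (Assoc B M N P)"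
    and theta_unit_right: "M \<in> hom1 B R R
      \<Longrightarrow> ShArr S R (LUnit B M) \<bullet>\<^bsub>T\<^esub> ShTheta S M (Unit1 B R) = ShArr S R (RUnit B M)"
    and theta_unit_left: "M \<in> hom1 B R R
      \<Longrightarrow> ShArr S R (RUnit B M) \<bullet>\<^bsub>T\<^esub> ShTheta S (Unit1 B R) M = ShArr S R (LUnit B M)"

section \<open>Twisting data and the bicategory of twists\<close>

record ('g, 'o, 'm, 'c) twisting =
  Theta :: "'o \<Rightarrow> 'g \<Rightarrow> 'm"
  Mu :: "'o \<Rightarrow> 'g \<Rightarrow> 'g \<Rightarrow> 'c"
  Eta :: "'o \<Rightarrow> 'c"

text \<open>For each 0-cell \<open>A\<close>, a strong monoidal functor from \<open>G\<close>, as a discrete monoidal category,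
  to the monoidal groupoid of invertible 1-cells \<open>A \<rightarrow> A\<close> and invertible 2-cells.\<close>

locale twisting = bicategory B + G: group G
  for B :: "('o, 'm, 'c) bicategory" (structure) and G :: "'g monoid" +
  fixes W :: "('g, 'o, 'm, 'c) twisting"
  assumes Theta_closed: "\<lbrakk>A \<in> Cells0 B; g \<in> carrier G\<rbrakk> \<Longrightarrow> Theta W A g \<in> hom1 B A A"
    and Theta_invertible: "\<lbrakk>A \<in> Cells0 B; g \<in> carrier G\<rbrakk> \<Longrightarrow> invertible1 B (Theta W A g)"
    and Mu_iso: "\<lbrakk>A \<in> Cells0 B; g \<in> carrier G; h \<in> carrier G\<rbrakk>
      \<Longrightarrow> iso2 B (Theta W A g \<odot> Theta W A h) (Theta W A (g \<otimes>\<^bsub>G\<^esub> h)) (Mu W A g h)"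
    and Eta_iso: "A \<in> Cells0 B \<Longrightarrow> iso2 B (Unit1 B A) (Theta W A \<one>\<^bsub>G\<^esub>) (Eta W A)"
    and Mu_assoc: "\<lbrakk>A \<in> Cells0 B; g \<in> carrier G; h \<in> carrier G; k \<in> carrier G\<rbrakk>
      \<Longrightarrow> Mu W A (g \<otimes>\<^bsub>G\<^esub> h) k \<cdot> (Mu W A g h \<star> Id2 B (Theta W A k))
          = Mu W A g (h \<otimes>\<^bsub>G\<^esub> k) \<cdot> (Id2 B (Theta W A g) \<star> Mu W A h k)
              \<cdot> Assoc B (Theta W A g) (Theta W A h) (Theta W A k)"
    and Mu_unit_left: "\<lbrakk>A \<in> Cells0 B; g \<in> carrier G\<rbrakk>
      \<Longrightarrow> Mu W A \<one>\<^bsub>G\<^esub> g \<cdot> (Eta W A \<star> Id2 B (Theta W A g)) = LUnit B (Theta W A g)"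
    and Mu_unit_right: "\<lbrakk>A \<in> Cells0 B; g \<in> carrier G\<rbrakk>
      \<Longrightarrow> Mu W A g \<one>\<^bsub>G\<^esub> \<cdot> (Id2 B (Theta W A g) \<star> Eta W A) = RUnit B (Theta W A g)"

definition Mu_inv ::
  "('o, 'm, 'c) bicategory \<Rightarrow> 'g monoid \<Rightarrow> ('g, 'o, 'm, 'c) twisting \<Rightarrow> 'o \<Rightarrow> 'g \<Rightarrow> 'g \<Rightarrow> 'c" where
  "Mu_inv B G W A g h =
     inv2 B (Theta W A g \<odot>\<^bsub>B\<^esub> Theta W A h) (Theta W A (g \<otimes>\<^bsub>G\<^esub> h)) (Mu W A g h)"

definition Eta_inv ::
  "('o, 'm, 'c) bicategory \<Rightarrow> 'g monoid \<Rightarrow> ('g, 'o, 'm, 'c) twisting \<Rightarrow> 'o \<Rightarrow> 'c" where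
  "Eta_inv B G W A = inv2 B (Unit1 B A) (Theta W A \<one>\<^bsub>G\<^esub>) (Eta W A)"

text \<open>The family \<open>\<tau>\<close> is extensional, i.e. arbitrary but fixed outside the carrier of \<open>G\<close>, so that
  equality of twisted 1-cells does not depend on values outside \<open>G\<close>.\<close>

definition is_twist ::
  "('o, 'm, 'c) bicategory \<Rightarrow> 'g monoid \<Rightarrow> ('g, 'o, 'm, 'c) twisting \<Rightarrow> 'm \<Rightarrow> ('g \<Rightarrow> 'c) \<Rightarrow> bool" where
  "is_twist B G W M \<tau> \<longleftrightarrow>
     (let \<Theta>A = Theta W (Src B M); \<Theta>C = Theta W (Trg B M) in
      \<tau> \<in> extensional (carrier G) \<and>
      (\<forall>g\<in>carrier G. iso2 B (\<Theta>A g \<odot>\<^bsub>B\<^esub> M) (M \<odot>\<^bsub>B\<^esub> \<Theta>C g) (\<tau> g)) \<and>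
      \<tau> \<one>\<^bsub>G\<^esub> = (Id2 B M \<star>\<^bsub>B\<^esub> Eta W (Trg B M)) \<cdot>\<^bsub>B\<^esub> RUnit_inv B M \<cdot>\<^bsub>B\<^esub> LUnit B M
               \<cdot>\<^bsub>B\<^esub> (Eta_inv B G W (Src B M) \<star>\<^bsub>B\<^esub> Id2 B M) \<and>
      (\<forall>g\<in>carrier G. \<forall>h\<in>carrier G.
         \<tau> (g \<otimes>\<^bsub>G\<^esub> h) =
           (Id2 B M \<star>\<^bsub>B\<^esub> Mu W (Trg B M) g h)
           \<cdot>\<^bsub>B\<^esub> Assoc B M (\<Theta>C g) (\<Theta>C h)
           \<cdot>\<^bsub>B\<^esub> (\<tau> g \<star>\<^bsub>B\<^esub> Id2 B (\<Theta>C h))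
           \<cdot>\<^bsub>B\<^esub> Assoc_inv B (\<Theta>A g) M (\<Theta>C h)
           \<cdot>\<^bsub>B\<^esub> (Id2 B (\<Theta>A g) \<star>\<^bsub>B\<^esub> \<tau> h)
           \<cdot>\<^bsub>B\<^esub> Assoc B (\<Theta>A g) (\<Theta>A h) M
           \<cdot>\<^bsub>B\<^esub> (Mu_inv B G W (Src B M) g h \<star>\<^bsub>B\<^esub> Id2 B M)))"

definition twist_cells1 ::
  "('o, 'm, 'c) bicategory \<Rightarrow> 'g monoid \<Rightarrow> ('g, 'o, 'm, 'c) twisting \<Rightarrow> ('m \<times> ('g \<Rightarrow> 'c)) set" where
  "twist_cells1 B G W = {(M, \<tau>). M \<in> Cells1 B \<and> is_twist B G W M \<tau>}"

definition twist_cells2 ::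
  "('o, 'm, 'c) bicategory \<Rightarrow> 'g monoid \<Rightarrow> ('g, 'o, 'm, 'c) twisting \<Rightarrow>
   'm \<times> ('g \<Rightarrow> 'c) \<Rightarrow> 'm \<times> ('g \<Rightarrow> 'c) \<Rightarrow> 'c set" where
  "twist_cells2 B G W = (\<lambda>(M, \<tau>) (N, \<sigma>).
     {f \<in> Cells2 B M N. (M, \<tau>) \<in> twist_cells1 B G W \<and> (N, \<sigma>) \<in> twist_cells1 B G W \<and>
        (\<forall>g\<in>carrier G.
           \<sigma> g \<cdot>\<^bsub>B\<^esub> (Id2 B (Theta W (Src B M) g) \<star>\<^bsub>B\<^esub> f)
           = (f \<star>\<^bsub>B\<^esub> Id2 B (Theta W (Trg B M) g)) \<cdot>\<^bsub>B\<^esub> \<tau> g)})"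

definition twist_hcomp1 ::
  "('o, 'm, 'c) bicategory \<Rightarrow> 'g monoid \<Rightarrow> ('g, 'o, 'm, 'c) twisting \<Rightarrow>
   'm \<times> ('g \<Rightarrow> 'c) \<Rightarrow> 'm \<times> ('g \<Rightarrow> 'c) \<Rightarrow> 'm \<times> ('g \<Rightarrow> 'c)" where
  "twist_hcomp1 B G W = (\<lambda>(M, \<tau>) (N, \<sigma>).
     (M \<odot>\<^bsub>B\<^esub> N,
      \<lambda>g\<in>carrier G.
        Assoc_inv B M N (Theta W (Trg B N) g)
        \<cdot>\<^bsub>B\<^esub> (Id2 B M \<star>\<^bsub>B\<^esub> \<sigma> g)
        \<cdot>\<^bsub>B\<^esub> Assoc B M (Theta W (Trg B M) g) N
        \<cdot>\<^bsub>B\<^esub> (\<tau> g \<star>\<^bsub>B\<^esub> Id2 B N)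
        \<cdot>\<^bsub>B\<^esub> Assoc_inv B (Theta W (Src B M) g) M N))"

definition twist_unit1 ::
  "('o, 'm, 'c) bicategory \<Rightarrow> 'g monoid \<Rightarrow> ('g, 'o, 'm, 'c) twisting \<Rightarrow> 'o \<Rightarrow> 'm \<times> ('g \<Rightarrow> 'c)" where
  "twist_unit1 B G W A =
     (Unit1 B A,
      \<lambda>g\<in>carrier G. LUnit_inv B (Theta W A g) \<cdot>\<^bsub>B\<^esub> RUnit B (Theta W A g))"

text \<open>Units, associators and vertical and horizontal composites of 2-cells are those of \<open>B\<close>.\<close>

definition twist_bicategory ::
  "('o, 'm, 'c) bicategory \<Rightarrow> 'g monoid \<Rightarrow> ('g, 'o, 'm, 'c) twisting \<Rightarrow>
   ('o, 'm \<times> ('g \<Rightarrow> 'c), 'c) bicategory" where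
  "twist_bicategory B G W =
     \<lparr>Cells0 = Cells0 B,
      Cells1 = twist_cells1 B G W,
      Src = (\<lambda>X. Src B (fst X)),
      Trg = (\<lambda>X. Trg B (fst X)),
      Cells2 = twist_cells2 B G W,
      Id2 = (\<lambda>X. Id2 B (fst X)),
      VComp = VComp B,
      Unit1 = twist_unit1 B G W,
      HComp1 = twist_hcomp1 B G W,
      HComp2 = HComp2 B,
      Assoc = (\<lambda>X Y Z. Assoc B (fst X) (fst Y) (fst Z)),
      LUnit = (\<lambda>X. LUnit B (fst X)),
      RUnit = (\<lambda>X. RUnit B (fst X))\<rparr>"

section \<open>Twisted shadows and traces\<close>

text \<open>The transport map \<open>g\<^sub>M\<close> of \<open>(M, \<tau>)\<close>, from \<open>M \<odot> \<Theta>(g\<^sup>-\<^sup>1)\<close> to \<open>\<Theta>(g\<^sup>-\<^sup>1) \<odot> M\<close>.\<close>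

definition transport ::
  "('o, 'm, 'c) bicategory \<Rightarrow> 'g monoid \<Rightarrow> ('g, 'o, 'm, 'c) twisting \<Rightarrow>
   'g \<Rightarrow> 'm \<times> ('g \<Rightarrow> 'c) \<Rightarrow> 'c" where
  "transport B G W g = (\<lambda>(M, \<tau>).
     inv2 B (Theta W (Src B M) (inv\<^bsub>G\<^esub> g) \<odot>\<^bsub>B\<^esub> M) (M \<odot>\<^bsub>B\<^esub> Theta W (Trg B M) (inv\<^bsub>G\<^esub> g))
       (\<tau> (inv\<^bsub>G\<^esub> g)))"

definition twShOb ::
  "('o, 'm, 'c) bicategory \<Rightarrow> 'g monoid \<Rightarrow> ('g, 'o, 'm, 'c) twisting \<Rightarrow>
   ('o, 'm, 'c, 't, 'u) shadow \<Rightarrow> 'g \<Rightarrow> 'o \<Rightarrow> 'm \<times> ('g \<Rightarrow> 'c) \<Rightarrow> 't" where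
  "twShOb B G W S g R X = ShOb S R (Theta W R (inv\<^bsub>G\<^esub> g) \<odot>\<^bsub>B\<^esub> fst X)"

definition twShArr ::
  "('o, 'm, 'c) bicategory \<Rightarrow> 'g monoid \<Rightarrow> ('g, 'o, 'm, 'c) twisting \<Rightarrow>
   ('o, 'm, 'c, 't, 'u) shadow \<Rightarrow> 'g \<Rightarrow> 'o \<Rightarrow> 'c \<Rightarrow> 'u" where
  "twShArr B G W S g R f = ShArr S R (Id2 B (Theta W R (inv\<^bsub>G\<^esub> g)) \<star>\<^bsub>B\<^esub> f)"

text \<open>Twisted cyclicity for \<open>X = (M, \<tau>) : R \<rightarrow> Q\<close> and \<open>Y = (N, \<sigma>) : Q \<rightarrow> R\<close>.\<close>

definition twShTheta ::
  "('o, 'm, 'c) bicategory \<Rightarrow> 'g monoid \<Rightarrow> ('g, 'o, 'm, 'c) twisting \<Rightarrow> ('t, 'u) category \<Rightarrow>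
   ('o, 'm, 'c, 't, 'u) shadow \<Rightarrow> 'g \<Rightarrow> 'm \<times> ('g \<Rightarrow> 'c) \<Rightarrow> 'm \<times> ('g \<Rightarrow> 'c) \<Rightarrow> 'u" where
  "twShTheta B G W T S g X Y =
     (let M = fst X; N = fst Y; R = Src B M; Q = Trg B M;
          \<Theta>R = Theta W R (inv\<^bsub>G\<^esub> g); \<Theta>Q = Theta W Q (inv\<^bsub>G\<^esub> g) in
      ShArr S Q (Assoc B \<Theta>Q N M)
      \<bullet>\<^bsub>T\<^esub> ShArr S Q (transport B G W g Y \<star>\<^bsub>B\<^esub> Id2 B M)
      \<bullet>\<^bsub>T\<^esub> ShArr S Q (Assoc_inv B N \<Theta>R M)
      \<bullet>\<^bsub>T\<^esub> ShTheta S (\<Theta>R \<odot>\<^bsub>B\<^esub> M) N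
      \<bullet>\<^bsub>T\<^esub> ShArr S R (Assoc_inv B \<Theta>R M N))"

text \<open>The twisted trace of \<open>f : X \<Rightarrow> X\<close> computed with the left dual \<open>(X', \<eta>, \<epsilon>)\<close> of \<open>X\<close>.\<close>

definition twisted_trace ::
  "('o, 'm, 'c) bicategory \<Rightarrow> 'g monoid \<Rightarrow> ('g, 'o, 'm, 'c) twisting \<Rightarrow> ('t, 'u) category \<Rightarrow>
   ('o, 'm, 'c, 't, 'u) shadow \<Rightarrow> 'g \<Rightarrow>
   'm \<times> ('g \<Rightarrow> 'c) \<Rightarrow> 'm \<times> ('g \<Rightarrow> 'c) \<Rightarrow> 'c \<Rightarrow> 'c \<Rightarrow> 'c \<Rightarrow> 'u" where
  "twisted_trace B G W T S g X X' \<eta> \<epsilon> f =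
     (let A = Src B (fst X); C = Trg B (fst X) in
      twShArr B G W S g A \<epsilon>
      \<bullet>\<^bsub>T\<^esub> twShTheta B G W T S g X' X
      \<bullet>\<^bsub>T\<^esub> twShArr B G W S g C (Id2 B (fst X') \<star>\<^bsub>B\<^esub> f)
      \<bullet>\<^bsub>T\<^esub> twShArr B G W S g C \<eta>)"

end

theory Submission
  imports Defs
begin

text \<open>Let \<open>Z = X \<oplus> Y\<close> with inclusions \<open>i\<close>, \<open>j\<close> and projections \<open>p\<close>, \<open>q\<close>, so that
\<open>f\<^sub>X \<oplus> f\<^sub>Y = i f\<^sub>X p + j f\<^sub>Y q\<close>, and let \<open>Z'\<close> be any left dual of \<open>Z\<close>. The trace of an endomorphism \<open>f\<close> of
\<open>Z\<close> has the form \<open>l F(f) r\<close>, where \<open>l\<close> and \<open>r\<close> do not depend on \<open>f\<close> and \<open>F\<close>, the twisted shadow of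
\<open>Z' \<odot> -\<close>, is a functor that preserves biproducts. Such a functor is additive on sums of this kind
and composition in the target category is bilinear, hence
\<open>tr(f\<^sub>X \<oplus> f\<^sub>Y) = tr(i f\<^sub>X p) + tr(j f\<^sub>Y q)\<close>. The trace is cyclic, \<open>tr(h f) = tr(f h)\<close> for
\<open>f : X \<Rightarrow> Z\<close> and \<open>h : Z \<Rightarrow> X\<close> and for all choices of duals of \<open>X\<close> and \<open>Z\<close>
(\<open>twisted_trace_cyclic\<close>), so \<open>tr(i f\<^sub>X p) = tr(p i f\<^sub>X) = tr(f\<^sub>X)\<close>, and likewise for \<open>Y\<close>.

Cyclicity has two ingredients. The first is the mate \<open>h\<^sup>* : X' \<Rightarrow> Z'\<close> of \<open>h\<close>, which lets \<open>h\<close> pass through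
coevaluations and evaluations (\<open>mate_laws\<close>). The second is naturality of the twisted cyclicity
isomorphism (\<open>twShTheta_natural\<close>). Its argument that is rotated past \<open>\<Theta>(g\<^sup>-\<^sup>1)\<close> may vary along 2-cells of
the bicategory of twists, since these commute with the transport maps; its other argument may vary
along all 2-cells of \<open>B\<close>, in particular along a mate.

The dual of \<open>Z\<close> is \<open>X' \<oplus> Y'\<close>, with coevaluation \<open>(i' \<star> i) \<eta>\<^sub>X + (j' \<star> j) \<eta>\<^sub>Y\<close> and evaluation
\<open>\<epsilon>\<^sub>X (p \<star> p') + \<epsilon>\<^sub>Y (q \<star> q')\<close>. Restricted to a summand, each triangle identity of \<open>Z\<close> becomes the one of that
summand, because the cross terms vanish; and the inclusions of the summands are jointly epic
(\<open>left_dualizable_biproduct\<close>).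

These arguments use the bicategory of twists as a bicategory (\<open>bicategory_Tw\<close>). Its 2-cells compose
as in \<open>B\<close>, so every equation between them is inherited. The content is that composites and units of
twists are twists, and that horizontal composites and the coherence 2-cells are compatible with the
twists; this is a computation with pentagons, done for single squares in an arbitrary bicategory.\<close>

section \<open>Typed 2-cells\<close>

text \<open>A 2-cell together with its source and target. Hom-sets may overlap, so a 2-cell alone does not
determine its ends; with the ends attached, composability is an equation between 1-cells. The value
\<open>Null\<close> stands for composites of 2-cells that do not fit together.\<close>
datatype ('m, 'c) cell = Null | Cell (dm: 'm) (raw: 'c) (cd: 'm)

context bicategory
begin

lemma HComp1_Cells1 [simp]:
  assumes "M \<in> Cells1 B" "N \<in> Cells1 B" "Trg B M = Src B N"
  shows "M \<odot> N \<in> Cells1 B" "Src B (M \<odot> N) = Src B M" "Trg B (M \<odot> N) = Trg B N"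
  using HComp1_closed[of M "Src B M" "Trg B M" N "Trg B N"] assms by (auto simp: hom1_def)

lemma Unit1_Cells1 [simp]:
  assumes "R \<in> Cells0 B"
  shows "Unit1 B R \<in> Cells1 B" "Src B (Unit1 B R) = R" "Trg B (Unit1 B R) = R"
  using Unit1_closed[OF assms] by (auto simp: hom1_def)

lemmas [simp] = Src_closed Trg_closed

lemma category_hom_Cells1: "M \<in> Cells1 B \<Longrightarrow> category (hom_category B (Src B M) (Trg B M))"
  by (simp add: category_hom)

lemma Id2_closed: "M \<in> Cells1 B \<Longrightarrow> Id2 B M \<in> Cells2 B M M"
  using category.Id_closed[OF category_hom_Cells1, of M M] by (simp add: hom_category_def hom1_def)

lemma VComp_closed: "\<lbrakk>f \<in> Cells2 B M N; h \<in> Cells2 B N P\<rbrakk> \<Longrightarrow> h \<cdot> f \<in> Cells2 B M P"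
  using category.Comp_closed[OF category_hom_Cells1, of M M N P f h] Cells2_parallel[of f M N]
    Cells2_parallel[of h N P] by (simp add: hom_category_def hom1_def)

lemma VComp_Id2: "f \<in> Cells2 B M N \<Longrightarrow> f \<cdot> Id2 B M = f"
  using category.Comp_Id[OF category_hom_Cells1, of M M N f] Cells2_parallel[of f M N]
  by (simp add: hom_category_def hom1_def)

lemma Id2_VComp: "f \<in> Cells2 B M N \<Longrightarrow> Id2 B N \<cdot> f = f"
  using category.Id_Comp[OF category_hom_Cells1, of M M N f] Cells2_parallel[of f M N]
  by (simp add: hom_category_def hom1_def)

lemma VComp_assoc:
  "\<lbrakk>f \<in> Cells2 B M N; h \<in> Cells2 B N P; k \<in> Cells2 B P Q\<rbrakk> \<Longrightarrow> k \<cdot> h \<cdot> f = k \<cdot> (h \<cdot> f)"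
  using category.Comp_assoc[OF category_hom_Cells1, of M M N P Q f h k] Cells2_parallel[of f M N]
    Cells2_parallel[of h N P] Cells2_parallel[of k P Q] by (simp add: hom_category_def hom1_def)

definition inverse2 :: "'m \<Rightarrow> 'm \<Rightarrow> 'c \<Rightarrow> 'c \<Rightarrow> bool" where
  "inverse2 M N f h \<longleftrightarrow> f \<in> Cells2 B M N \<and> h \<in> Cells2 B N M \<and> h \<cdot> f = Id2 B M \<and> f \<cdot> h = Id2 B N"

lemma inverse2_unique:
  assumes "inverse2 M N f h" "inverse2 M N f h'"
  shows "h = h'"
proof -
  have "h \<cdot> f \<cdot> h' = h \<cdot> (f \<cdot> h')"
    using assms by (intro VComp_assoc) (auto simp: inverse2_def)
  thus ?thesis using assms by (auto simp: inverse2_def Id2_VComp VComp_Id2)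
qed

lemma inv2_eqI: "inverse2 M N f h \<Longrightarrow> inv2 B M N f = h"
  unfolding inv2_def the_inverse_def
  by (rule the_equality) (auto simp: is_inverse_def hom_category_def inverse2_def
      intro: inverse2_unique[unfolded inverse2_def])

lemma iso2_iff: "iso2 B M N f \<longleftrightarrow> (\<exists>h. inverse2 M N f h)"
  by (simp add: iso2_def is_iso_def is_inverse_def hom_category_def inverse2_def)

lemma iso2_inverse2: "iso2 B M N f \<Longrightarrow> inverse2 M N f (inv2 B M N f)"
  using inv2_eqI iso2_iff by metis

definition is_cell :: "('m, 'c) cell \<Rightarrow> bool" where
  "is_cell f \<longleftrightarrow> f \<noteq> Null \<and> raw f \<in> Cells2 B (dm f) (cd f)"

definition vc :: "('m, 'c) cell \<Rightarrow> ('m, 'c) cell \<Rightarrow> ('m, 'c) cell" (infixr "\<circ>\<^sub>v" 55) where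
  "f \<circ>\<^sub>v h = (if is_cell f \<and> is_cell h \<and> dm f = cd h then Cell (dm h) (raw f \<cdot> raw h) (cd f) else Null)"

definition hc :: "('m, 'c) cell \<Rightarrow> ('m, 'c) cell \<Rightarrow> ('m, 'c) cell" (infixr "\<star>\<^sub>h" 60) where
  "f \<star>\<^sub>h h = (if is_cell f \<and> is_cell h \<and> Trg B (dm f) = Src B (dm h)
     then Cell (dm f \<odot> dm h) (raw f \<star> raw h) (cd f \<odot> cd h) else Null)"

definition idc :: "'m \<Rightarrow> ('m, 'c) cell" where "idc M = Cell M (Id2 B M) M"

definition asc :: "'m \<Rightarrow> 'm \<Rightarrow> 'm \<Rightarrow> ('m, 'c) cell" where
  "asc M N P = Cell (M \<odot> N \<odot> P) (Assoc B M N P) (M \<odot> (N \<odot> P))"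

definition asci :: "'m \<Rightarrow> 'm \<Rightarrow> 'm \<Rightarrow> ('m, 'c) cell" where
  "asci M N P = Cell (M \<odot> (N \<odot> P)) (Assoc_inv B M N P) (M \<odot> N \<odot> P)"

definition lu :: "'m \<Rightarrow> ('m, 'c) cell" where
  "lu M = Cell (Unit1 B (Src B M) \<odot> M) (LUnit B M) M"

definition lui :: "'m \<Rightarrow> ('m, 'c) cell" where
  "lui M = Cell M (LUnit_inv B M) (Unit1 B (Src B M) \<odot> M)"

definition ru :: "'m \<Rightarrow> ('m, 'c) cell" where
  "ru M = Cell (M \<odot> Unit1 B (Trg B M)) (RUnit B M) M"

definition rui :: "'m \<Rightarrow> ('m, 'c) cell" where
  "rui M = Cell M (RUnit_inv B M) (M \<odot> Unit1 B (Trg B M))"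

abbreviation typed :: "('m, 'c) cell \<Rightarrow> 'm \<Rightarrow> 'm \<Rightarrow> bool" where
  "typed f M N \<equiv> is_cell f \<and> dm f = M \<and> cd f = N"

lemma dm_cd [simp]:
  assumes "is_cell f"
  shows "dm f \<in> Cells1 B" "cd f \<in> Cells1 B" "Src B (cd f) = Src B (dm f)" "Trg B (cd f) = Trg B (dm f)"
  using assms Cells2_parallel[of "raw f" "dm f" "cd f"] by (auto simp: is_cell_def)

lemma not_is_cell_Null [simp]: "\<not> is_cell Null" by (simp add: is_cell_def)

lemma typed_vc [simp]:
  assumes "is_cell f" "is_cell h" "dm f = cd h"
  shows "is_cell (f \<circ>\<^sub>v h)" "dm (f \<circ>\<^sub>v h) = dm h" "cd (f \<circ>\<^sub>v h) = cd f"
  using assms VComp_closed[of "raw h" "dm h" "cd h" "raw f" "cd f"] by (auto simp: vc_def is_cell_def)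

lemma is_cell_vc: "is_cell (f \<circ>\<^sub>v h) \<longleftrightarrow> is_cell f \<and> is_cell h \<and> dm f = cd h"
  by (metis not_is_cell_Null typed_vc(1) vc_def)

lemma vc_nonNull: "f \<circ>\<^sub>v h = Null \<longleftrightarrow> \<not> is_cell (f \<circ>\<^sub>v h)"
  using is_cell_vc vc_def by (metis cell.distinct(1) not_is_cell_Null)

text \<open>This holds without conditions: if some pair of neighbours does not fit together, both sides
are \<open>Null\<close>. Long composites can therefore be rewritten without checking types along the way.\<close>
lemma vc_assoc [simp]: "(f \<circ>\<^sub>v h) \<circ>\<^sub>v k = f \<circ>\<^sub>v h \<circ>\<^sub>v k"
proof (cases "is_cell f \<and> is_cell h \<and> is_cell k \<and> dm f = cd h \<and> dm h = cd k")
  case True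
  hence "raw f \<cdot> raw h \<cdot> raw k = raw f \<cdot> (raw h \<cdot> raw k)"
    by (intro VComp_assoc[of _ "dm k" "dm h" _ "dm f" _ "cd f"]) (auto simp: is_cell_def)
  with True show ?thesis
    using typed_vc[of f h] typed_vc[of h k] by (simp add: vc_def)
next
  case False
  have "\<not> is_cell ((f \<circ>\<^sub>v h) \<circ>\<^sub>v k)" "\<not> is_cell (f \<circ>\<^sub>v h \<circ>\<^sub>v k)"
    using False by (auto simp: is_cell_vc)
  thus ?thesis using vc_nonNull by metis
qed

text \<open>Composites are kept bracketed to the right. An equation between two of them then applies at the
head of a longer composite only in a form with a tail \<open>x\<close>.\<close>
lemma vc_assoc_eq2: "f \<circ>\<^sub>v h = k \<Longrightarrow> f \<circ>\<^sub>v h \<circ>\<^sub>v x = k \<circ>\<^sub>v x"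
  using vc_assoc by metis

lemma vc_assoc_eq3: "f \<circ>\<^sub>v h \<circ>\<^sub>v k = m \<Longrightarrow> f \<circ>\<^sub>v h \<circ>\<^sub>v k \<circ>\<^sub>v x = m \<circ>\<^sub>v x"
  using vc_assoc by metis

lemma vc_assoc_eq4: "f \<circ>\<^sub>v h \<circ>\<^sub>v k \<circ>\<^sub>v l = m \<Longrightarrow> f \<circ>\<^sub>v h \<circ>\<^sub>v k \<circ>\<^sub>v l \<circ>\<^sub>v x = m \<circ>\<^sub>v x"
  using vc_assoc by metis

lemma typed_hc [simp]:
  assumes "is_cell f" "is_cell h" "Trg B (dm f) = Src B (dm h)"
  shows "is_cell (f \<star>\<^sub>h h)" "dm (f \<star>\<^sub>h h) = dm f \<odot> dm h" "cd (f \<star>\<^sub>h h) = cd f \<odot> cd h"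
  using assms HComp2_closed[of "raw f" "dm f" "cd f" "raw h" "dm h" "cd h"]
  by (auto simp: hc_def is_cell_def)

lemma typed_idc [simp]: "dm (idc M) = M" "cd (idc M) = M" "M \<in> Cells1 B \<Longrightarrow> is_cell (idc M)"
  by (auto simp: idc_def is_cell_def Id2_closed)

lemma vc_idc [simp]: "\<lbrakk>is_cell f; dm f = M\<rbrakk> \<Longrightarrow> f \<circ>\<^sub>v idc M = f"
  by (cases f) (auto simp: vc_def idc_def is_cell_def VComp_Id2 Id2_closed dest: Cells2_parallel)

lemma idc_vc [simp]: "\<lbrakk>is_cell f; cd f = M\<rbrakk> \<Longrightarrow> idc M \<circ>\<^sub>v f = f"
  by (cases f) (auto simp: vc_def idc_def is_cell_def Id2_VComp Id2_closed dest: Cells2_parallel)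

lemma idc_hc_idc [simp]: "\<lbrakk>M \<in> Cells1 B; N \<in> Cells1 B; Trg B M = Src B N\<rbrakk> \<Longrightarrow> idc M \<star>\<^sub>h idc N = idc (M \<odot> N)"
  by (simp add: hc_def) (simp add: idc_def HComp2_Id)

lemma hc_vc:
  assumes "is_cell f" "is_cell f'" "dm f' = cd f" "is_cell h" "is_cell h'" "dm h' = cd h"
    "Trg B (dm f) = Src B (dm h)"
  shows "(f' \<circ>\<^sub>v f) \<star>\<^sub>h (h' \<circ>\<^sub>v h) = (f' \<star>\<^sub>h h') \<circ>\<^sub>v (f \<star>\<^sub>h h)"
proof -
  have "(raw f' \<cdot> raw f) \<star> (raw h' \<cdot> raw h) = (raw f' \<star> raw h') \<cdot> (raw f \<star> raw h)"
    using assms by (intro interchange[of _ "dm f" "dm f'" _ "cd f'" _ "dm h" "dm h'" _ "cd h'"])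
      (auto simp: is_cell_def)
  thus ?thesis
    using assms typed_vc[of f' f] typed_vc[of h' h] typed_hc[of f h] typed_hc[of f' h']
    by (simp add: vc_def hc_def)
qed

lemma idc_hc_vc [simp]:
  assumes "M \<in> Cells1 B" "is_cell f" "is_cell h" "dm f = cd h" "Trg B M = Src B (dm h)"
  shows "idc M \<star>\<^sub>h (f \<circ>\<^sub>v h) = (idc M \<star>\<^sub>h f) \<circ>\<^sub>v (idc M \<star>\<^sub>h h)"
  using hc_vc[of "idc M" "idc M" h f] assms by simp

lemma vc_hc_idc [simp]:
  assumes "M \<in> Cells1 B" "is_cell f" "is_cell h" "dm f = cd h" "Trg B (dm h) = Src B M"
  shows "(f \<circ>\<^sub>v h) \<star>\<^sub>h idc M = (f \<star>\<^sub>h idc M) \<circ>\<^sub>v (h \<star>\<^sub>h idc M)"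
  using hc_vc[of h f "idc M" "idc M"] assms by simp

lemma hc_eq_whiskers:
  assumes "is_cell f" "is_cell h" "Trg B (dm f) = Src B (dm h)"
  shows "f \<star>\<^sub>h h = (f \<star>\<^sub>h idc (cd h)) \<circ>\<^sub>v (idc (dm f) \<star>\<^sub>h h)"
    and "f \<star>\<^sub>h h = (idc (cd f) \<star>\<^sub>h h) \<circ>\<^sub>v (f \<star>\<^sub>h idc (dm h))"
  using hc_vc[of "idc (dm f)" f h "idc (cd h)"] hc_vc[of f "idc (cd f)" "idc (dm h)" h] assms by simp_all

lemma whisker_exchange:
  assumes "typed f M M'" "typed h N N'" "Trg B M = Src B N"
  shows "(f \<star>\<^sub>h idc N') \<circ>\<^sub>v (idc M \<star>\<^sub>h h) = (idc M' \<star>\<^sub>h h) \<circ>\<^sub>v (f \<star>\<^sub>h idc N)"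
  using hc_eq_whiskers[of f h] assms by simp

lemma Assoc_inverse2:
  "\<lbrakk>M \<in> Cells1 B; N \<in> Cells1 B; P \<in> Cells1 B; Trg B M = Src B N; Trg B N = Src B P\<rbrakk>
   \<Longrightarrow> inverse2 (M \<odot> N \<odot> P) (M \<odot> (N \<odot> P)) (Assoc B M N P) (Assoc_inv B M N P)"
  unfolding Assoc_inv_def by (intro iso2_inverse2 Assoc_iso)

lemma LUnit_inverse2:
  "M \<in> Cells1 B \<Longrightarrow> inverse2 (Unit1 B (Src B M) \<odot> M) M (LUnit B M) (LUnit_inv B M)"
  unfolding LUnit_inv_def by (intro iso2_inverse2 LUnit_iso)

lemma RUnit_inverse2:
  "M \<in> Cells1 B \<Longrightarrow> inverse2 (M \<odot> Unit1 B (Trg B M)) M (RUnit B M) (RUnit_inv B M)"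
  unfolding RUnit_inv_def by (intro iso2_inverse2 RUnit_iso)

definition invc :: "('m, 'c) cell \<Rightarrow> ('m, 'c) cell \<Rightarrow> bool" where
  "invc f h \<longleftrightarrow> is_cell f \<and> is_cell h \<and> cd h = dm f \<and> dm h = cd f \<and> h \<circ>\<^sub>v f = idc (dm f) \<and> f \<circ>\<^sub>v h = idc (cd f)"

lemma invc_Cell: "inverse2 M N f h \<Longrightarrow> invc (Cell M f N) (Cell N h M)"
  by (auto simp: invc_def inverse2_def is_cell_def vc_def idc_def)

lemma invc_iff_inverse2: "invc (Cell M f N) (Cell N h M) \<longleftrightarrow> inverse2 M N f h"
  by (auto simp: invc_def inverse2_def is_cell_def vc_def idc_def)

lemma invcD:
  assumes "invc f h"
  shows "is_cell f" "is_cell h" "cd h = dm f" "dm h = cd f" "h \<circ>\<^sub>v f = idc (dm f)" "f \<circ>\<^sub>v h = idc (cd f)"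
    "\<lbrakk>is_cell x; cd x = dm f\<rbrakk> \<Longrightarrow> h \<circ>\<^sub>v f \<circ>\<^sub>v x = x" "\<lbrakk>is_cell x; cd x = cd f\<rbrakk> \<Longrightarrow> f \<circ>\<^sub>v h \<circ>\<^sub>v x = x"
  using assms by (auto simp: invc_def) (metis vc_assoc idc_vc)+

lemma invc_sym: "invc f h \<Longrightarrow> invc h f" by (auto simp: invc_def)

lemma invc_vc: "\<lbrakk>invc f h; invc f' h'; dm f' = cd f\<rbrakk> \<Longrightarrow> invc (f' \<circ>\<^sub>v f) (h \<circ>\<^sub>v h')"
  unfolding invc_def by (auto) (metis vc_assoc idc_vc)+

lemma invc_hc: "\<lbrakk>invc f h; invc f' h'; Trg B (dm f) = Src B (dm f')\<rbrakk> \<Longrightarrow> invc (f \<star>\<^sub>h f') (h \<star>\<^sub>h h')"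
  by (auto simp: invc_def simp flip: hc_vc)

lemma invc_idc [simp]: "M \<in> Cells1 B \<Longrightarrow> invc (idc M) (idc M)" by (simp add: invc_def)

lemma invc_asc:
  "\<lbrakk>M \<in> Cells1 B; N \<in> Cells1 B; P \<in> Cells1 B; Trg B M = Src B N; Trg B N = Src B P\<rbrakk>
   \<Longrightarrow> invc (asc M N P) (asci M N P)"
  unfolding asc_def asci_def by (intro invc_Cell Assoc_inverse2)

lemma invc_lu: "M \<in> Cells1 B \<Longrightarrow> invc (lu M) (lui M)"
  unfolding lu_def lui_def by (intro invc_Cell LUnit_inverse2)

lemma invc_ru: "M \<in> Cells1 B \<Longrightarrow> invc (ru M) (rui M)"
  unfolding ru_def rui_def by (intro invc_Cell RUnit_inverse2)

lemma ends [simp]: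
  "dm (asc M N P) = M \<odot> N \<odot> P" "cd (asc M N P) = M \<odot> (N \<odot> P)"
  "dm (asci M N P) = M \<odot> (N \<odot> P)" "cd (asci M N P) = M \<odot> N \<odot> P"
  "dm (lu M) = Unit1 B (Src B M) \<odot> M" "cd (lu M) = M" "dm (lui M) = M" "cd (lui M) = Unit1 B (Src B M) \<odot> M"
  "dm (ru M) = M \<odot> Unit1 B (Trg B M)" "cd (ru M) = M" "dm (rui M) = M" "cd (rui M) = M \<odot> Unit1 B (Trg B M)"
  by (auto simp: asc_def asci_def lu_def lui_def ru_def rui_def)

lemma is_cell_asc [simp]:
  assumes "M \<in> Cells1 B" "N \<in> Cells1 B" "P \<in> Cells1 B" "Trg B M = Src B N" "Trg B N = Src B P"
  shows "is_cell (asc M N P)" "is_cell (asci M N P)"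
  using invc_asc[OF assms] by (auto simp: invc_def)

lemma is_cell_unitors [simp]:
  assumes "M \<in> Cells1 B"
  shows "is_cell (lu M)" "is_cell (lui M)" "is_cell (ru M)" "is_cell (rui M)"
  using invc_lu[OF assms] invc_ru[OF assms] by (auto simp: invc_def)

lemma asc_natural:
  assumes "typed f M M'" "typed h N N'" "typed k P P'" "Trg B M = Src B N" "Trg B N = Src B P"
  shows "asc M' N' P' \<circ>\<^sub>v ((f \<star>\<^sub>h h) \<star>\<^sub>h k) = (f \<star>\<^sub>h (h \<star>\<^sub>h k)) \<circ>\<^sub>v asc M N P"
proof -
  have "is_cell (asc M N P)" "is_cell (asc M' N' P')"
    using assms dm_cd[of f] dm_cd[of h] dm_cd[of k] by auto
  moreover have "Assoc B M' N' P' \<cdot> (raw f \<star> raw h \<star> raw k) = (raw f \<star> (raw h \<star> raw k)) \<cdot> Assoc B M N P"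
    using assms by (intro Assoc_natural) (auto simp: is_cell_def)
  moreover note typed_hc[of f h] typed_hc[of h k] typed_hc[of "f \<star>\<^sub>h h" k] typed_hc[of f "h \<star>\<^sub>h k"]
  ultimately show ?thesis
    using assms dm_cd[of f] dm_cd[of h] dm_cd[of k] by (simp add: vc_def hc_def asc_def)
qed

text \<open>Inverting two opposite sides of a commuting square. Naturality of inverse associators and of transport
maps, and the twist condition for inverse 2-cells, are obtained in this way.\<close>
lemma invc_square:
  assumes "invc f f'" "invc h h'" "f \<circ>\<^sub>v k = l \<circ>\<^sub>v h" "is_cell k" "is_cell l" "dm f = cd k" "dm l = cd h"
  shows "f' \<circ>\<^sub>v l = k \<circ>\<^sub>v h'"
proof -
  note D = invcD[OF assms(1)] invcD[OF assms(2)]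
  have "dm k = dm h" using arg_cong[OF assms(3), of dm] assms(4-) D by simp
  have "f' \<circ>\<^sub>v l = f' \<circ>\<^sub>v (l \<circ>\<^sub>v h) \<circ>\<^sub>v h'"
    using assms(4-) D by simp
  also have "\<dots> = f' \<circ>\<^sub>v f \<circ>\<^sub>v k \<circ>\<^sub>v h'" by (simp flip: assms(3))
  also have "\<dots> = k \<circ>\<^sub>v h'" using assms(4-) D \<open>dm k = dm h\<close> by simp
  finally show ?thesis .
qed

lemma asci_natural:
  assumes "typed f M M'" "typed h N N'" "typed k P P'" "Trg B M = Src B N" "Trg B N = Src B P"
  shows "asci M' N' P' \<circ>\<^sub>v (f \<star>\<^sub>h (h \<star>\<^sub>h k)) = ((f \<star>\<^sub>h h) \<star>\<^sub>h k) \<circ>\<^sub>v asci M N P"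
  by (rule invc_square[OF invc_asc invc_asc asc_natural])
    (use assms dm_cd[of f] dm_cd[of h] dm_cd[of k] in auto)

lemma lu_natural:
  assumes "typed f M M'"
  shows "lu M' \<circ>\<^sub>v (idc (Unit1 B (Src B M)) \<star>\<^sub>h f) = f \<circ>\<^sub>v lu M"
  using assms LUnit_natural[of "raw f" M M'] dm_cd[of f] typed_hc[of "idc (Unit1 B (Src B M))" f]
    is_cell_unitors[of M] is_cell_unitors[of M'] typed_idc(3)[of "Unit1 B (Src B M)"]
  by (cases f) (simp_all add: vc_def hc_def lu_def idc_def is_cell_def)

lemma ru_natural:
  assumes "typed f M M'"
  shows "ru M' \<circ>\<^sub>v (f \<star>\<^sub>h idc (Unit1 B (Trg B M))) = f \<circ>\<^sub>v ru M"
  using assms RUnit_natural[of "raw f" M M'] dm_cd[of f] typed_hc[of f "idc (Unit1 B (Trg B M))"]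
    is_cell_unitors[of M] is_cell_unitors[of M'] typed_idc(3)[of "Unit1 B (Trg B M)"]
  by (cases f) (simp_all add: vc_def hc_def ru_def idc_def is_cell_def)

lemma raw_simps [simp]:
  "raw (idc M) = Id2 B M" "raw (asc M N P) = Assoc B M N P" "raw (asci M N P) = Assoc_inv B M N P"
  "raw (lu M) = LUnit B M" "raw (lui M) = LUnit_inv B M"
  "raw (ru M) = RUnit B M" "raw (rui M) = RUnit_inv B M"
  "\<lbrakk>is_cell f; is_cell h; dm f = cd h\<rbrakk> \<Longrightarrow> raw (f \<circ>\<^sub>v h) = raw f \<cdot> raw h"
  "\<lbrakk>is_cell f; is_cell h; Trg B (dm f) = Src B (dm h)\<rbrakk> \<Longrightarrow> raw (f \<star>\<^sub>h h) = raw f \<star> raw h"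
  by (simp_all add: idc_def asc_def asci_def lu_def lui_def ru_def rui_def vc_def hc_def)

lemma cell_eqI: "\<lbrakk>is_cell f; is_cell h; dm f = dm h; cd f = cd h; raw f = raw h\<rbrakk> \<Longrightarrow> f = h"
  by (cases f; cases h) (auto simp: is_cell_def)

lemma cell_eq_iff:
  "\<lbrakk>is_cell f; is_cell h; dm f = dm h; cd f = cd h\<rbrakk> \<Longrightarrow> f = h \<longleftrightarrow> raw f = raw h"
  using cell_eqI by metis

lemma asc_pentagon:
  assumes "M \<in> Cells1 B" "N \<in> Cells1 B" "P \<in> Cells1 B" "Q \<in> Cells1 B"
    "Trg B M = Src B N" "Trg B N = Src B P" "Trg B P = Src B Q"
  shows "(idc M \<star>\<^sub>h asc N P Q) \<circ>\<^sub>v asc M (N \<odot> P) Q \<circ>\<^sub>v (asc M N P \<star>\<^sub>h idc Q)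
         = asc M N (P \<odot> Q) \<circ>\<^sub>v asc (M \<odot> N) P Q" (is "?l = ?r")
proof -
  have "((idc M \<star>\<^sub>h asc N P Q) \<circ>\<^sub>v asc M (N \<odot> P) Q) \<circ>\<^sub>v (asc M N P \<star>\<^sub>h idc Q) = ?r"
    by (rule cell_eqI) (use pentagon[OF assms] assms in \<open>simp_all del: vc_assoc\<close>)
  thus ?thesis by simp
qed

lemma asc_triangle:
  assumes "M \<in> Cells1 B" "N \<in> Cells1 B" "Trg B M = Src B N"
  shows "(idc M \<star>\<^sub>h lu N) \<circ>\<^sub>v asc M (Unit1 B (Trg B M)) N = ru M \<star>\<^sub>h idc N"
  by (rule cell_eqI) (use triangle[OF assms] assms in simp_all)

section \<open>Coherence of units and associators\<close>

lemma invc_cancel_right: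
  assumes "invc f f'" "h \<circ>\<^sub>v f = k \<circ>\<^sub>v f" "is_cell h" "is_cell k" "dm h = cd f" "dm k = cd f"
  shows "h = k"
proof -
  have "h \<circ>\<^sub>v f \<circ>\<^sub>v f' = k \<circ>\<^sub>v f \<circ>\<^sub>v f'" using assms(2) by (metis vc_assoc)
  thus ?thesis using assms invcD[OF assms(1)] by simp
qed

lemma invc_cancel_left:
  assumes "invc f f'" "f \<circ>\<^sub>v h = f \<circ>\<^sub>v k" "is_cell h" "is_cell k" "cd h = dm f" "cd k = dm f"
  shows "h = k"
  using assms invcD[OF assms(1)] by metis

lemma invc_move_right:
  assumes "invc f f'" "is_cell h" "is_cell k" "dm h = cd f" "dm k = dm f"
  shows "h = k \<circ>\<^sub>v f' \<longleftrightarrow> h \<circ>\<^sub>v f = k"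
  using assms invcD[OF assms(1)] by (metis vc_assoc vc_idc)

lemmas cancel_simps [simp] = invcD(5-8)[OF invc_asc, unfolded ends] invcD(5-8)[OF invc_lu, unfolded ends]
  invcD(5-8)[OF invc_ru, unfolded ends]

text \<open>Naturality of the unitor conjugates a 2-cell whiskered with a unit into the 2-cell itself.\<close>
lemma Unit_whisker_faithful:
  assumes "typed f M N" "typed h M N" "idc (Unit1 B (Src B M)) \<star>\<^sub>h f = idc (Unit1 B (Src B M)) \<star>\<^sub>h h"
  shows "f = h"
  by (rule invc_cancel_right[OF invc_lu[of M]])
    (use assms lu_natural[of f M N] lu_natural[of h M N] dm_cd[of f] in auto)

lemma whisker_Unit_faithful:
  assumes "typed f M N" "typed h M N" "f \<star>\<^sub>h idc (Unit1 B (Trg B M)) = h \<star>\<^sub>h idc (Unit1 B (Trg B M))"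
  shows "f = h"
  by (rule invc_cancel_right[OF invc_ru[of M]])
    (use assms ru_natural[of f M N] ru_natural[of h M N] dm_cd[of f] in auto)

text \<open>Whiskering with the unit \<open>U\<close> is faithful, so the equation may be checked after \<open>U \<odot> -\<close> and after
composing with an isomorphism from \<open>((U \<odot> U) \<odot> M) \<odot> N\<close>. There both sides are computed by the pentagon
for \<open>U, U, M, N\<close> and the triangle axiom.\<close>
lemma lu_HComp1:
  assumes [simp]: "M \<in> Cells1 B" "N \<in> Cells1 B" "Trg B M = Src B N"
  shows "lu (M \<odot> N) \<circ>\<^sub>v asc (Unit1 B (Src B M)) M N = lu M \<star>\<^sub>h idc N"
proof (rule Unit_whisker_faithful)
  let ?U = "Unit1 B (Src B M)"
  show "typed (lu (M \<odot> N) \<circ>\<^sub>v asc (Unit1 B (Src B M)) M N) (?U \<odot> M \<odot> N) (M \<odot> N)" by simp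
  show "typed (lu M \<star>\<^sub>h idc N) (?U \<odot> M \<odot> N) (M \<odot> N)" by simp
  note pent = asc_pentagon[of ?U ?U M N, simplified]
    and tri1 = asc_triangle[of ?U "M \<odot> N", simplified]
    and tri2 = arg_cong[OF asc_triangle[of ?U M], of "\<lambda>x. x \<star>\<^sub>h idc N", simplified]
    and nat1 = asc_natural[of "ru ?U" "?U \<odot> ?U" ?U "idc M" M M "idc N" N N, simplified]
    and nat2 = asc_natural[of "idc ?U" ?U ?U "lu M" "?U \<odot> M" M "idc N" N N, simplified]
  have "idc ?U \<star>\<^sub>h (lu (M \<odot> N) \<circ>\<^sub>v asc (Unit1 B (Src B M)) M N) = idc ?U \<star>\<^sub>h (lu M \<star>\<^sub>h idc N)"
  proof (rule invc_cancel_right)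
    show "invc (asc ?U (?U \<odot> M) N \<circ>\<^sub>v (asc ?U ?U M \<star>\<^sub>h idc N))
       ((asci ?U ?U M \<star>\<^sub>h idc N) \<circ>\<^sub>v asci ?U (?U \<odot> M) N)"
      by (intro invc_vc invc_hc invc_asc invc_idc) simp_all
    show "(idc ?U \<star>\<^sub>h (lu (M \<odot> N) \<circ>\<^sub>v asc (Unit1 B (Src B M)) M N)) \<circ>\<^sub>v asc ?U (?U \<odot> M) N \<circ>\<^sub>v (asc ?U ?U M \<star>\<^sub>h idc N)
      = (idc ?U \<star>\<^sub>h (lu M \<star>\<^sub>h idc N)) \<circ>\<^sub>v asc ?U (?U \<odot> M) N \<circ>\<^sub>v (asc ?U ?U M \<star>\<^sub>h idc N)"
      by (simp add: pent tri1[THEN vc_assoc_eq2] nat1[symmetric] nat2[symmetric, THEN vc_assoc_eq2] tri2)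
  qed simp_all
  thus "idc (Unit1 B (Src B (Unit1 B (Src B M) \<odot> M \<odot> N))) \<star>\<^sub>h (lu (M \<odot> N) \<circ>\<^sub>v asc (Unit1 B (Src B M)) M N) =
    idc (Unit1 B (Src B (Unit1 B (Src B M) \<odot> M \<odot> N))) \<star>\<^sub>h (lu M \<star>\<^sub>h idc N)" by simp
qed

text \<open>The mirror image of \<open>lu_HComp1\<close>, from the pentagon for \<open>M, N, U, U\<close>.\<close>
lemma ru_HComp1:
  assumes [simp]: "M \<in> Cells1 B" "N \<in> Cells1 B" "Trg B M = Src B N"
  shows "(idc M \<star>\<^sub>h ru N) \<circ>\<^sub>v asc M N (Unit1 B (Trg B N)) = ru (M \<odot> N)"
proof (rule whisker_Unit_faithful)
  let ?U = "Unit1 B (Trg B N)"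
  show "typed ((idc M \<star>\<^sub>h ru N) \<circ>\<^sub>v asc M N (Unit1 B (Trg B N))) (M \<odot> N \<odot> ?U) (M \<odot> N)" by simp
  show "typed (ru (M \<odot> N)) (M \<odot> N \<odot> ?U) (M \<odot> N)" by simp
  note pent = asc_pentagon[of M N ?U ?U, simplified]
    and tri1 = asc_triangle[of "M \<odot> N" ?U, simplified]
    and tri2 = arg_cong[OF asc_triangle[of N ?U], of "\<lambda>x. idc M \<star>\<^sub>h x", simplified]
    and nat1 = asc_natural[of "idc M" M M "idc N" N N "lu ?U" "?U \<odot> ?U" ?U, simplified]
    and nat2 = asc_natural[of "idc M" M M "ru N" "N \<odot> ?U" N "idc ?U" ?U ?U, simplified]
  have "((idc M \<star>\<^sub>h ru N) \<circ>\<^sub>v asc M N ?U) \<star>\<^sub>h idc ?U = ru (M \<odot> N) \<star>\<^sub>h idc ?U"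
  proof (rule invc_cancel_left[OF invc_asc[of M N ?U]])
    show "asc M N ?U \<circ>\<^sub>v (((idc M \<star>\<^sub>h ru N) \<circ>\<^sub>v asc M N ?U) \<star>\<^sub>h idc ?U)
      = asc M N ?U \<circ>\<^sub>v (ru (M \<odot> N) \<star>\<^sub>h idc ?U)"
      by (simp add: nat2[THEN vc_assoc_eq2] tri2[symmetric] pent tri1[symmetric]
        nat1[symmetric] nat1[symmetric, THEN vc_assoc_eq2])
  qed simp_all
  thus "((idc M \<star>\<^sub>h ru N) \<circ>\<^sub>v asc M N (Unit1 B (Trg B N))) \<star>\<^sub>h idc (Unit1 B (Trg B (M \<odot> N \<odot> ?U))) =
    ru (M \<odot> N) \<star>\<^sub>h idc (Unit1 B (Trg B (M \<odot> N \<odot> ?U)))" by simp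
qed

text \<open>Naturality of the left unitor at the left unitor of \<open>U\<close> itself gives \<open>l\<^bsub>UU\<^esub> = U \<star> l\<^sub>U\<close>. By \<open>lu_HComp1\<close> and the
triangle axiom the two unitors of \<open>U\<close> agree after whiskering with \<open>U\<close>.\<close>
lemma lu_Unit1:
  assumes [simp]: "R \<in> Cells0 B"
  shows "lu (Unit1 B R) = ru (Unit1 B R)"
proof (rule whisker_Unit_faithful)
  let ?U = "Unit1 B R"
  have "lu (?U \<odot> ?U) = idc ?U \<star>\<^sub>h lu ?U"
    by (rule invc_cancel_left[OF invc_lu[of ?U]])
      (use lu_natural[of "lu ?U" "?U \<odot> ?U" ?U] in simp_all)
  hence "lu ?U \<star>\<^sub>h idc ?U = ru ?U \<star>\<^sub>h idc ?U"
    using lu_HComp1[of ?U ?U] asc_triangle[of ?U ?U] by simp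
  thus "lu ?U \<star>\<^sub>h idc (Unit1 B (Trg B (?U \<odot> ?U))) = ru ?U \<star>\<^sub>h idc (Unit1 B (Trg B (?U \<odot> ?U)))"
    by simp
qed simp_all

text \<open>The pentagon, solved for each of the partial composites that occur when a twist is moved past a
tensor product.\<close>
lemma asc_pentagon_inv:
  assumes [simp]: "M \<in> Cells1 B" "N \<in> Cells1 B" "P \<in> Cells1 B" "Q \<in> Cells1 B"
    "Trg B M = Src B N" "Trg B N = Src B P" "Trg B P = Src B Q"
  shows "(asc M N P \<star>\<^sub>h idc Q) \<circ>\<^sub>v asci (M \<odot> N) P Q
         = asci M (N \<odot> P) Q \<circ>\<^sub>v (idc M \<star>\<^sub>h asci N P Q) \<circ>\<^sub>v asc M N (P \<odot> Q)" (is ?A)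
    and "asc (M \<odot> N) P Q \<circ>\<^sub>v (asci M N P \<star>\<^sub>h idc Q) \<circ>\<^sub>v asci M (N \<odot> P) Q
         = asci M N (P \<odot> Q) \<circ>\<^sub>v (idc M \<star>\<^sub>h asc N P Q)" (is ?B)
    and "(idc M \<star>\<^sub>h asci N P Q) \<circ>\<^sub>v asc M N (P \<odot> Q) \<circ>\<^sub>v asc (M \<odot> N) P Q
         = asc M (N \<odot> P) Q \<circ>\<^sub>v (asc M N P \<star>\<^sub>h idc Q)" (is ?C)
    and "asci M N (P \<odot> Q) \<circ>\<^sub>v (idc M \<star>\<^sub>h asc N P Q) \<circ>\<^sub>v asc M (N \<odot> P) Q
         = asc (M \<odot> N) P Q \<circ>\<^sub>v (asci M N P \<star>\<^sub>h idc Q)" (is ?D)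
    and "(idc M \<star>\<^sub>h asc N P Q) \<circ>\<^sub>v asc M (N \<odot> P) Q
         = asc M N (P \<odot> Q) \<circ>\<^sub>v asc (M \<odot> N) P Q \<circ>\<^sub>v (asci M N P \<star>\<^sub>h idc Q)" (is ?E)
proof -
  note x = invcD[OF invc_hc[OF invc_idc invc_asc], of M N P Q, simplified]
    and z = invcD[OF invc_hc[OF invc_asc invc_idc], of M N P Q, simplified]
  note pent = asc_pentagon[OF assms]
  have "asci M (N \<odot> P) Q \<circ>\<^sub>v (idc M \<star>\<^sub>h asci N P Q) \<circ>\<^sub>v asc M N (P \<odot> Q) =
    asci M (N \<odot> P) Q \<circ>\<^sub>v (idc M \<star>\<^sub>h asci N P Q) \<circ>\<^sub>v (asc M N (P \<odot> Q) \<circ>\<^sub>v asc (M \<odot> N) P Q) \<circ>\<^sub>v asci (M \<odot> N) P Q"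
    by simp
  thus ?A by (simp add: x flip: pent)
  have "asci M N (P \<odot> Q) \<circ>\<^sub>v (idc M \<star>\<^sub>h asc N P Q) = asci M N (P \<odot> Q) \<circ>\<^sub>v ((idc M \<star>\<^sub>h asc N P Q)
      \<circ>\<^sub>v asc M (N \<odot> P) Q \<circ>\<^sub>v (asc M N P \<star>\<^sub>h idc Q)) \<circ>\<^sub>v (asci M N P \<star>\<^sub>h idc Q) \<circ>\<^sub>v asci M (N \<odot> P) Q"
    by (simp add: z)
  thus ?B unfolding pent by simp
  show ?C by (simp add: x flip: pent)
  have "asci M N (P \<odot> Q) \<circ>\<^sub>v (idc M \<star>\<^sub>h asc N P Q) \<circ>\<^sub>v asc M (N \<odot> P) Q = asci M N (P \<odot> Q)
      \<circ>\<^sub>v ((idc M \<star>\<^sub>h asc N P Q) \<circ>\<^sub>v asc M (N \<odot> P) Q \<circ>\<^sub>v (asc M N P \<star>\<^sub>h idc Q)) \<circ>\<^sub>v (asci M N P \<star>\<^sub>h idc Q)"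
    by (simp add: z)
  thus ?D unfolding pent by simp
  have "(idc M \<star>\<^sub>h asc N P Q) \<circ>\<^sub>v asc M (N \<odot> P) Q = ((idc M \<star>\<^sub>h asc N P Q) \<circ>\<^sub>v asc M (N \<odot> P) Q
      \<circ>\<^sub>v (asc M N P \<star>\<^sub>h idc Q)) \<circ>\<^sub>v (asci M N P \<star>\<^sub>h idc Q)"
    by (simp add: z)
  thus ?E unfolding pent by simp
qed

section \<open>Compatibility squares of composites\<close>

text \<open>Multiplicativity of a composite of twists. Here \<open>P\<close>, \<open>Q\<close> and \<open>R\<close> stand for \<open>\<Theta>(g)\<close>, \<open>\<Theta>(h)\<close> and \<open>\<Theta>(gh)\<close> at the three
0-cells, \<open>m\<close> for \<open>\<mu>\<close>, \<open>t\<close> and \<open>s\<close> for the components of twists of \<open>M\<close> and \<open>N\<close>, and \<open>u\<close> forms the component of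
the composite twist. The hypotheses carry \<open>m\<close> through \<open>M\<close> and \<open>N\<close>. What remains consists of
the same four components on both sides, with \<open>t\<^sub>P\<close> and \<open>s\<^sub>Q\<close> in the opposite order; these two are
exchanged by the interchange law, and the bracketings are matched by six pentagons.\<close>
lemma composite_square_multiplicative:
  assumes [simp]: "M \<in> Cells1 B" "N \<in> Cells1 B" "Trg B M = Src B N"
    "P1 \<in> Cells1 B" "Src B P1 = Src B M" "Trg B P1 = Src B M"
    "Q1 \<in> Cells1 B" "Src B Q1 = Src B M" "Trg B Q1 = Src B M"
    "P2 \<in> Cells1 B" "Src B P2 = Src B N" "Trg B P2 = Src B N"
    "Q2 \<in> Cells1 B" "Src B Q2 = Src B N" "Trg B Q2 = Src B N"
    "P3 \<in> Cells1 B" "Src B P3 = Trg B N" "Trg B P3 = Trg B N"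
    "Q3 \<in> Cells1 B" "Src B Q3 = Trg B N" "Trg B Q3 = Trg B N"
    "is_cell m1" "dm m1 = P1 \<odot> Q1" "cd m1 = R1"
    "is_cell m2" "dm m2 = P2 \<odot> Q2" "cd m2 = R2"
    "is_cell m3" "dm m3 = P3 \<odot> Q3" "cd m3 = R3"
    "is_cell tP" "dm tP = P1 \<odot> M" "cd tP = M \<odot> P2"
    "is_cell tQ" "dm tQ = Q1 \<odot> M" "cd tQ = M \<odot> Q2"
    "is_cell tR" "dm tR = R1 \<odot> M" "cd tR = M \<odot> R2"
    "is_cell sP" "dm sP = P2 \<odot> N" "cd sP = N \<odot> P3"
    "is_cell sQ" "dm sQ = Q2 \<odot> N" "cd sQ = N \<odot> Q3"
    "is_cell sR" "dm sR = R2 \<odot> N" "cd sR = N \<odot> R3"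
   and t: "tR \<circ>\<^sub>v (m1 \<star>\<^sub>h idc M) = (idc M \<star>\<^sub>h m2) \<circ>\<^sub>v asc M P2 Q2 \<circ>\<^sub>v (tP \<star>\<^sub>h idc Q2) \<circ>\<^sub>v asci P1 M Q2
       \<circ>\<^sub>v (idc P1 \<star>\<^sub>h tQ) \<circ>\<^sub>v asc P1 Q1 M"
   and s: "sR \<circ>\<^sub>v (m2 \<star>\<^sub>h idc N) = (idc N \<star>\<^sub>h m3) \<circ>\<^sub>v asc N P3 Q3 \<circ>\<^sub>v (sP \<star>\<^sub>h idc Q3) \<circ>\<^sub>v asci P2 N Q3
       \<circ>\<^sub>v (idc P2 \<star>\<^sub>h sQ) \<circ>\<^sub>v asc P2 Q2 N"
   and u: "\<And>P1 P2 P3 t s. u P1 P2 P3 t s = asci M N P3 \<circ>\<^sub>v (idc M \<star>\<^sub>h s) \<circ>\<^sub>v asc M P2 N \<circ>\<^sub>v (t \<star>\<^sub>h idc N)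
       \<circ>\<^sub>v asci P1 M N"
  shows "u R1 R2 R3 tR sR \<circ>\<^sub>v (m1 \<star>\<^sub>h idc (M \<odot> N)) = (idc (M \<odot> N) \<star>\<^sub>h m3) \<circ>\<^sub>v asc (M \<odot> N) P3 Q3
     \<circ>\<^sub>v (u P1 P2 P3 tP sP \<star>\<^sub>h idc Q3) \<circ>\<^sub>v asci P1 (M \<odot> N) Q3
       \<circ>\<^sub>v (idc P1 \<star>\<^sub>h u Q1 Q2 Q3 tQ sQ) \<circ>\<^sub>v asc P1 Q1 (M \<odot> N)"
proof -
  have [simp]: "R1 \<in> Cells1 B" "Src B R1 = Src B M" "Trg B R1 = Src B M"
    "R2 \<in> Cells1 B" "Src B R2 = Src B N" "Trg B R2 = Src B N"
    "R3 \<in> Cells1 B" "Src B R3 = Trg B N" "Trg B R3 = Trg B N"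
    using dm_cd[of m1] dm_cd[of m2] dm_cd[of m3] by auto
  note n1 = asci_natural[of m1 "P1 \<odot> Q1" R1 "idc M" M M "idc N" N N, simplified]
  note t' = arg_cong[OF t, of "\<lambda>x. x \<star>\<^sub>h idc N", simplified]
  note n2 = asc_natural[of "idc M" M M m2 "P2 \<odot> Q2" R2 "idc N" N N, simplified]
  note s' = arg_cong[OF s, of "\<lambda>x. idc M \<star>\<^sub>h x", simplified]
  note n3 = asci_natural[of "idc M" M M "idc N" N N m3 "P3 \<odot> Q3" R3, simplified]
  note p1 = asc_pentagon_inv(1)[of P1 Q1 M N, simplified]
  note n4 = asci_natural[of "idc P1" P1 P1 tQ "Q1 \<odot> M" "M \<odot> Q2" "idc N" N N, simplified, symmetric]
  note p2 = asc_pentagon[of M P2 Q2 N, simplified]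
  note n5 = asc_natural[of tP "P1 \<odot> M" "M \<odot> P2" "idc Q2" Q2 Q2 "idc N" N N, simplified]
  note p3 = asc_pentagon_inv(2)[of P1 M Q2 N, simplified]
  note n6 = asc_natural[of "idc M" M M "idc P2" P2 P2 sQ "Q2 \<odot> N" "N \<odot> Q3", simplified, symmetric]
  note n7 = whisker_exchange[of tP "P1 \<odot> M" "M \<odot> P2" sQ "Q2 \<odot> N" "N \<odot> Q3", simplified, symmetric]
  note n8 = asci_natural[of "idc P1" P1 P1 "idc M" M M sQ "Q2 \<odot> N" "N \<odot> Q3", simplified, symmetric]
  note p4 = asc_pentagon_inv(2)[of P1 M N Q3, simplified]
  note n9 = asc_natural[of tP "P1 \<odot> M" "M \<odot> P2" "idc N" N N "idc Q3" Q3 Q3, simplified, symmetric]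
  note p5 = asc_pentagon_inv(3)[of M P2 N Q3, simplified]
  note n10 = asc_natural[of "idc M" M M sP "P2 \<odot> N" "N \<odot> P3" "idc Q3" Q3 Q3, simplified, symmetric]
  note p6 = asc_pentagon_inv(4)[of M N P3 Q3, simplified]
  note c = invcD(5-8)[OF invc_hc[OF invc_idc invc_asc], of P1 M N Q3, simplified]
  \<comment> \<open>The multiplications are moved to the far left by naturality and the two hypotheses.\<close>
  have "u R1 R2 R3 tR sR \<circ>\<^sub>v (m1 \<star>\<^sub>h idc (M \<odot> N)) =
    (idc (M \<odot> N) \<star>\<^sub>h m3) \<circ>\<^sub>v asci M N (P3 \<odot> Q3) \<circ>\<^sub>v (idc M \<star>\<^sub>h asc N P3 Q3) \<circ>\<^sub>v (idc M \<star>\<^sub>h (sP \<star>\<^sub>h idc Q3))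
     \<circ>\<^sub>v (idc M \<star>\<^sub>h asci P2 N Q3) \<circ>\<^sub>v (idc M \<star>\<^sub>h (idc P2 \<star>\<^sub>h sQ)) \<circ>\<^sub>v (idc M \<star>\<^sub>h asc P2 Q2 N) \<circ>\<^sub>v asc M (P2 \<odot> Q2) N
     \<circ>\<^sub>v (asc M P2 Q2 \<star>\<^sub>h idc N) \<circ>\<^sub>v ((tP \<star>\<^sub>h idc Q2) \<star>\<^sub>h idc N) \<circ>\<^sub>v (asci P1 M Q2 \<star>\<^sub>h idc N)
         \<circ>\<^sub>v ((idc P1 \<star>\<^sub>h tQ) \<star>\<^sub>h idc N)
     \<circ>\<^sub>v (asc P1 Q1 M \<star>\<^sub>h idc N) \<circ>\<^sub>v asci (P1 \<odot> Q1) M N"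
    by (simp add: u n1 t'[THEN vc_assoc_eq2] n2[THEN vc_assoc_eq2] s'[THEN vc_assoc_eq2] n3[THEN vc_assoc_eq2])
  \<comment> \<open>Three pentagons move the two components for \<open>Q\<close> to the right; \<open>n7\<close> exchanges \<open>tP\<close> and \<open>sQ\<close>.\<close>
  also have "\<dots> = (idc (M \<odot> N) \<star>\<^sub>h m3) \<circ>\<^sub>v asci M N (P3 \<odot> Q3) \<circ>\<^sub>v (idc M \<star>\<^sub>h asc N P3 Q3)
      \<circ>\<^sub>v (idc M \<star>\<^sub>h (sP \<star>\<^sub>h idc Q3))
     \<circ>\<^sub>v (idc M \<star>\<^sub>h asci P2 N Q3) \<circ>\<^sub>v asc M P2 (N \<odot> Q3) \<circ>\<^sub>v (tP \<star>\<^sub>h idc (N \<odot> Q3)) \<circ>\<^sub>v asci P1 M (N \<odot> Q3)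
     \<circ>\<^sub>v (idc P1 \<star>\<^sub>h (idc M \<star>\<^sub>h sQ)) \<circ>\<^sub>v (idc P1 \<star>\<^sub>h asc M Q2 N) \<circ>\<^sub>v (idc P1 \<star>\<^sub>h (tQ \<star>\<^sub>h idc N))
     \<circ>\<^sub>v (idc P1 \<star>\<^sub>h asci Q1 M N) \<circ>\<^sub>v asc P1 Q1 (M \<odot> N)"
    by (simp add: p1 n4[THEN vc_assoc_eq2] p2[THEN vc_assoc_eq3] n5[THEN vc_assoc_eq2] p3[THEN vc_assoc_eq3]
      n6[THEN vc_assoc_eq2] n7[THEN vc_assoc_eq2] n8[THEN vc_assoc_eq2])
  also have "\<dots> = (idc (M \<odot> N) \<star>\<^sub>h m3) \<circ>\<^sub>v asc (M \<odot> N) P3 Q3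
     \<circ>\<^sub>v (u P1 P2 P3 tP sP \<star>\<^sub>h idc Q3) \<circ>\<^sub>v asci P1 (M \<odot> N) Q3
       \<circ>\<^sub>v (idc P1 \<star>\<^sub>h u Q1 Q2 Q3 tQ sQ) \<circ>\<^sub>v asc P1 Q1 (M \<odot> N)"
    by (simp add: u p4[THEN vc_assoc_eq3] n9[symmetric, THEN vc_assoc_eq2] p5[symmetric, THEN vc_assoc_eq2]
      n10[symmetric, THEN vc_assoc_eq2] p6[symmetric, THEN vc_assoc_eq2] c)
  finally show ?thesis .
qed

text \<open>Both sides apply \<open>t\<close>, \<open>s\<close> and \<open>r\<close> in this order and differ only in the bracketing, so that the
associator is moved past one component at a time by naturality, with a pentagon between two components.\<close>
lemma composite_square_asc:
  assumes [simp]: "M \<in> Cells1 B" "N \<in> Cells1 B" "Trg B M = Src B N" "P \<in> Cells1 B" "Trg B N = Src B P"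
    "K1 \<in> Cells1 B" "Src B K1 = Src B M" "Trg B K1 = Src B M"
    "K2 \<in> Cells1 B" "Src B K2 = Src B N" "Trg B K2 = Src B N"
    "K3 \<in> Cells1 B" "Src B K3 = Src B P" "Trg B K3 = Src B P"
    "K4 \<in> Cells1 B" "Src B K4 = Trg B P" "Trg B K4 = Trg B P"
    "is_cell t" "dm t = K1 \<odot> M" "cd t = M \<odot> K2"
    "is_cell s" "dm s = K2 \<odot> N" "cd s = N \<odot> K3"
    "is_cell r" "dm r = K3 \<odot> P" "cd r = P \<odot> K4"
   and u: "\<And>M N K1 K2 K3 t s. u M N K1 K2 K3 t s = asci M N K3 \<circ>\<^sub>v (idc M \<star>\<^sub>h s) \<circ>\<^sub>v asc M K2 N
       \<circ>\<^sub>v (t \<star>\<^sub>h idc N) \<circ>\<^sub>v asci K1 M N"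
  shows "u M (N \<odot> P) K1 K2 K4 t (u N P K2 K3 K4 s r) \<circ>\<^sub>v (idc K1 \<star>\<^sub>h asc M N P)
    = (asc M N P \<star>\<^sub>h idc K4) \<circ>\<^sub>v u (M \<odot> N) P K1 K3 K4 (u M N K1 K2 K3 t s) r"
proof -
  note p1 = asc_pentagon_inv(2)[of K1 M N P, simplified, symmetric]
  note n1 = asc_natural[of t "K1 \<odot> M" "M \<odot> K2" "idc N" N N "idc P" P P, simplified, symmetric]
  note p2 = asc_pentagon_inv(3)[of M K2 N P, simplified]
  note n2 = asc_natural[of "idc M" M M s "K2 \<odot> N" "N \<odot> K3" "idc P" P P, simplified, symmetric]
  note p3 = asc_pentagon_inv(5)[of M N K3 P, simplified]
  note n3 = asc_natural[of "idc M" M M "idc N" N N r "K3 \<odot> P" "P \<odot> K4", simplified, symmetric]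
  note p4 = asc_pentagon_inv(1)[of M N P K4, simplified, symmetric]
  show ?thesis
    by (simp add: u p1 n1[THEN vc_assoc_eq2] p2[THEN vc_assoc_eq3] n2[THEN vc_assoc_eq2]
        p3[THEN vc_assoc_eq2] n3[THEN vc_assoc_eq2] p4[THEN vc_assoc_eq3])
qed

lemma whiskered_triangle_inv:
  assumes [simp]: "M \<in> Cells1 B" "N \<in> Cells1 B" "Trg B M = Src B N"
  shows "(ru M \<star>\<^sub>h idc N) \<circ>\<^sub>v asci M (Unit1 B (Trg B M)) N = idc M \<star>\<^sub>h lu N"
  by (simp flip: asc_triangle[OF assms])

lemma lu_HComp1_inv:
  assumes [simp]: "M \<in> Cells1 B" "N \<in> Cells1 B" "Trg B M = Src B N"
  shows "(lu M \<star>\<^sub>h idc N) \<circ>\<^sub>v asci (Unit1 B (Src B M)) M N = lu (M \<odot> N)"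
    and "asc (Unit1 B (Src B M)) M N \<circ>\<^sub>v (lui M \<star>\<^sub>h idc N) = lui (M \<odot> N)"
proof -
  show "(lu M \<star>\<^sub>h idc N) \<circ>\<^sub>v asci (Unit1 B (Src B M)) M N = lu (M \<odot> N)"
    by (simp flip: lu_HComp1[OF assms])
  show "asc (Unit1 B (Src B M)) M N \<circ>\<^sub>v (lui M \<star>\<^sub>h idc N) = lui (M \<odot> N)"
    by (rule invc_cancel_left[OF invc_lu[of "M \<odot> N"]])
     (use invcD(6)[OF invc_hc[OF invc_lu invc_idc], of M N]
         in \<open>simp_all add: lu_HComp1[OF assms, THEN vc_assoc_eq2]\<close>)
qed

lemma ru_HComp1_inv:
  assumes [simp]: "M \<in> Cells1 B" "N \<in> Cells1 B" "Trg B M = Src B N"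
  shows "ru (M \<odot> N) \<circ>\<^sub>v asci M N (Unit1 B (Trg B N)) = idc M \<star>\<^sub>h ru N"
    and "asci M N (Unit1 B (Trg B N)) \<circ>\<^sub>v (idc M \<star>\<^sub>h rui N) = rui (M \<odot> N)"
proof -
  show *: "ru (M \<odot> N) \<circ>\<^sub>v asci M N (Unit1 B (Trg B N)) = idc M \<star>\<^sub>h ru N"
    by (simp flip: ru_HComp1[OF assms])
  show "asci M N (Unit1 B (Trg B N)) \<circ>\<^sub>v (idc M \<star>\<^sub>h rui N) = rui (M \<odot> N)"
    by (rule invc_cancel_left[OF invc_ru[of "M \<odot> N"]])
     (use invcD(6)[OF invc_hc[OF invc_idc invc_ru], of M N] in \<open>simp_all add: *[THEN vc_assoc_eq2]\<close>)
qed

text \<open>The unit condition of a composite of twists, with \<open>\<eta>\<close> on the left instead of its inverse on the right.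
Between the two unit conditions of \<open>M\<close> and \<open>N\<close> the unitors in the middle cancel by the triangle axiom.\<close>
lemma composite_square_unit:
  assumes [simp]: "M \<in> Cells1 B" "N \<in> Cells1 B" "Trg B M = Src B N"
    "is_cell e1" "dm e1 = Unit1 B (Src B M)" "cd e1 = E1"
    "is_cell e2" "dm e2 = Unit1 B (Src B N)" "cd e2 = E2"
    "is_cell e3" "dm e3 = Unit1 B (Trg B N)" "cd e3 = E3"
    "is_cell t" "dm t = E1 \<odot> M" "cd t = M \<odot> E2"
    "is_cell s" "dm s = E2 \<odot> N" "cd s = N \<odot> E3"
   and t: "t \<circ>\<^sub>v (e1 \<star>\<^sub>h idc M) = (idc M \<star>\<^sub>h e2) \<circ>\<^sub>v rui M \<circ>\<^sub>v lu M"
   and s: "s \<circ>\<^sub>v (e2 \<star>\<^sub>h idc N) = (idc N \<star>\<^sub>h e3) \<circ>\<^sub>v rui N \<circ>\<^sub>v lu N"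
  shows "(asci M N E3 \<circ>\<^sub>v (idc M \<star>\<^sub>h s) \<circ>\<^sub>v asc M E2 N \<circ>\<^sub>v (t \<star>\<^sub>h idc N) \<circ>\<^sub>v asci E1 M N) \<circ>\<^sub>v (e1 \<star>\<^sub>h idc (M \<odot> N))
    = (idc (M \<odot> N) \<star>\<^sub>h e3) \<circ>\<^sub>v rui (M \<odot> N) \<circ>\<^sub>v lu (M \<odot> N)"
proof -
  let ?U = "Unit1 B (Src B N)"
  have [simp]: "E1 \<in> Cells1 B" "Src B E1 = Src B M" "Trg B E1 = Src B M"
    "E2 \<in> Cells1 B" "Src B E2 = Src B N" "Trg B E2 = Src B N"
    "E3 \<in> Cells1 B" "Src B E3 = Trg B N" "Trg B E3 = Trg B N"
    using dm_cd[of e1] dm_cd[of e2] dm_cd[of e3] by auto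
  note n1 = asci_natural[of e1 "Unit1 B (Src B M)" E1 "idc M" M M "idc N" N N, simplified]
    and t' = arg_cong[OF t, of "\<lambda>x. x \<star>\<^sub>h idc N", simplified]
    and n2 = asc_natural[of "idc M" M M e2 ?U E2 "idc N" N N, simplified]
    and s' = arg_cong[OF s, of "\<lambda>x. idc M \<star>\<^sub>h x", simplified]
    and n3 = asci_natural[of "idc M" M M "idc N" N N e3 "Unit1 B (Trg B N)" E3, simplified]
    and tri = asc_triangle[of M N, simplified]
    and r = invcD(6)[OF invc_hc[OF invc_ru invc_idc], of M N, simplified]
    and l = lu_HComp1_inv(1)[of M N, simplified] and r' = ru_HComp1_inv(2)[of M N, simplified]
  show ?thesis
    by (simp add: n1 t'[THEN vc_assoc_eq2] n2[THEN vc_assoc_eq2] s'[THEN vc_assoc_eq2] n3[THEN vc_assoc_eq2]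
       l tri[THEN vc_assoc_eq2] r[THEN vc_assoc_eq2] r'[THEN vc_assoc_eq2])
qed

text \<open>Two squares, for \<open>f\<close> past \<open>K1\<close> and \<open>K2\<close> and for \<open>h\<close> past \<open>K2\<close> and \<open>K3\<close>, are pasted side by side.\<close>
lemma composite_square_hc:
  assumes [simp]: "is_cell f" "dm f = M" "cd f = M'" "is_cell h" "dm h = N" "cd h = N'" "Trg B M = Src B N"
    "K1 \<in> Cells1 B" "Src B K1 = Src B M" "Trg B K1 = Src B M"
    "K2 \<in> Cells1 B" "Src B K2 = Src B N" "Trg B K2 = Src B N"
    "K3 \<in> Cells1 B" "Src B K3 = Trg B N" "Trg B K3 = Trg B N"
    "is_cell t" "dm t = K1 \<odot> M" "cd t = M \<odot> K2"
    "is_cell s" "dm s = K2 \<odot> N" "cd s = N \<odot> K3"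
    "is_cell t'" "dm t' = K1 \<odot> M'" "cd t' = M' \<odot> K2"
    "is_cell s'" "dm s' = K2 \<odot> N'" "cd s' = N' \<odot> K3"
   and t: "t' \<circ>\<^sub>v (idc K1 \<star>\<^sub>h f) = (f \<star>\<^sub>h idc K2) \<circ>\<^sub>v t"
   and s: "s' \<circ>\<^sub>v (idc K2 \<star>\<^sub>h h) = (h \<star>\<^sub>h idc K3) \<circ>\<^sub>v s"
  shows "(asci M' N' K3 \<circ>\<^sub>v (idc M' \<star>\<^sub>h s') \<circ>\<^sub>v asc M' K2 N' \<circ>\<^sub>v (t' \<star>\<^sub>h idc N') \<circ>\<^sub>v asci K1 M' N')
      \<circ>\<^sub>v (idc K1 \<star>\<^sub>h (f \<star>\<^sub>h h))
    = ((f \<star>\<^sub>h h) \<star>\<^sub>h idc K3) \<circ>\<^sub>v asci M N K3 \<circ>\<^sub>v (idc M \<star>\<^sub>h s) \<circ>\<^sub>v asc M K2 N \<circ>\<^sub>v (t \<star>\<^sub>h idc N) \<circ>\<^sub>v asci K1 M N"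
proof -
  have [simp]: "M \<in> Cells1 B" "M' \<in> Cells1 B" "Src B M' = Src B M" "Trg B M' = Src B N"
    "N \<in> Cells1 B" "N' \<in> Cells1 B" "Src B N' = Src B N" "Trg B N' = Trg B N"
    using dm_cd[of f] dm_cd[of h] by auto
  note n1 = asci_natural[of "idc K1" K1 K1 f M M' h N N', simplified]
    and n2 = asc_natural[of f M M' "idc K2" K2 K2 h N N', simplified]
    and n3 = asci_natural[of f M M' h N N' "idc K3" K3 K3, simplified]
  have e1: "(t' \<star>\<^sub>h idc N') \<circ>\<^sub>v ((idc K1 \<star>\<^sub>h f) \<star>\<^sub>h h) = ((f \<star>\<^sub>h idc K2) \<star>\<^sub>h h) \<circ>\<^sub>v (t \<star>\<^sub>h idc N)"
    using hc_vc[of "idc K1 \<star>\<^sub>h f" t' h "idc N'"] hc_vc[of t "f \<star>\<^sub>h idc K2" "idc N" h] t by simp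
  have e2: "(idc M' \<star>\<^sub>h s') \<circ>\<^sub>v (f \<star>\<^sub>h (idc K2 \<star>\<^sub>h h)) = (f \<star>\<^sub>h (h \<star>\<^sub>h idc K3)) \<circ>\<^sub>v (idc M \<star>\<^sub>h s)"
    using hc_vc[of f "idc M'" "idc K2 \<star>\<^sub>h h" s'] hc_vc[of "idc M" f s "h \<star>\<^sub>h idc K3"] s by simp
  show ?thesis
    by (simp add: n1 e1[THEN vc_assoc_eq2] n2[THEN vc_assoc_eq2] e2[THEN vc_assoc_eq2] n3[THEN vc_assoc_eq2])
qed

text \<open>In the following four lemmas the component of the unit twist at \<open>P\<close> is \<open>l\<^sup>-\<^sup>1 r : P \<odot> U \<Rightarrow> U \<odot> P\<close>. The first
two are the unit condition and multiplicativity of this family, the others say that the unitors of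
\<open>M\<close> are compatible with it and with a component \<open>t\<close> of a twist of \<open>M\<close>.\<close>
lemma Unit1_square_unit:
  assumes [simp]: "is_cell e" "dm e = Unit1 B R" "cd e = E" "R \<in> Cells0 B"
  shows "(lui E \<circ>\<^sub>v ru E) \<circ>\<^sub>v (e \<star>\<^sub>h idc (Unit1 B R)) =
    (idc (Unit1 B R) \<star>\<^sub>h e) \<circ>\<^sub>v rui (Unit1 B R) \<circ>\<^sub>v lu (Unit1 B R)"
proof -
  let ?U = "Unit1 B R"
  have [simp]: "E \<in> Cells1 B" "Src B E = R" "Trg B E = R" using dm_cd[of e] by auto
  show ?thesis
    by (rule invc_cancel_left[OF invc_lu[of E]])
      (use ru_natural[of e ?U E] lu_natural[of e ?U E] in \<open>simp_all add: lu_Unit1\<close>)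
qed

lemma Unit1_square_multiplicative:
  assumes [simp]: "is_cell m" "dm m = P \<odot> Q" "cd m = K" "R \<in> Cells0 B"
     "P \<in> Cells1 B" "Src B P = R" "Trg B P = R" "Q \<in> Cells1 B" "Src B Q = R" "Trg B Q = R"
  defines "U \<equiv> Unit1 B R"
  shows "(lui K \<circ>\<^sub>v ru K) \<circ>\<^sub>v (m \<star>\<^sub>h idc U) = (idc U \<star>\<^sub>h m) \<circ>\<^sub>v asc U P Q \<circ>\<^sub>v ((lui P \<circ>\<^sub>v ru P) \<star>\<^sub>h idc Q) \<circ>\<^sub>v asci P U Q
       \<circ>\<^sub>v (idc P \<star>\<^sub>h (lui Q \<circ>\<^sub>v ru Q)) \<circ>\<^sub>v asc P Q U"
proof -
  have [simp]: "K \<in> Cells1 B" "Src B K = R" "Trg B K = R" using dm_cd[of m] by auto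
  note r = ru_HComp1[of P Q, simplified] and tri = whiskered_triangle_inv[of P Q, simplified]
   and l = lu_HComp1_inv(2)[of P Q, simplified]
   and n = ru_natural[of m "P \<odot> Q" K, simplified] lu_natural[of m "P \<odot> Q" K, simplified]
   and c = invcD(6)[OF invc_hc[OF invc_idc invc_lu], of P Q, simplified]
  show ?thesis
    by (rule invc_cancel_left[OF invc_lu[of K]])
      (simp_all add: U_def r l[THEN vc_assoc_eq2] tri[THEN vc_assoc_eq2] c[THEN vc_assoc_eq2] n
          n[THEN vc_assoc_eq2])
qed

lemma Unit1_square_lu:
  assumes [simp]: "M \<in> Cells1 B" "is_cell t" "dm t = P \<odot> M" "cd t = M \<odot> Q"
     "P \<in> Cells1 B" "Src B P = Src B M" "Trg B P = Src B M"
     "Q \<in> Cells1 B" "Src B Q = Trg B M" "Trg B Q = Trg B M"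
  defines "U \<equiv> Unit1 B (Src B M)"
  shows "t \<circ>\<^sub>v (idc P \<star>\<^sub>h lu M) = (lu M \<star>\<^sub>h idc Q) \<circ>\<^sub>v asci U M Q \<circ>\<^sub>v (idc U \<star>\<^sub>h t) \<circ>\<^sub>v asc U P M \<circ>\<^sub>v
      ((lui P \<circ>\<^sub>v ru P) \<star>\<^sub>h idc M) \<circ>\<^sub>v asci P U M"
proof -
  note l = lu_HComp1_inv(1)[of M Q, simplified] lu_HComp1[of P M, simplified]
   and n = lu_natural[of t "P \<odot> M" "M \<odot> Q", simplified] and tri = whiskered_triangle_inv[of P M, simplified]
   and c = invcD(6)[OF invc_hc[OF invc_lu invc_idc], of P M, simplified]
  show ?thesis
   by (simp add: U_def l[THEN vc_assoc_eq2] n[THEN vc_assoc_eq2] tri c[THEN vc_assoc_eq2])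
qed

lemma Unit1_square_ru:
  assumes [simp]: "M \<in> Cells1 B" "is_cell t" "dm t = P \<odot> M" "cd t = M \<odot> Q"
     "P \<in> Cells1 B" "Src B P = Src B M" "Trg B P = Src B M"
     "Q \<in> Cells1 B" "Src B Q = Trg B M" "Trg B Q = Trg B M"
  defines "U \<equiv> Unit1 B (Trg B M)"
  shows "t \<circ>\<^sub>v (idc P \<star>\<^sub>h ru M) = (ru M \<star>\<^sub>h idc Q) \<circ>\<^sub>v asci M U Q \<circ>\<^sub>v (idc M \<star>\<^sub>h (lui Q \<circ>\<^sub>v ru Q)) \<circ>\<^sub>v asc M Q U \<circ>\<^sub>v
      (t \<star>\<^sub>h idc U) \<circ>\<^sub>v asci P M U"
proof -
  note l = ru_HComp1[of M Q, simplified] ru_HComp1_inv(1)[of P M, simplified]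
   and n = ru_natural[of t "P \<odot> M" "M \<odot> Q", simplified] and tri = whiskered_triangle_inv[of M Q, simplified]
   and c = invcD(6)[OF invc_hc[OF invc_idc invc_lu], of M Q, simplified]
  show ?thesis
   by (simp add: U_def l l[THEN vc_assoc_eq2] n[THEN vc_assoc_eq2] tri[THEN vc_assoc_eq2] c[THEN vc_assoc_eq2])
qed

end

section \<open>The bicategory of twists\<close>

context twisting
begin

lemma Theta_Cells1 [simp]:
  assumes "A \<in> Cells0 B" "g \<in> carrier G"
  shows "Theta W A g \<in> Cells1 B" "Src B (Theta W A g) = A" "Trg B (Theta W A g) = A"
  using Theta_closed[OF assms] by (auto simp: hom1_def)

lemma Mu_inverse2: "\<lbrakk>A \<in> Cells0 B; g \<in> carrier G; h \<in> carrier G\<rbrakk>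
  \<Longrightarrow> inverse2 (Theta W A g \<odot> Theta W A h) (Theta W A (g \<otimes>\<^bsub>G\<^esub> h)) (Mu W A g h) (Mu_inv B G W A g h)"
  unfolding Mu_inv_def by (intro iso2_inverse2 Mu_iso)

lemma Eta_inverse2: "A \<in> Cells0 B \<Longrightarrow> inverse2 (Unit1 B A) (Theta W A \<one>\<^bsub>G\<^esub>) (Eta W A) (Eta_inv B G W A)"
  unfolding Eta_inv_def by (intro iso2_inverse2 Eta_iso)

definition mu_cell :: "'o \<Rightarrow> 'g \<Rightarrow> 'g \<Rightarrow> ('m, 'c) cell" where
  "mu_cell A g h = Cell (Theta W A g \<odot> Theta W A h) (Mu W A g h) (Theta W A (g \<otimes>\<^bsub>G\<^esub> h))"

definition mu_inv_cell :: "'o \<Rightarrow> 'g \<Rightarrow> 'g \<Rightarrow> ('m, 'c) cell" where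
  "mu_inv_cell A g h = Cell (Theta W A (g \<otimes>\<^bsub>G\<^esub> h)) (Mu_inv B G W A g h) (Theta W A g \<odot> Theta W A h)"

definition eta_cell :: "'o \<Rightarrow> ('m, 'c) cell" where
  "eta_cell A = Cell (Unit1 B A) (Eta W A) (Theta W A \<one>\<^bsub>G\<^esub>)"

definition eta_inv_cell :: "'o \<Rightarrow> ('m, 'c) cell" where
  "eta_inv_cell A = Cell (Theta W A \<one>\<^bsub>G\<^esub>) (Eta_inv B G W A) (Unit1 B A)"

lemma invc_mu_cell: "\<lbrakk>A \<in> Cells0 B; g \<in> carrier G; h \<in> carrier G\<rbrakk> \<Longrightarrow> invc (mu_cell A g h) (mu_inv_cell A g h)"
  unfolding mu_cell_def mu_inv_cell_def by (intro invc_Cell Mu_inverse2)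

lemma invc_eta_cell: "A \<in> Cells0 B \<Longrightarrow> invc (eta_cell A) (eta_inv_cell A)"
  unfolding eta_cell_def eta_inv_cell_def by (intro invc_Cell Eta_inverse2)

lemma mu_eta_simps [simp]:
  "dm (mu_cell A g h) = Theta W A g \<odot> Theta W A h" "cd (mu_cell A g h) = Theta W A (g \<otimes>\<^bsub>G\<^esub> h)"
      "raw (mu_cell A g h) = Mu W A g h"
  "cd (mu_inv_cell A g h) = Theta W A g \<odot> Theta W A h" "dm (mu_inv_cell A g h) = Theta W A (g \<otimes>\<^bsub>G\<^esub> h)"
      "raw (mu_inv_cell A g h) = Mu_inv B G W A g h"
  "dm (eta_cell A) = Unit1 B A" "cd (eta_cell A) = Theta W A \<one>\<^bsub>G\<^esub>" "raw (eta_cell A) = Eta W A"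
  "cd (eta_inv_cell A) = Unit1 B A" "dm (eta_inv_cell A) = Theta W A \<one>\<^bsub>G\<^esub>"
      "raw (eta_inv_cell A) = Eta_inv B G W A"
  by (simp_all add: mu_cell_def mu_inv_cell_def eta_cell_def eta_inv_cell_def)

lemma is_cell_mu_cell [simp]:
  assumes "A \<in> Cells0 B" "g \<in> carrier G" "h \<in> carrier G"
  shows "is_cell (mu_cell A g h)" "is_cell (mu_inv_cell A g h)"
  using invc_mu_cell[OF assms] by (auto simp: invc_def)

lemma is_cell_eta_cell [simp]:
  assumes "A \<in> Cells0 B"
  shows "is_cell (eta_cell A)" "is_cell (eta_inv_cell A)"
  using invc_eta_cell[OF assms] by (auto simp: invc_def)

definition twist_cell :: "'m \<times> ('g \<Rightarrow> 'c) \<Rightarrow> 'g \<Rightarrow> ('m, 'c) cell" where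
  "twist_cell X g = Cell (Theta W (Src B (fst X)) g \<odot> fst X) (snd X g) (fst X \<odot> Theta W (Trg B (fst X)) g)"

lemma twist_cell_simps [simp]: "dm (twist_cell X g) = Theta W (Src B (fst X)) g \<odot> fst X"
  "cd (twist_cell X g) = fst X \<odot> Theta W (Trg B (fst X)) g" "raw (twist_cell X g) = snd X g"
  by (simp_all add: twist_cell_def)

text \<open>The twist conditions in a form without the inverses of \<open>\<eta>\<close> and \<open>\<mu>\<close>, which is the one that is stable under
pasting of squares.\<close>
lemma twist_cells1_iff:
  "X \<in> twist_cells1 B G W \<longleftrightarrow> fst X \<in> Cells1 B \<and> snd X \<in> extensional (carrier G) \<and>
    (\<forall>g\<in>carrier G. \<exists>k. invc (twist_cell X g) k) \<and>
    twist_cell X \<one>\<^bsub>G\<^esub> \<circ>\<^sub>v (eta_cell (Src B (fst X)) \<star>\<^sub>h idc (fst X))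
      = (idc (fst X) \<star>\<^sub>h eta_cell (Trg B (fst X))) \<circ>\<^sub>v rui (fst X) \<circ>\<^sub>v lu (fst X) \<and>
    (\<forall>g\<in>carrier G. \<forall>h\<in>carrier G. twist_cell X (g \<otimes>\<^bsub>G\<^esub> h) \<circ>\<^sub>v (mu_cell (Src B (fst X)) g h \<star>\<^sub>h idc (fst X)) =
       (idc (fst X) \<star>\<^sub>h mu_cell (Trg B (fst X)) g h)
       \<circ>\<^sub>v asc (fst X) (Theta W (Trg B (fst X)) g) (Theta W (Trg B (fst X)) h)
       \<circ>\<^sub>v (twist_cell X g \<star>\<^sub>h idc (Theta W (Trg B (fst X)) h))
       \<circ>\<^sub>v asci (Theta W (Src B (fst X)) g) (fst X) (Theta W (Trg B (fst X)) h)
       \<circ>\<^sub>v (idc (Theta W (Src B (fst X)) g) \<star>\<^sub>h twist_cell X h)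
       \<circ>\<^sub>v asc (Theta W (Src B (fst X)) g) (Theta W (Src B (fst X)) h) (fst X))"
proof (cases "fst X \<in> Cells1 B \<and> (\<forall>g\<in>carrier G. \<exists>k. invc (twist_cell X g) k)")
  case False
  have "iso2 B (Theta W (Src B (fst X)) g \<odot> fst X) (fst X \<odot> Theta W (Trg B (fst X)) g) (snd X g)
     \<Longrightarrow> \<exists>k. invc (twist_cell X g) k" for g
    unfolding iso2_iff twist_cell_def using invc_Cell by blast
  hence "X \<notin> twist_cells1 B G W"
    using False by (cases X) (auto simp: twist_cells1_def is_twist_def Let_def)
  thus ?thesis using False by blast
next
  case True
  obtain M \<tau> where X: "X = (M, \<tau>)" by force
  have [simp]: "fst X = M" "snd X = \<tau>" by (simp_all add: X)
  define A C where "A = Src B M" and "C = Trg B M"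
  have [simp]: "M \<in> Cells1 B" "Src B M = A" "Trg B M = C" "A \<in> Cells0 B" "C \<in> Cells0 B"
    using True X by (auto simp: A_def C_def)
  have tcell [simp]: "is_cell (twist_cell X g)" if "g \<in> carrier G" for g
    using True that by (auto simp: invc_def)
  have iso: "iso2 B (Theta W A g \<odot> M) (M \<odot> Theta W C g) (\<tau> g)" if "g \<in> carrier G" for g
  proof -
    obtain k where k: "invc (twist_cell X g) k" using True \<open>g \<in> carrier G\<close> by blast
    hence "k = Cell (M \<odot> Theta W C g) (raw k) (Theta W A g \<odot> M)"
      using X invcD[OF k] by (cases k) auto
    thus ?thesis using k X unfolding iso2_iff twist_cell_def by (metis A_def C_def fst_conv
        invc_iff_inverse2 snd_conv)
  qed
  have unit: "\<tau> \<one>\<^bsub>G\<^esub> = (Id2 B M \<star> Eta W C) \<cdot> RUnit_inv B M \<cdot> LUnit B M \<cdot> (Eta_inv B G W A \<star> Id2 B M)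
    \<longleftrightarrow> twist_cell X \<one>\<^bsub>G\<^esub> \<circ>\<^sub>v (eta_cell A \<star>\<^sub>h idc M) = (idc M \<star>\<^sub>h eta_cell C) \<circ>\<^sub>v rui M \<circ>\<^sub>v lu M" (is "?l \<longleftrightarrow> ?r")
  proof -
    define rhs where "rhs = (((idc M \<star>\<^sub>h eta_cell C) \<circ>\<^sub>v rui M) \<circ>\<^sub>v lu M) \<circ>\<^sub>v (eta_inv_cell A \<star>\<^sub>h idc M)"
    have e: "invc (eta_cell A \<star>\<^sub>h idc M) (eta_inv_cell A \<star>\<^sub>h idc M)" by (intro invc_hc invc_eta_cell
        invc_idc) simp_all
    have rhs: "is_cell rhs" "dm rhs = Theta W A \<one>\<^bsub>G\<^esub> \<odot> M" "cd rhs = M \<odot> Theta W C \<one>\<^bsub>G\<^esub>"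
       by (simp_all add: rhs_def)
    have "raw rhs = (Id2 B M \<star> Eta W C) \<cdot> RUnit_inv B M \<cdot> LUnit B M \<cdot> (Eta_inv B G W A \<star> Id2 B M)"
      by (simp add: rhs_def del: vc_assoc)
    hence "?l \<longleftrightarrow> twist_cell X \<one>\<^bsub>G\<^esub> = rhs"
      using rhs by (auto intro!: cell_eqI dest: arg_cong[of _ _ raw])
    also have "\<dots> \<longleftrightarrow> ?r"
      unfolding rhs_def by (subst invc_move_right[OF e]) simp_all
    finally show ?thesis .
  qed
  have mult: "\<tau> (g \<otimes>\<^bsub>G\<^esub> h) =
           (Id2 B M \<star> Mu W C g h)
           \<cdot> Assoc B M (Theta W C g) (Theta W C h)
           \<cdot> (\<tau> g \<star> Id2 B (Theta W C h))
           \<cdot> Assoc_inv B (Theta W A g) M (Theta W C h)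
           \<cdot> (Id2 B (Theta W A g) \<star> \<tau> h)
           \<cdot> Assoc B (Theta W A g) (Theta W A h) M
           \<cdot> (Mu_inv B G W A g h \<star> Id2 B M)
    \<longleftrightarrow> twist_cell X (g \<otimes>\<^bsub>G\<^esub> h) \<circ>\<^sub>v (mu_cell A g h \<star>\<^sub>h idc M) =
       (idc M \<star>\<^sub>h mu_cell C g h) \<circ>\<^sub>v asc M (Theta W C g) (Theta W C h)
       \<circ>\<^sub>v (twist_cell X g \<star>\<^sub>h idc (Theta W C h)) \<circ>\<^sub>v asci (Theta W A g) M (Theta W C h)
       \<circ>\<^sub>v (idc (Theta W A g) \<star>\<^sub>h twist_cell X h) \<circ>\<^sub>v asc (Theta W A g) (Theta W A h) M" (is "?l \<longleftrightarrow> ?r")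
    if [simp]: "g \<in> carrier G" "h \<in> carrier G" for g h
  proof -
    define rhs where "rhs = ((((((idc M \<star>\<^sub>h mu_cell C g h) \<circ>\<^sub>v asc M (Theta W C g) (Theta W C h))
       \<circ>\<^sub>v (twist_cell X g \<star>\<^sub>h idc (Theta W C h))) \<circ>\<^sub>v asci (Theta W A g) M (Theta W C h))
       \<circ>\<^sub>v (idc (Theta W A g) \<star>\<^sub>h twist_cell X h)) \<circ>\<^sub>v asc (Theta W A g) (Theta W A h) M)
           \<circ>\<^sub>v (mu_inv_cell A g h \<star>\<^sub>h idc M)"
    have e: "invc (mu_cell A g h \<star>\<^sub>h idc M) (mu_inv_cell A g h \<star>\<^sub>h idc M)" by (intro invc_hc invc_mu_cell
        invc_idc) simp_all
    have rhs: "is_cell rhs" "dm rhs = Theta W A (g \<otimes>\<^bsub>G\<^esub> h) \<odot> M" "cd rhs = M \<odot> Theta W C (g \<otimes>\<^bsub>G\<^esub> h)"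
       by (simp_all add: rhs_def)
    have "raw rhs = (Id2 B M \<star> Mu W C g h)
           \<cdot> Assoc B M (Theta W C g) (Theta W C h)
           \<cdot> (\<tau> g \<star> Id2 B (Theta W C h))
           \<cdot> Assoc_inv B (Theta W A g) M (Theta W C h)
           \<cdot> (Id2 B (Theta W A g) \<star> \<tau> h)
           \<cdot> Assoc B (Theta W A g) (Theta W A h) M
           \<cdot> (Mu_inv B G W A g h \<star> Id2 B M)"
      by (simp add: rhs_def del: vc_assoc)
    hence "?l \<longleftrightarrow> twist_cell X (g \<otimes>\<^bsub>G\<^esub> h) = rhs"
      using rhs by (auto intro!: cell_eqI dest: arg_cong[of _ _ raw])
    also have "\<dots> \<longleftrightarrow> ?r"
      unfolding rhs_def by (subst invc_move_right[OF e]) simp_all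
    finally show ?thesis .
  qed
  show ?thesis
    using True X iso unit mult by (simp add: twist_cells1_def is_twist_def Let_def)
qed

lemma twist_cells1D:
  assumes "X \<in> twist_cells1 B G W"
  shows "fst X \<in> Cells1 B" "snd X \<in> extensional (carrier G)"
    "g \<in> carrier G \<Longrightarrow> \<exists>k. invc (twist_cell X g) k" "g \<in> carrier G \<Longrightarrow> is_cell (twist_cell X g)"
  using assms unfolding twist_cells1_iff invc_def by blast+

lemma twist_cell_eqI:
  "\<lbrakk>is_cell r; dm r = Theta W (Src B (fst X)) g \<odot> fst X; cd r = fst X \<odot> Theta W (Trg B (fst X)) g;
    raw r = snd X g\<rbrakk> \<Longrightarrow> twist_cell X g = r"
  by (cases r) (auto simp: twist_cell_def)

lemma twist_cells2_iff:
  "f \<in> twist_cells2 B G W X Y \<longleftrightarrow> X \<in> twist_cells1 B G W \<and> Y \<in> twist_cells1 B G W \<and>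
     f \<in> Cells2 B (fst X) (fst Y) \<and>
     (\<forall>g\<in>carrier G. twist_cell Y g \<circ>\<^sub>v (idc (Theta W (Src B (fst X)) g) \<star>\<^sub>h Cell (fst X) f (fst Y))
        = (Cell (fst X) f (fst Y) \<star>\<^sub>h idc (Theta W (Trg B (fst X)) g)) \<circ>\<^sub>v twist_cell X g)"
proof (cases "X \<in> twist_cells1 B G W \<and> Y \<in> twist_cells1 B G W \<and> f \<in> Cells2 B (fst X) (fst Y)")
  case True
  hence "fst X \<in> Cells1 B" "is_cell (Cell (fst X) f (fst Y))" "Src B (fst Y) = Src B (fst X)"
      "Trg B (fst Y) = Trg B (fst X)"
    using Cells2_parallel[of f "fst X" "fst Y"] by (auto simp: is_cell_def)
  hence "(twist_cell Y g \<circ>\<^sub>v (idc (Theta W (Src B (fst X)) g) \<star>\<^sub>h Cell (fst X) f (fst Y))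
        = (Cell (fst X) f (fst Y) \<star>\<^sub>h idc (Theta W (Trg B (fst X)) g)) \<circ>\<^sub>v twist_cell X g) \<longleftrightarrow>
     snd Y g \<cdot> (Id2 B (Theta W (Src B (fst X)) g) \<star> f) = (f \<star> Id2 B (Theta W (Trg B (fst X)) g)) \<cdot> snd X g"
    if "g \<in> carrier G" for g
    using True that twist_cells1D(4)[of X g] twist_cells1D(4)[of Y g] by (subst cell_eq_iff) simp_all
  with True show ?thesis by (cases X; cases Y) (simp add: twist_cells2_def)
next
  case False
  thus ?thesis by (cases X; cases Y) (simp add: twist_cells2_def, blast)
qed

lemma twist_cells2_cellI:
  assumes "X \<in> twist_cells1 B G W" "Y \<in> twist_cells1 B G W" "is_cell f" "dm f = fst X" "cd f = fst Y"
    "\<And>g. g \<in> carrier G \<Longrightarrow> twist_cell Y g \<circ>\<^sub>v (idc (Theta W (Src B (fst X)) g) \<star>\<^sub>h f)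
        = (f \<star>\<^sub>h idc (Theta W (Trg B (fst X)) g)) \<circ>\<^sub>v twist_cell X g"
  shows "raw f \<in> twist_cells2 B G W X Y"
proof -
  have "Cell (fst X) (raw f) (fst Y) = f" using assms(3-5) by (cases f) auto
  moreover have "raw f \<in> Cells2 B (fst X) (fst Y)" using assms(3-5) by (simp add: is_cell_def)
  ultimately show ?thesis using assms by (simp add: twist_cells2_iff)
qed

lemma twist_cells2_cell:
  assumes "f \<in> twist_cells2 B G W X Y"
  shows "\<exists>F. f = raw F \<and> is_cell F \<and> dm F = fst X \<and> cd F = fst Y \<and>
    X \<in> twist_cells1 B G W \<and> Y \<in> twist_cells1 B G W \<and>
    fst X \<in> Cells1 B \<and> fst Y \<in> Cells1 B \<and> Src B (fst Y) = Src B (fst X) \<and> Trg B (fst Y) = Trg B (fst X) \<and>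
    (\<forall>g\<in>carrier G. twist_cell Y g \<circ>\<^sub>v (idc (Theta W (Src B (fst X)) g) \<star>\<^sub>h F)
        = (F \<star>\<^sub>h idc (Theta W (Trg B (fst X)) g)) \<circ>\<^sub>v twist_cell X g)"
proof (rule exI[of _ "Cell (fst X) f (fst Y)"], intro conjI)
  show "fst X \<in> Cells1 B" "fst Y \<in> Cells1 B" "Src B (fst Y) = Src B (fst X)" "Trg B (fst Y) = Trg B (fst X)"
    using assms Cells2_parallel[of f "fst X" "fst Y"] unfolding twist_cells2_iff by auto
qed (use assms in \<open>simp_all add: twist_cells2_iff is_cell_def\<close>)

lemma twist_cell_hcomp:
  assumes "X \<in> twist_cells1 B G W" "Y \<in> twist_cells1 B G W" "Trg B (fst X) = Src B (fst Y)" "g \<in> carrier G"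
  shows "twist_cell (twist_hcomp1 B G W X Y) g =
    asci (fst X) (fst Y) (Theta W (Trg B (fst Y)) g) \<circ>\<^sub>v (idc (fst X) \<star>\<^sub>h twist_cell Y g)
    \<circ>\<^sub>v asc (fst X) (Theta W (Src B (fst Y)) g) (fst Y)
    \<circ>\<^sub>v (twist_cell X g \<star>\<^sub>h idc (fst Y)) \<circ>\<^sub>v asci (Theta W (Src B (fst X)) g) (fst X) (fst Y)"
    (is "_ = ?r")
proof -
  have [simp]: "fst X \<in> Cells1 B" "fst Y \<in> Cells1 B" "is_cell (twist_cell X g)" "is_cell (twist_cell Y g)"
    using twist_cells1D assms by auto
  note [simp] = assms(3,4)
  define r where "r = (((asci (fst X) (fst Y) (Theta W (Trg B (fst Y)) g) \<circ>\<^sub>v (idc (fst X) \<star>\<^sub>h twist_cell Y g))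
    \<circ>\<^sub>v asc (fst X) (Theta W (Src B (fst Y)) g) (fst Y))
    \<circ>\<^sub>v (twist_cell X g \<star>\<^sub>h idc (fst Y))) \<circ>\<^sub>v asci (Theta W (Src B (fst X)) g) (fst X) (fst Y)"
  have [simp]: "fst (twist_hcomp1 B G W X Y) = fst X \<odot> fst Y" by (simp add: twist_hcomp1_def split_beta)
  have "raw r = snd (twist_hcomp1 B G W X Y) g"
    by (simp add: r_def twist_hcomp1_def split_beta del: vc_assoc)
  hence "twist_cell (twist_hcomp1 B G W X Y) g = r" by (intro twist_cell_eqI) (simp_all add: r_def)
  thus ?thesis by (simp add: r_def)
qed

lemma twist_cell_unit:
  assumes "A \<in> Cells0 B" "g \<in> carrier G"
  shows "twist_cell (twist_unit1 B G W A) g = lui (Theta W A g) \<circ>\<^sub>v ru (Theta W A g)"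
  by (rule twist_cell_eqI) (use assms in \<open>simp_all add: twist_unit1_def\<close>)

lemma fst_twist_hcomp1 [simp]: "fst (twist_hcomp1 B G W X Y) = fst X \<odot> fst Y"
  by (simp add: twist_hcomp1_def split_beta)

lemma fst_twist_unit1 [simp]: "fst (twist_unit1 B G W A) = Unit1 B A"
  by (simp add: twist_unit1_def)

lemma twist_hcomp1_closed:
  assumes X: "X \<in> twist_cells1 B G W" and Y: "Y \<in> twist_cells1 B G W" and XY: "Trg B (fst X) = Src B (fst Y)"
  shows "twist_hcomp1 B G W X Y \<in> twist_cells1 B G W"
proof -
  let ?M = "fst X" and ?N = "fst Y"
  have [simp]: "?M \<in> Cells1 B" "?N \<in> Cells1 B" using twist_cells1D X Y by auto
  have [simp]: "is_cell (twist_cell X g)" "is_cell (twist_cell Y g)" if "g \<in> carrier G" for g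
    using twist_cells1D X Y that by auto
  note [simp] = XY
  note twist_cell = twist_cell_hcomp[OF X Y XY]
  have "\<exists>k. invc (twist_cell (twist_hcomp1 B G W X Y) g) k" if [simp]: "g \<in> carrier G" for g
  proof -
    obtain k l where kl: "invc (twist_cell X g) k" "invc (twist_cell Y g) l"
        using twist_cells1D(3) X Y \<open>g \<in> carrier G\<close> by blast
    show ?thesis unfolding twist_cell[OF that]
      by (rule exI, (rule kl invc_vc invc_hc invc_idc invc_asc invc_asc[THEN invc_sym] | simp)+)
  qed
  moreover have "twist_cell (twist_hcomp1 B G W X Y) \<one>\<^bsub>G\<^esub> \<circ>\<^sub>v (eta_cell (Src B ?M) \<star>\<^sub>h idc (?M \<odot> ?N))
     = (idc (?M \<odot> ?N) \<star>\<^sub>h eta_cell (Trg B ?N)) \<circ>\<^sub>v rui (?M \<odot> ?N) \<circ>\<^sub>v lu (?M \<odot> ?N)"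
    unfolding twist_cell[OF G.one_closed]
    by (rule composite_square_unit[where ?e2.0 = "eta_cell (Src B ?N)"])
      (use X Y in \<open>simp_all add: twist_cells1_iff\<close>)
  moreover have "twist_cell (twist_hcomp1 B G W X Y) (g \<otimes>\<^bsub>G\<^esub> h) \<circ>\<^sub>v (mu_cell (Src B ?M) g h \<star>\<^sub>h idc (?M \<odot> ?N)) =
       (idc (?M \<odot> ?N) \<star>\<^sub>h mu_cell (Trg B ?N) g h)
       \<circ>\<^sub>v asc (?M \<odot> ?N) (Theta W (Trg B ?N) g) (Theta W (Trg B ?N) h)
       \<circ>\<^sub>v (twist_cell (twist_hcomp1 B G W X Y) g \<star>\<^sub>h idc (Theta W (Trg B ?N) h))
       \<circ>\<^sub>v asci (Theta W (Src B ?M) g) (?M \<odot> ?N) (Theta W (Trg B ?N) h)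
       \<circ>\<^sub>v (idc (Theta W (Src B ?M) g) \<star>\<^sub>h twist_cell (twist_hcomp1 B G W X Y) h)
       \<circ>\<^sub>v asc (Theta W (Src B ?M) g) (Theta W (Src B ?M) h) (?M \<odot> ?N)"
    if gh: "g \<in> carrier G" "h \<in> carrier G" for g h
    unfolding twist_cell[OF gh(1)] twist_cell[OF gh(2)] twist_cell[OF G.m_closed[OF gh]]
    by (rule composite_square_multiplicative[where u = "\<lambda>K1 K2 K3 t s. asci ?M ?N K3 \<circ>\<^sub>v (idc ?M \<star>\<^sub>h s) \<circ>\<^sub>v
         asc ?M K2 ?N \<circ>\<^sub>v (t \<star>\<^sub>h idc ?N) \<circ>\<^sub>v asci K1 ?M ?N" and ?m2.0 = "mu_cell (Src B ?N) g h"])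
      (use X Y gh in \<open>simp_all add: twist_cells1_iff\<close>)
  moreover have "snd (twist_hcomp1 B G W X Y) \<in> extensional (carrier G)"
    by (simp add: twist_hcomp1_def split_beta)
  ultimately show ?thesis unfolding twist_cells1_iff by simp
qed

lemma twist_unit1_closed:
  assumes [simp]: "A \<in> Cells0 B"
  shows "twist_unit1 B G W A \<in> twist_cells1 B G W"
proof -
  note twist_cell = twist_cell_unit[OF assms]
  have "\<exists>k. invc (twist_cell (twist_unit1 B G W A) g) k" if [simp]: "g \<in> carrier G" for g
    unfolding twist_cell[OF that]
    by (rule exI, rule invc_vc[OF invc_ru invc_lu[THEN invc_sym]]) simp_all
  moreover have "twist_cell (twist_unit1 B G W A) \<one>\<^bsub>G\<^esub> \<circ>\<^sub>v (eta_cell A \<star>\<^sub>h idc (Unit1 B A))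
     = (idc (Unit1 B A) \<star>\<^sub>h eta_cell A) \<circ>\<^sub>v rui (Unit1 B A) \<circ>\<^sub>v lu (Unit1 B A)"
    unfolding twist_cell[OF G.one_closed] by (rule Unit1_square_unit) simp_all
  moreover have "twist_cell (twist_unit1 B G W A) (g \<otimes>\<^bsub>G\<^esub> h) \<circ>\<^sub>v (mu_cell A g h \<star>\<^sub>h idc (Unit1 B A)) =
       (idc (Unit1 B A) \<star>\<^sub>h mu_cell A g h) \<circ>\<^sub>v asc (Unit1 B A) (Theta W A g) (Theta W A h)
       \<circ>\<^sub>v (twist_cell (twist_unit1 B G W A) g \<star>\<^sub>h idc (Theta W A h))
       \<circ>\<^sub>v asci (Theta W A g) (Unit1 B A) (Theta W A h)
       \<circ>\<^sub>v (idc (Theta W A g) \<star>\<^sub>h twist_cell (twist_unit1 B G W A) h)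
       \<circ>\<^sub>v asc (Theta W A g) (Theta W A h) (Unit1 B A)"
    if gh: "g \<in> carrier G" "h \<in> carrier G" for g h
    unfolding twist_cell[OF gh(1)] twist_cell[OF gh(2)] twist_cell[OF G.m_closed[OF gh]]
    by (rule Unit1_square_multiplicative) (use gh in simp_all)
  moreover have "snd (twist_unit1 B G W A) \<in> extensional (carrier G)"
    by (simp add: twist_unit1_def)
  ultimately show ?thesis unfolding twist_cells1_iff by simp
qed

lemma twist_cells2_Id:
  assumes X: "X \<in> twist_cells1 B G W"
  shows "Id2 B (fst X) \<in> twist_cells2 B G W X X"
proof -
  have "raw (idc (fst X)) \<in> twist_cells2 B G W X X"
    by (rule twist_cells2_cellI) (use twist_cells1D[OF X] X in auto)
  thus ?thesis by simp
qed

lemma twist_cells2_VComp: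
  assumes "f \<in> twist_cells2 B G W X Y" "h \<in> twist_cells2 B G W Y Z"
  shows "h \<cdot> f \<in> twist_cells2 B G W X Z"
proof -
  obtain F where F [simp]: "f = raw F" "is_cell F" "dm F = fst X" "cd F = fst Y"
    "X \<in> twist_cells1 B G W" "Y \<in> twist_cells1 B G W" and F':
    "\<forall>g\<in>carrier G. twist_cell Y g \<circ>\<^sub>v (idc (Theta W (Src B (fst X)) g) \<star>\<^sub>h F)
        = (F \<star>\<^sub>h idc (Theta W (Trg B (fst X)) g)) \<circ>\<^sub>v twist_cell X g"
    and [simp]: "fst X \<in> Cells1 B" "fst Y \<in> Cells1 B" "Src B (fst Y) = Src B (fst X)"
        "Trg B (fst Y) = Trg B (fst X)"
    using twist_cells2_cell[OF assms(1)] by blast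
  obtain H where H [simp]: "h = raw H" "is_cell H" "dm H = fst Y" "cd H = fst Z"
    "Z \<in> twist_cells1 B G W" and H':
    "\<forall>g\<in>carrier G. twist_cell Z g \<circ>\<^sub>v (idc (Theta W (Src B (fst Y)) g) \<star>\<^sub>h H)
        = (H \<star>\<^sub>h idc (Theta W (Trg B (fst Y)) g)) \<circ>\<^sub>v twist_cell Y g"
    and [simp]: "fst Z \<in> Cells1 B" "Src B (fst Z) = Src B (fst Y)" "Trg B (fst Z) = Trg B (fst Y)"
    using twist_cells2_cell[OF assms(2)] by blast
  have "raw (H \<circ>\<^sub>v F) \<in> twist_cells2 B G W X Z"
    by (rule twist_cells2_cellI)
      (simp_all add: F'[rule_format, THEN vc_assoc_eq2] F'
          H'[simplified, rule_format, THEN vc_assoc_eq2] twist_cells1D)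
  thus ?thesis by simp
qed

lemma twist_cells2_HComp:
  assumes f: "f \<in> twist_cells2 B G W X X'" and h: "h \<in> twist_cells2 B G W Y Y'" and XY:
      "Trg B (fst X) = Src B (fst Y)"
  shows "f \<star> h \<in> twist_cells2 B G W (twist_hcomp1 B G W X Y) (twist_hcomp1 B G W X' Y')"
proof -
  obtain F where F [simp]: "f = raw F" "is_cell F" "dm F = fst X" "cd F = fst X'"
    and FX: "X \<in> twist_cells1 B G W" "X' \<in> twist_cells1 B G W" and F':
    "\<forall>g\<in>carrier G. twist_cell X' g \<circ>\<^sub>v (idc (Theta W (Src B (fst X)) g) \<star>\<^sub>h F)
        = (F \<star>\<^sub>h idc (Theta W (Trg B (fst X)) g)) \<circ>\<^sub>v twist_cell X g"
    and [simp]: "fst X \<in> Cells1 B" "fst X' \<in> Cells1 B" "Src B (fst X') = Src B (fst X)"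
        "Trg B (fst X') = Trg B (fst X)"
    using twist_cells2_cell[OF assms(1)] by blast
  obtain H where H [simp]: "h = raw H" "is_cell H" "dm H = fst Y" "cd H = fst Y'"
    and HY: "Y \<in> twist_cells1 B G W" "Y' \<in> twist_cells1 B G W" and H':
    "\<forall>g\<in>carrier G. twist_cell Y' g \<circ>\<^sub>v (idc (Theta W (Src B (fst Y)) g) \<star>\<^sub>h H)
        = (H \<star>\<^sub>h idc (Theta W (Trg B (fst Y)) g)) \<circ>\<^sub>v twist_cell Y g"
    and [simp]: "fst Y \<in> Cells1 B" "fst Y' \<in> Cells1 B" "Src B (fst Y') = Src B (fst Y)"
        "Trg B (fst Y') = Trg B (fst Y)"
    using twist_cells2_cell[OF assms(2)] by blast
  note [simp] = XY
  have "raw (F \<star>\<^sub>h H) \<in> twist_cells2 B G W (twist_hcomp1 B G W X Y) (twist_hcomp1 B G W X' Y')"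
  proof (rule twist_cells2_cellI)
    fix g assume g: "g \<in> carrier G"
    have "twist_cell (twist_hcomp1 B G W X' Y') g \<circ>\<^sub>v (idc (Theta W (Src B (fst X)) g) \<star>\<^sub>h (F \<star>\<^sub>h H)) =
      ((F \<star>\<^sub>h H) \<star>\<^sub>h idc (Theta W (Trg B (fst Y)) g)) \<circ>\<^sub>v twist_cell (twist_hcomp1 B G W X Y) g"
      using twist_cell_hcomp[OF FX(1) HY(1) _ g] twist_cell_hcomp[OF FX(2) HY(2) _ g]
        composite_square_hc[of F "fst X" "fst X'" H "fst Y" "fst Y'" "Theta W (Src B (fst X)) g" "Theta W (Src B (fst Y)) g" "Theta W (Trg B (fst Y)) g" "twist_cell X g" "twist_cell Y g" "twist_cell X' g" "twist_cell Y' g"]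
       g F'[rule_format, OF g] H'[rule_format, OF g] by (simp add: twist_cells1D FX HY)
    thus "twist_cell (twist_hcomp1 B G W X' Y') g \<circ>\<^sub>v (idc (Theta W (Src B (fst (twist_hcomp1 B G W X
        Y))) g) \<star>\<^sub>h (F \<star>\<^sub>h H)) =
      ((F \<star>\<^sub>h H) \<star>\<^sub>h idc (Theta W (Trg B (fst (twist_hcomp1 B G W X Y))) g))
          \<circ>\<^sub>v twist_cell (twist_hcomp1 B G W X Y) g"
      by simp
  qed (simp_all add: twist_hcomp1_closed FX HY)
  thus ?thesis by simp
qed

lemma twist_cells2_inverse:
  assumes f: "f \<in> twist_cells2 B G W X Y" and "inverse2 (fst X) (fst Y) f h"
  shows "h \<in> twist_cells2 B G W Y X"
proof -
  obtain F where F [simp]: "f = raw F" "is_cell F" "dm F = fst X" "cd F = fst Y"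
    and FX: "X \<in> twist_cells1 B G W" "Y \<in> twist_cells1 B G W" and F':
    "\<forall>g\<in>carrier G. twist_cell Y g \<circ>\<^sub>v (idc (Theta W (Src B (fst X)) g) \<star>\<^sub>h F)
        = (F \<star>\<^sub>h idc (Theta W (Trg B (fst X)) g)) \<circ>\<^sub>v twist_cell X g"
    and [simp]: "fst X \<in> Cells1 B" "fst Y \<in> Cells1 B" "Src B (fst Y) = Src B (fst X)"
        "Trg B (fst Y) = Trg B (fst X)"
    using twist_cells2_cell[OF assms(1)] by blast
  define H where "H = Cell (fst Y) h (fst X)"
  have "F = Cell (fst X) f (fst Y)" using F by (cases F) auto
  hence inv: "invc F H" using assms(2) invc_Cell H_def by metis
  have [simp]: "is_cell H" "dm H = fst Y" "cd H = fst X" using invcD[OF inv] by simp_all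
  have "raw H \<in> twist_cells2 B G W Y X"
  proof (rule twist_cells2_cellI)
    fix g assume [simp]: "g \<in> carrier G"
    let ?P = "Theta W (Src B (fst X)) g" and ?Q = "Theta W (Trg B (fst X)) g"
    have "(H \<star>\<^sub>h idc ?Q) \<circ>\<^sub>v twist_cell Y g = twist_cell X g \<circ>\<^sub>v (idc ?P \<star>\<^sub>h H)"
      by (rule invc_square[where f = "F \<star>\<^sub>h idc ?Q" and h = "idc ?P \<star>\<^sub>h F"])
        (auto simp: F' twist_cells1D FX intro!: invc_hc inv)
    thus "twist_cell X g \<circ>\<^sub>v (idc (Theta W (Src B (fst Y)) g) \<star>\<^sub>h H)
        = (H \<star>\<^sub>h idc (Theta W (Trg B (fst Y)) g)) \<circ>\<^sub>v twist_cell Y g"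
      by simp
  qed (simp_all add: FX)
  thus ?thesis by (simp add: H_def)
qed

lemma twist_cells2_Assoc:
  assumes X: "X \<in> twist_cells1 B G W" and Y: "Y \<in> twist_cells1 B G W" and Z: "Z \<in> twist_cells1 B G W"
    and XY [simp]: "Trg B (fst X) = Src B (fst Y)" and YZ [simp]: "Trg B (fst Y) = Src B (fst Z)"
  shows "Assoc B (fst X) (fst Y) (fst Z) \<in> twist_cells2 B G W
    (twist_hcomp1 B G W (twist_hcomp1 B G W X Y) Z) (twist_hcomp1 B G W X (twist_hcomp1 B G W Y
        Z))" (is "_ \<in> twist_cells2 B G W ?L ?R")
proof -
  let ?M = "fst X" and ?N = "fst Y" and ?P = "fst Z"
  have [simp]: "?M \<in> Cells1 B" "?N \<in> Cells1 B" "?P \<in> Cells1 B" using twist_cells1D X Y Z by auto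
  have "raw (asc ?M ?N ?P) \<in> twist_cells2 B G W ?L ?R"
  proof (rule twist_cells2_cellI)
    fix g assume g: "g \<in> carrier G"
    have [simp]: "is_cell (twist_cell X g)" "is_cell (twist_cell Y g)" "is_cell (twist_cell Z g)"
        using twist_cells1D X Y Z g by auto
    have L: "twist_cell ?L g = asci (?M \<odot> ?N) ?P (Theta W (Trg B ?P) g)
        \<circ>\<^sub>v (idc (?M \<odot> ?N) \<star>\<^sub>h twist_cell Z g) \<circ>\<^sub>v asc (?M \<odot> ?N) (Theta W (Src B ?P) g) ?P
       \<circ>\<^sub>v (twist_cell (twist_hcomp1 B G W X Y) g \<star>\<^sub>h idc ?P) \<circ>\<^sub>v asci (Theta W (Src B ?M) g) (?M \<odot> ?N) ?P"
      by (subst twist_cell_hcomp) (simp_all add: twist_hcomp1_closed X Y Z g)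
    have R: "twist_cell ?R g = asci ?M (?N \<odot> ?P) (Theta W (Trg B ?P) g)
        \<circ>\<^sub>v (idc ?M \<star>\<^sub>h twist_cell (twist_hcomp1 B G W Y Z) g) \<circ>\<^sub>v asc ?M (Theta W (Src B ?N) g) (?N \<odot> ?P)
       \<circ>\<^sub>v (twist_cell X g \<star>\<^sub>h idc (?N \<odot> ?P)) \<circ>\<^sub>v asci (Theta W (Src B ?M) g) ?M (?N \<odot> ?P)"
      by (subst twist_cell_hcomp) (simp_all add: twist_hcomp1_closed X Y Z g)
    have "twist_cell ?R g \<circ>\<^sub>v (idc (Theta W (Src B ?M) g) \<star>\<^sub>h asc ?M ?N ?P)
        = (asc ?M ?N ?P \<star>\<^sub>h idc (Theta W (Trg B ?P) g)) \<circ>\<^sub>v twist_cell ?L g"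
      unfolding L R twist_cell_hcomp[OF X Y XY g] twist_cell_hcomp[OF Y Z YZ g] XY YZ
      by (rule composite_square_asc[where u = "\<lambda>M N K1 K2 K3 t s. asci M N K3 \<circ>\<^sub>v (idc M \<star>\<^sub>h s) \<circ>\<^sub>v asc M K2 N \<circ>\<^sub>v (t \<star>\<^sub>h idc N) \<circ>\<^sub>v asci K1 M N"])
        (use g in simp_all)
    thus "twist_cell ?R g \<circ>\<^sub>v (idc (Theta W (Src B (fst ?L)) g) \<star>\<^sub>h asc ?M ?N ?P)
        = (asc ?M ?N ?P \<star>\<^sub>h idc (Theta W (Trg B (fst ?L)) g)) \<circ>\<^sub>v twist_cell ?L g"
      by simp
  qed (simp_all add: twist_hcomp1_closed X Y Z)
  thus ?thesis by simp
qed

lemma twist_cells2_unitors: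
  assumes X: "X \<in> twist_cells1 B G W"
  shows "LUnit B (fst X) \<in> twist_cells2 B G W (twist_hcomp1 B G W (twist_unit1 B G W (Src B (fst X))) X) X"
    and "RUnit B (fst X) \<in> twist_cells2 B G W (twist_hcomp1 B G W X (twist_unit1 B G W (Trg B (fst X)))) X"
proof -
  let ?M = "fst X"
  let ?L = "twist_hcomp1 B G W (twist_unit1 B G W (Src B ?M)) X" and ?R =
      "twist_hcomp1 B G W X (twist_unit1 B G W (Trg B ?M))"
  have [simp]: "?M \<in> Cells1 B" using twist_cells1D X by auto
  have tX [simp]: "is_cell (twist_cell X g)" if "g \<in> carrier G" for g using twist_cells1D X that by auto
  have "raw (lu ?M) \<in> twist_cells2 B G W ?L X"
  proof (rule twist_cells2_cellI)
    fix g assume g [simp]: "g \<in> carrier G"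
    show "twist_cell X g \<circ>\<^sub>v (idc (Theta W (Src B (fst ?L)) g) \<star>\<^sub>h lu ?M)
        = (lu ?M \<star>\<^sub>h idc (Theta W (Trg B (fst ?L)) g)) \<circ>\<^sub>v twist_cell ?L g"
      using Unit1_square_lu[of ?M "twist_cell X g" "Theta W (Src B ?M) g" "Theta W (Trg B ?M) g"]
      by (simp add: twist_cell_hcomp twist_cell_unit twist_unit1_closed X)
  qed (simp_all add: twist_hcomp1_closed twist_unit1_closed X)
  thus "LUnit B ?M \<in> twist_cells2 B G W ?L X" by simp
  have "raw (ru ?M) \<in> twist_cells2 B G W ?R X"
  proof (rule twist_cells2_cellI)
    fix g assume g [simp]: "g \<in> carrier G"
    show "twist_cell X g \<circ>\<^sub>v (idc (Theta W (Src B (fst ?R)) g) \<star>\<^sub>h ru ?M)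
        = (ru ?M \<star>\<^sub>h idc (Theta W (Trg B (fst ?R)) g)) \<circ>\<^sub>v twist_cell ?R g"
      using Unit1_square_ru[of ?M "twist_cell X g" "Theta W (Src B ?M) g" "Theta W (Trg B ?M) g"]
      by (simp add: twist_cell_hcomp twist_cell_unit twist_unit1_closed X)
  qed (simp_all add: twist_hcomp1_closed twist_unit1_closed X)
  thus "RUnit B ?M \<in> twist_cells2 B G W ?R X" by simp
qed

abbreviation Tw :: "('o, 'm \<times> ('g \<Rightarrow> 'c), 'c) bicategory" where "Tw \<equiv> twist_bicategory B G W"

lemma Tw_simps [simp]:
  "Cells0 Tw = Cells0 B" "Cells1 Tw = twist_cells1 B G W" "Src Tw X = Src B (fst X)" "Trg Tw X = Trg B (fst X)"
  "Cells2 Tw = twist_cells2 B G W" "Id2 Tw X = Id2 B (fst X)" "VComp Tw = VComp B"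
  "Unit1 Tw = twist_unit1 B G W" "HComp1 Tw = twist_hcomp1 B G W" "HComp2 Tw = HComp2 B"
  "Assoc Tw X Y Z = Assoc B (fst X) (fst Y) (fst Z)" "LUnit Tw X = LUnit B (fst X)"
      "RUnit Tw X = RUnit B (fst X)"
  by (simp_all add: twist_bicategory_def)

lemma hom1_Tw: "hom1 Tw A C = {X \<in> twist_cells1 B G W. Src B (fst X) = A \<and> Trg B (fst X) = C}"
  by (simp add: hom1_def)

lemma twist_cells2_Cells2: "f \<in> twist_cells2 B G W X Y \<Longrightarrow> f \<in> Cells2 B (fst X) (fst Y)"
  by (simp add: twist_cells2_iff)

text \<open>The inverse in \<open>B\<close> of a 2-cell of twists is again compatible with the twists.\<close>
lemma iso2_Tw:
  assumes "f \<in> twist_cells2 B G W X Y" "iso2 B (fst X) (fst Y) f"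
  shows "iso2 Tw X Y f"
proof -
  obtain h where "inverse2 (fst X) (fst Y) f h" using assms(2) iso2_iff by blast
  thus ?thesis using assms(1) twist_cells2_inverse[OF assms(1)]
    by (auto simp: iso2_def is_iso_def is_inverse_def hom_category_def inverse2_def)
qed

lemma category_hom_Tw:
  assumes "A \<in> Cells0 B" "C \<in> Cells0 B"
  shows "category (hom_category Tw A C)"
proof (rule category.intro, goal_cases)
  case (3 X Y f) thus ?case by (auto simp: hom_category_def dest!: twist_cells2_Cells2 intro: VComp_Id2)
next
  case (4 X Y f) thus ?case by (auto simp: hom_category_def dest!: twist_cells2_Cells2 intro: Id2_VComp)
next
  case (5 X Y Z V f h k)
  thus ?case by (auto simp: hom_category_def dest!: twist_cells2_Cells2 intro: VComp_assoc)
qed (auto simp: hom_category_def hom1_Tw intro: twist_cells2_Id twist_cells2_VComp)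

theorem bicategory_Tw: "bicategory Tw"
proof (rule bicategory.intro, goal_cases)
  case (3 f M N) thus ?case using Cells2_parallel[of f "fst M" "fst N"] by (auto simp: twist_cells2_iff)
next
  case (4 A C) thus ?case by (simp add: category_hom_Tw)
next
  case (7 f M M' h N N') thus ?case by (simp add: twist_cells2_HComp)
next
  case (9 f M M' f' M'' h N N' h' N'')
  thus ?case using interchange[of f "fst M" "fst M'" f' "fst M''" h "fst N" "fst N'" h' "fst N''"]
    by (simp add: twist_cells2_Cells2)
next
  case (10 M N P) thus ?case
    using twist_cells1D by (intro iso2_Tw) (simp_all add: twist_cells2_Assoc Assoc_iso)
next
  case (11 M) thus ?case
    using twist_cells1D by (intro iso2_Tw) (simp_all add: twist_cells2_unitors LUnit_iso)
next
  case (12 M) thus ?case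
    using twist_cells1D by (intro iso2_Tw) (simp_all add: twist_cells2_unitors RUnit_iso)
next
  case (13 f M M' h N N' k P P')
  thus ?case using Assoc_natural[of f "fst M" "fst M'" h "fst N" "fst N'" k "fst P" "fst P'"]
    by (simp add: twist_cells2_Cells2)
next
  case (14 f M M')
  thus ?case using LUnit_natural[of f "fst M" "fst M'"] by (simp add: twist_cells2_Cells2)
next
  case (15 f M M')
  thus ?case using RUnit_natural[of f "fst M" "fst M'"] by (simp add: twist_cells2_Cells2)
next
  case (16 M N P Q) thus ?case using pentagon[of "fst M" "fst N" "fst P" "fst Q"] by (simp add: twist_cells1D)
next
  case (17 M N) thus ?case using triangle[of "fst M" "fst N"] by (simp add: twist_cells1D)
qed (simp_all add: hom1_Tw twist_cells1D twist_unit1_closed twist_hcomp1_closed HComp2_Id)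

text \<open>Inverses are unique, and the inverse in \<open>B\<close> is a 2-cell of twists.\<close>
lemma Assoc_inv_Tw:
  assumes "X \<in> twist_cells1 B G W" "Y \<in> twist_cells1 B G W" "Z \<in> twist_cells1 B G W"
    "Trg B (fst X) = Src B (fst Y)" "Trg B (fst Y) = Src B (fst Z)"
  shows "Assoc_inv Tw X Y Z = Assoc_inv B (fst X) (fst Y) (fst Z)"
proof -
  interpret Tw: bicategory Tw by (rule bicategory_Tw)
  have inv: "inverse2 (fst X \<odot> fst Y \<odot> fst Z) (fst X \<odot> (fst Y \<odot> fst Z)) (Assoc B (fst X) (fst Y) (fst Z))
    (Assoc_inv B (fst X) (fst Y) (fst Z))"
    using assms by (intro Assoc_inverse2) (simp_all add: twist_cells1D)
  have "Assoc_inv B (fst X) (fst Y) (fst Z) \<in> twist_cells2 B G W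
    (twist_hcomp1 B G W X (twist_hcomp1 B G W Y Z)) (twist_hcomp1 B G W (twist_hcomp1 B G W X Y) Z)"
    by (rule twist_cells2_inverse[OF twist_cells2_Assoc[OF assms]]) (use inv in simp)
  thus ?thesis unfolding Assoc_inv_def[of Tw]
    by (intro Tw.inv2_eqI) (use inv twist_cells2_Assoc[OF assms] in \<open>simp add: Tw.inverse2_def inverse2_def\<close>)
qed

lemma is_left_dual_Tw_imp:
  assumes "is_left_dual Tw X X' \<eta> \<epsilon>"
  shows "is_left_dual B (fst X) (fst X') \<eta> \<epsilon>"
  using assms unfolding is_left_dual_def
  by (auto simp: hom1_Tw hom1_def Assoc_inv_Tw twist_cells1D dest!: twist_cells2_Cells2)

end

section \<open>Biproducts in preadditive categories\<close>

context preadditive_category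
begin

text \<open>An element of a group with \<open>x + x = x\<close> is zero.\<close>
lemma Comp_zero:
  assumes [simp]: "X \<in> Ob C" "Y \<in> Ob C" "Z \<in> Ob C" "h \<in> Hom C Y Z"
  shows "h \<bullet> zero X Y = zero X Z"
proof -
  interpret XY: comm_group "\<lparr>carrier = Hom C X Y, mult = add X Y, one = zero X Y\<rparr>" by (rule hom_group) simp_all
  interpret XZ: comm_group "\<lparr>carrier = Hom C X Z, mult = add X Z, one = zero X Z\<rparr>" by (rule hom_group) simp_all
  have z: "zero X Y \<in> Hom C X Y" using XY.one_closed by simp
  have "add X Z (h \<bullet> zero X Y) (h \<bullet> zero X Y) = h \<bullet> zero X Y"
    using Comp_add[of X Y Z "zero X Y" "zero X Y" h] XY.r_one z by simp
  thus ?thesis using XZ.r_cancel_one[of "h \<bullet> zero X Y" "h \<bullet> zero X Y"]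
      Comp_closed[of X Y Z "zero X Y" h] z by simp
qed

lemma zero_Comp:
  assumes [simp]: "X \<in> Ob C" "Y \<in> Ob C" "Z \<in> Ob C" "f \<in> Hom C X Y"
  shows "zero Y Z \<bullet> f = zero X Z"
proof -
  interpret YZ: comm_group "\<lparr>carrier = Hom C Y Z, mult = add Y Z, one = zero Y Z\<rparr>" by (rule hom_group) simp_all
  interpret XZ: comm_group "\<lparr>carrier = Hom C X Z, mult = add X Z, one = zero X Z\<rparr>" by (rule hom_group) simp_all
  have z: "zero Y Z \<in> Hom C Y Z" using YZ.one_closed by simp
  have "add X Z (zero Y Z \<bullet> f) (zero Y Z \<bullet> f) = zero Y Z \<bullet> f"
    using add_Comp[of X Y Z f "zero Y Z" "zero Y Z"] YZ.r_one z by simp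
  thus ?thesis using XZ.r_cancel_one[of "zero Y Z \<bullet> f" "zero Y Z \<bullet> f"]
      Comp_closed[of X Y Z f "zero Y Z"] z by simp
qed

lemma hom_group_rules:
  assumes "X \<in> Ob C" "Y \<in> Ob C"
  shows zero_closed: "zero X Y \<in> Hom C X Y"
    and add_closed: "\<lbrakk>f \<in> Hom C X Y; h \<in> Hom C X Y\<rbrakk> \<Longrightarrow> add X Y f h \<in> Hom C X Y"
    and add_zero: "f \<in> Hom C X Y \<Longrightarrow> add X Y f (zero X Y) = f"
    and zero_add: "f \<in> Hom C X Y \<Longrightarrow> add X Y (zero X Y) f = f"
    and add_commute: "\<lbrakk>f \<in> Hom C X Y; h \<in> Hom C X Y\<rbrakk> \<Longrightarrow> add X Y f h = add X Y h f"
proof -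
  interpret comm_group "\<lparr>carrier = Hom C X Y, mult = add X Y, one = zero X Y\<rparr>" by (rule hom_group) fact+
  show "zero X Y \<in> Hom C X Y"
    "\<lbrakk>f \<in> Hom C X Y; h \<in> Hom C X Y\<rbrakk> \<Longrightarrow> add X Y f h \<in> Hom C X Y"
    "f \<in> Hom C X Y \<Longrightarrow> add X Y f (zero X Y) = f"
    "f \<in> Hom C X Y \<Longrightarrow> add X Y (zero X Y) f = f"
    "\<lbrakk>f \<in> Hom C X Y; h \<in> Hom C X Y\<rbrakk> \<Longrightarrow> add X Y f h = add X Y h f"
    using one_closed m_closed[of f h] r_one[of f] l_one[of f] m_comm[of f h] by simp_all
qed

lemma is_biproduct_swap:
  assumes "is_biproduct C add zero X Y Z i j p q"
  shows "is_biproduct C add zero Y X Z j i q p"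
  using assms add_commute[of Z Z "i \<bullet> p" "j \<bullet> q"] Comp_closed[of Z X Z p i] Comp_closed[of Z Y Z q j]
  by (auto simp: is_biproduct_def)

lemma Comp_biproduct_expand:
  assumes Z: "is_biproduct C add zero X Y Z i j p q" and f: "f \<in> Hom C Z V" and V: "V \<in> Ob C"
  shows "f = add Z V (f \<bullet> i \<bullet> p) (f \<bullet> j \<bullet> q)"
proof -
  have "f = f \<bullet> add Z Z (i \<bullet> p) (j \<bullet> q)"
    using Z f V Comp_Id[of Z V f] by (simp add: is_biproduct_def)
  also have "\<dots> = add Z V (f \<bullet> (i \<bullet> p)) (f \<bullet> (j \<bullet> q))"
    using Z f V by (intro Comp_add) (auto simp: is_biproduct_def intro: Comp_closed)
  also have "\<dots> = add Z V (f \<bullet> i \<bullet> p) (f \<bullet> j \<bullet> q)"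
    using Z f V Comp_assoc[of Z X Z V p i f] Comp_assoc[of Z Y Z V q j f] by (simp add: is_biproduct_def)
  finally show ?thesis .
qed

lemma biproduct_joint_epi:
  assumes "is_biproduct C add zero X Y Z i j p q" "f \<in> Hom C Z V" "h \<in> Hom C Z V" "V \<in> Ob C"
    "f \<bullet> i = h \<bullet> i" "f \<bullet> j = h \<bullet> j"
  shows "f = h"
  using Comp_biproduct_expand[OF assms(1,2,4)] Comp_biproduct_expand[OF assms(1,3,4)] assms(5,6) by simp

lemma biproduct_endo_inj:
  assumes Z: "is_biproduct C add zero X Y Z i j p q" and f: "f \<in> Hom C X X" and h: "h \<in> Hom C Y Y"
  shows "biproduct_endo C add Z i j p q f h \<in> Hom C Z Z"
    and "biproduct_endo C add Z i j p q f h \<bullet> i = i \<bullet> f"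
    and "biproduct_endo C add Z i j p q f h \<bullet> j = j \<bullet> h"
proof -
  have ob [simp]: "X \<in> Ob C" "Y \<in> Ob C" "Z \<in> Ob C" and
    arr [simp]: "i \<in> Hom C X Z" "j \<in> Hom C Y Z" "p \<in> Hom C Z X" "q \<in> Hom C Z Y"
    and eqs: "p \<bullet> i = Id C X" "q \<bullet> j = Id C Y" "p \<bullet> j = zero Y X" "q \<bullet> i = zero X Y"
    using Z by (auto simp: is_biproduct_def)
  have [simp]: "i \<bullet> f \<in> Hom C X Z" "j \<bullet> h \<in> Hom C Y Z" using f h Comp_closed[of X X Z f i]
      Comp_closed[of Y Y Z h j] by auto
  hence s: "i \<bullet> f \<bullet> p \<in> Hom C Z Z" "j \<bullet> h \<bullet> q \<in> Hom C Z Z"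
    using Comp_closed[of Z X Z p "i \<bullet> f"] Comp_closed[of Z Y Z q "j \<bullet> h"] by auto
  thus "biproduct_endo C add Z i j p q f h \<in> Hom C Z Z" by (auto simp: biproduct_endo_def intro: add_closed)
  show "biproduct_endo C add Z i j p q f h \<bullet> i = i \<bullet> f"
    using s add_Comp[of X Z Z i "i \<bullet> f \<bullet> p" "j \<bullet> h \<bullet> q"] Comp_assoc[of X Z X Z i p "i \<bullet> f"]
      Comp_assoc[of X Z Y Z i q "j \<bullet> h"]
    by (simp add: biproduct_endo_def eqs Comp_Id[of X Z] Comp_zero[of X Y Z] add_zero)
  show "biproduct_endo C add Z i j p q f h \<bullet> j = j \<bullet> h"
    using s add_Comp[of Y Z Z j "i \<bullet> f \<bullet> p" "j \<bullet> h \<bullet> q"] Comp_assoc[of Y Z X Z j p "i \<bullet> f"]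
      Comp_assoc[of Y Z Y Z j q "j \<bullet> h"]
    by (simp add: biproduct_endo_def eqs Comp_Id[of Y Z] Comp_zero[of Y X Z] zero_add)
qed

text \<open>Additivity of a functor on this sum follows from functoriality: \<open>s = i f p + j h q\<close> satisfies
\<open>s i = i f\<close> and \<open>s j = j h\<close>, and expanding \<open>F(s)\<close> along the biproduct \<open>F(Z)\<close> only involves
\<open>F(s) F(i) = F(i f)\<close> and \<open>F(s) F(j) = F(j h)\<close>.\<close>
lemma functor_biproduct_endo:
  assumes D: "preadditive_category D addD zeroD" and F: "is_functor C D Fo Fa"
    and Z: "is_biproduct C add zero X Y Z i j p q" and f: "f \<in> Hom C X X" and h: "h \<in> Hom C Y Y"
    and FZ: "is_biproduct D addD zeroD (Fo X) (Fo Y) (Fo Z) (Fa i) (Fa j) (Fa p) (Fa q)"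
  shows "Fa (biproduct_endo C add Z i j p q f h)
     = addD (Fo Z) (Fo Z) (Fa (i \<bullet> f \<bullet> p)) (Fa (j \<bullet> h \<bullet> q))"
proof -
  interpret D: preadditive_category D addD zeroD by (rule D)
  let ?s = "biproduct_endo C add Z i j p q f h"
  have ob [simp]: "X \<in> Ob C" "Y \<in> Ob C" "Z \<in> Ob C" and
    arr [simp]: "i \<in> Hom C X Z" "j \<in> Hom C Y Z" "p \<in> Hom C Z X" "q \<in> Hom C Z Y"
    using Z by (auto simp: is_biproduct_def)
  have [simp]: "i \<bullet> f \<in> Hom C X Z" "j \<bullet> h \<in> Hom C Y Z" using f h Comp_closed[of X X Z f i]
      Comp_closed[of Y Y Z h j] by auto
  have comp: "Fa (k \<bullet> l) = Fa k \<bullet>\<^bsub>D\<^esub> Fa l" if "U \<in> Ob C" "V \<in> Ob C" "V' \<in> Ob C" "l \<in> Hom C U V"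
      "k \<in> Hom C V V'" for U V V' k l
    using F that unfolding is_functor_def by blast
  have FO: "Fo Z \<in> Ob D" and FA: "Fa ?s \<in> Hom D (Fo Z) (Fo Z)"
    using F biproduct_endo_inj(1)[OF Z f h] unfolding is_functor_def by auto
  note e = biproduct_endo_inj[OF Z f h]
  have "Fa ?s \<bullet>\<^bsub>D\<^esub> Fa i \<bullet>\<^bsub>D\<^esub> Fa p = Fa (i \<bullet> f \<bullet> p)" "Fa ?s \<bullet>\<^bsub>D\<^esub> Fa j \<bullet>\<^bsub>D\<^esub> Fa q = Fa (j \<bullet> h \<bullet> q)"
    using e comp[of X Z Z i ?s] comp[of Y Z Z j ?s] comp[of Z X Z p "i \<bullet> f"] comp[of Z Y Z q "j \<bullet> h"]
        by simp_all
  thus ?thesis using D.Comp_biproduct_expand[OF FZ FA FO] by simp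
qed

end

section \<open>Left duals of biproducts\<close>

context bicategory
begin

definition dual_pair :: "'m \<Rightarrow> 'm \<Rightarrow> ('m, 'c) cell \<Rightarrow> ('m, 'c) cell \<Rightarrow> bool" where
  "dual_pair X X' \<eta> \<epsilon> \<longleftrightarrow> X \<in> Cells1 B \<and> X' \<in> Cells1 B \<and> Src B X' = Trg B X \<and> Trg B X' = Src B X \<and>
     typed \<eta> (Unit1 B (Trg B X)) (X' \<odot> X) \<and> typed \<epsilon> (X \<odot> X') (Unit1 B (Src B X)) \<and>
     lu X \<circ>\<^sub>v (\<epsilon> \<star>\<^sub>h idc X) \<circ>\<^sub>v asci X X' X \<circ>\<^sub>v (idc X \<star>\<^sub>h \<eta>) = ru X \<and>
     ru X' \<circ>\<^sub>v (idc X' \<star>\<^sub>h \<epsilon>) \<circ>\<^sub>v asc X' X X' \<circ>\<^sub>v (\<eta> \<star>\<^sub>h idc X') = lu X'"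

lemma is_left_dual_iff:
  "is_left_dual B X X' \<eta> \<epsilon> \<longleftrightarrow>
   dual_pair X X' (Cell (Unit1 B (Trg B X)) \<eta> (X' \<odot> X)) (Cell (X \<odot> X') \<epsilon> (Unit1 B (Src B X)))"
  (is "_ \<longleftrightarrow> dual_pair X X' ?\<eta> ?\<epsilon>")
proof (cases "X \<in> Cells1 B \<and> X' \<in> Cells1 B \<and> Src B X' = Trg B X \<and> Trg B X' = Src B X \<and> is_cell ?\<eta> \<and> is_cell ?\<epsilon>")
  case True
  hence [simp]: "X \<in> Cells1 B" "X' \<in> Cells1 B" "Src B X' = Trg B X" "Trg B X' = Src B X" "is_cell ?\<eta>"
      "is_cell ?\<epsilon>" by auto
  have 1: "lu X \<circ>\<^sub>v (?\<epsilon> \<star>\<^sub>h idc X) \<circ>\<^sub>v asci X X' X \<circ>\<^sub>v (idc X \<star>\<^sub>h ?\<eta>) = ((lu X \<circ>\<^sub>v (?\<epsilon> \<star>\<^sub>h idc X))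
      \<circ>\<^sub>v asci X X' X) \<circ>\<^sub>v (idc X \<star>\<^sub>h ?\<eta>)"
    by simp
  have 2: "ru X' \<circ>\<^sub>v (idc X' \<star>\<^sub>h ?\<epsilon>) \<circ>\<^sub>v asc X' X X' \<circ>\<^sub>v (?\<eta> \<star>\<^sub>h idc X') = ((ru X' \<circ>\<^sub>v (idc X' \<star>\<^sub>h ?\<epsilon>))
      \<circ>\<^sub>v asc X' X X') \<circ>\<^sub>v (?\<eta> \<star>\<^sub>h idc X')"
    by simp
  have "(lu X \<circ>\<^sub>v (?\<epsilon> \<star>\<^sub>h idc X) \<circ>\<^sub>v asci X X' X \<circ>\<^sub>v (idc X \<star>\<^sub>h ?\<eta>) = ru X) \<longleftrightarrow>
     LUnit B X \<cdot> (\<epsilon> \<star> Id2 B X) \<cdot> Assoc_inv B X X' X \<cdot> (Id2 B X \<star> \<eta>) = RUnit B X"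
    unfolding 1 by (subst cell_eq_iff) (simp_all del: vc_assoc)
  moreover have "(ru X' \<circ>\<^sub>v (idc X' \<star>\<^sub>h ?\<epsilon>) \<circ>\<^sub>v asc X' X X' \<circ>\<^sub>v (?\<eta> \<star>\<^sub>h idc X') = lu X') \<longleftrightarrow>
     RUnit B X' \<cdot> (Id2 B X' \<star> \<epsilon>) \<cdot> Assoc B X' X X' \<cdot> (\<eta> \<star> Id2 B X') = LUnit B X'"
    unfolding 2 by (subst cell_eq_iff) (simp_all del: vc_assoc)
  moreover have "\<eta> \<in> Cells2 B (Unit1 B (Trg B X)) (X' \<odot> X)" "\<epsilon> \<in> Cells2 B (X \<odot> X') (Unit1 B (Src B X))"
    using True by (simp_all add: is_cell_def)
  ultimately show ?thesis by (simp add: is_left_dual_def dual_pair_def hom1_def)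
next
  case False
  thus ?thesis by (auto simp: is_left_dual_def dual_pair_def hom1_def is_cell_def)
qed

text \<open>The hypotheses \<open>ev\<close> and \<open>coev\<close> say that \<open>i\<close> and \<open>p'\<close> are mates of each other, except that \<open>(\<eta>, \<epsilon>)\<close> is not yet
known to be a duality. Moving \<open>i\<close> through \<open>\<epsilon>\<close> turns it into \<open>p'\<close>, which moves through \<open>\<eta>\<close> and turns back
into \<open>i\<close>; between the two moves the triangle of \<open>Z\<close> becomes the triangle of \<open>X\<close>.\<close>
lemma triangle_left_transfer:
  assumes X: "dual_pair X X' \<eta>X \<epsilon>X" and [simp]: "is_cell i" "dm i = X" "cd i = Z" "is_cell p'"
      "dm p' = Z'" "cd p' = X'"
    "is_cell \<eta>" "dm \<eta> = Unit1 B (Trg B X)" "cd \<eta> = Z' \<odot> Z" "is_cell \<epsilon>" "dm \<epsilon> = Z \<odot> Z'"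
        "cd \<epsilon> = Unit1 B (Src B X)"
  and ev: "\<epsilon> \<circ>\<^sub>v (i \<star>\<^sub>h idc Z') = \<epsilon>X \<circ>\<^sub>v (idc X \<star>\<^sub>h p')"
  and coev: "(p' \<star>\<^sub>h idc Z) \<circ>\<^sub>v \<eta> = (idc X' \<star>\<^sub>h i) \<circ>\<^sub>v \<eta>X"
  shows "(lu Z \<circ>\<^sub>v (\<epsilon> \<star>\<^sub>h idc Z) \<circ>\<^sub>v asci Z Z' Z \<circ>\<^sub>v (idc Z \<star>\<^sub>h \<eta>)) \<circ>\<^sub>v (i \<star>\<^sub>h idc (Unit1 B (Trg B X)))
    = ru Z \<circ>\<^sub>v (i \<star>\<^sub>h idc (Unit1 B (Trg B X)))"
proof -
  let ?U = "Unit1 B (Trg B X)"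
  have [simp]: "X \<in> Cells1 B" "X' \<in> Cells1 B" "Src B X' = Trg B X" "Trg B X' = Src B X"
    "is_cell \<eta>X" "dm \<eta>X = ?U" "cd \<eta>X = X' \<odot> X" "is_cell \<epsilon>X" "dm \<epsilon>X = X \<odot> X'" "cd \<epsilon>X = Unit1 B (Src B X)"
    and tri: "lu X \<circ>\<^sub>v (\<epsilon>X \<star>\<^sub>h idc X) \<circ>\<^sub>v asci X X' X \<circ>\<^sub>v (idc X \<star>\<^sub>h \<eta>X) = ru X"
    using X by (auto simp: dual_pair_def)
  have [simp]: "Z \<in> Cells1 B" "Src B Z = Src B X" "Trg B Z = Trg B X" "Z' \<in> Cells1 B"
      "Src B Z' = Trg B X" "Trg B Z' = Src B X"
    using dm_cd[of i] dm_cd[of p'] by auto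
  note n1 = whisker_exchange[of i X Z \<eta> ?U "Z' \<odot> Z", simplified, symmetric]
    and n2 = asci_natural[of i X Z "idc Z'" Z' Z' "idc Z" Z Z, simplified]
    and ev' = arg_cong[OF ev, of "\<lambda>x. x \<star>\<^sub>h idc Z", simplified]
    and n3 = asci_natural[of "idc X" X X p' Z' X' "idc Z" Z Z, simplified, symmetric]
    and coev' = arg_cong[OF coev, of "\<lambda>x. idc X \<star>\<^sub>h x", simplified]
    and n4 = asci_natural[of "idc X" X X "idc X'" X' X' i X Z, simplified]
    and n5 = whisker_exchange[of \<epsilon>X "X \<odot> X'" "Unit1 B (Src B X)" i X Z, simplified]
    and n6 = lu_natural[of i X Z, simplified] and n7 = ru_natural[of i X Z, simplified]
  show ?thesis
    by (simp add: n1 n2[THEN vc_assoc_eq2] ev'[THEN vc_assoc_eq2] n3[THEN vc_assoc_eq2] coev'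
      n4[THEN vc_assoc_eq2] n5[THEN vc_assoc_eq2] n6[THEN vc_assoc_eq2] n7 tri)
qed

text \<open>The second triangle, with \<open>p\<close> and \<open>i'\<close> in the roles of \<open>p'\<close> and \<open>i\<close>.\<close>
lemma triangle_right_transfer:
  assumes X: "dual_pair X X' \<eta>X \<epsilon>X" and [simp]: "is_cell p" "dm p = Z" "cd p = X" "is_cell i'"
      "dm i' = X'" "cd i' = Z'"
    "is_cell \<eta>" "dm \<eta> = Unit1 B (Trg B X)" "cd \<eta> = Z' \<odot> Z" "is_cell \<epsilon>" "dm \<epsilon> = Z \<odot> Z'"
        "cd \<epsilon> = Unit1 B (Src B X)"
  and ev: "\<epsilon> \<circ>\<^sub>v (idc Z \<star>\<^sub>h i') = \<epsilon>X \<circ>\<^sub>v (p \<star>\<^sub>h idc X')"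
  and coev: "(idc Z' \<star>\<^sub>h p) \<circ>\<^sub>v \<eta> = (i' \<star>\<^sub>h idc X) \<circ>\<^sub>v \<eta>X"
  shows "(ru Z' \<circ>\<^sub>v (idc Z' \<star>\<^sub>h \<epsilon>) \<circ>\<^sub>v asc Z' Z Z' \<circ>\<^sub>v (\<eta> \<star>\<^sub>h idc Z')) \<circ>\<^sub>v (idc (Unit1 B (Trg B X)) \<star>\<^sub>h i')
    = lu Z' \<circ>\<^sub>v (idc (Unit1 B (Trg B X)) \<star>\<^sub>h i')"
proof -
  let ?U = "Unit1 B (Trg B X)"
  have [simp]: "X \<in> Cells1 B" "X' \<in> Cells1 B" "Src B X' = Trg B X" "Trg B X' = Src B X"
    "is_cell \<eta>X" "dm \<eta>X = ?U" "cd \<eta>X = X' \<odot> X" "is_cell \<epsilon>X" "dm \<epsilon>X = X \<odot> X'" "cd \<epsilon>X = Unit1 B (Src B X)"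
    and tri: "ru X' \<circ>\<^sub>v (idc X' \<star>\<^sub>h \<epsilon>X) \<circ>\<^sub>v asc X' X X' \<circ>\<^sub>v (\<eta>X \<star>\<^sub>h idc X') = lu X'"
    using X by (auto simp: dual_pair_def)
  have [simp]: "Z \<in> Cells1 B" "Src B Z = Src B X" "Trg B Z = Trg B X" "Z' \<in> Cells1 B"
      "Src B Z' = Trg B X" "Trg B Z' = Src B X"
    using dm_cd[of p] dm_cd[of i'] by auto
  note n1 = whisker_exchange[of \<eta> ?U "Z' \<odot> Z" i' X' Z', simplified]
    and n2 = asc_natural[of "idc Z'" Z' Z' "idc Z" Z Z i' X' Z', simplified]
    and ev' = arg_cong[OF ev, of "\<lambda>x. idc Z' \<star>\<^sub>h x", simplified]
    and n3 = asc_natural[of "idc Z'" Z' Z' p Z X "idc X'" X' X', simplified, symmetric]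
    and coev' = arg_cong[OF coev, of "\<lambda>x. x \<star>\<^sub>h idc X'", simplified]
    and n4 = asc_natural[of i' X' Z' "idc X" X X "idc X'" X' X', simplified]
    and n5 = whisker_exchange[of i' X' Z' \<epsilon>X "X \<odot> X'" "Unit1 B (Src B X)", simplified, symmetric]
    and n6 = lu_natural[of i' X' Z', simplified] and n7 = ru_natural[of i' X' Z', simplified]
  show ?thesis
    by (simp add: n1 n2[THEN vc_assoc_eq2] ev'[THEN vc_assoc_eq2] n3[THEN vc_assoc_eq2] coev'
      n4[THEN vc_assoc_eq2] n5[THEN vc_assoc_eq2] n6 n7[THEN vc_assoc_eq2] tri)
qed

lemma HComp2_Id2_VComp:
  assumes "f \<in> Cells2 B M M'" "f' \<in> Cells2 B M' M''" "h \<in> Cells2 B N N'" "Trg B M = Src B N"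
  shows "(f' \<star> h) \<cdot> (f \<star> Id2 B N) = (f' \<cdot> f) \<star> h" "(f' \<star> Id2 B N') \<cdot> (f \<star> h) = (f' \<cdot> f) \<star> h"
  using interchange[of f M M' f' M'' "Id2 B N" N N h N']
      interchange[of f M M' f' M'' h N N' "Id2 B N'" N'] assms
    Id2_closed[of N] Id2_closed[of N'] VComp_Id2[of h N N'] Id2_VComp[of h N N']
        Cells2_parallel[of h N N'] by simp_all

lemma HComp2_VComp_Id2:
  assumes "f \<in> Cells2 B M M'" "h \<in> Cells2 B N N'" "h' \<in> Cells2 B N' N''" "Trg B M = Src B N"
  shows "(f \<star> h') \<cdot> (Id2 B M \<star> h) = f \<star> (h' \<cdot> h)" "(Id2 B M' \<star> h') \<cdot> (f \<star> h) = f \<star> (h' \<cdot> h)"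
  using interchange[of "Id2 B M" M M f M' h N N' h' N'']
      interchange[of f M M' "Id2 B M'" M' h N N' h' N''] assms
    Id2_closed[of M] Id2_closed[of M'] VComp_Id2[of f M M'] Id2_VComp[of f M M']
        Cells2_parallel[of f M M'] by simp_all

end

locale additive_bicategory = bicategory B for B :: "('o, 'm, 'c) bicategory" (structure) +
  fixes add :: "'o \<Rightarrow> 'o \<Rightarrow> 'm \<Rightarrow> 'm \<Rightarrow> 'c \<Rightarrow> 'c \<Rightarrow> 'c" and zero :: "'o \<Rightarrow> 'o \<Rightarrow> 'm \<Rightarrow> 'm \<Rightarrow> 'c"
  assumes homs_additive: "homs_additive B add zero"
    and hcomp_distributes: "hcomp_distributes B add zero"
begin

lemma additive_hom: "\<lbrakk>A \<in> Cells0 B; C \<in> Cells0 B\<rbrakk> \<Longrightarrow> additive_category (hom_category B A C) (add A C) (zero A C)"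
  using homs_additive by (simp add: homs_additive_def)

lemma preadditive_hom: "\<lbrakk>A \<in> Cells0 B; C \<in> Cells0 B\<rbrakk> \<Longrightarrow> preadditive_category (hom_category B A C) (add A
    C) (zero A C)"
  using additive_hom additive_category.axioms(1) by blast

lemma hom_rules:
  assumes "M \<in> Cells1 B" "N \<in> Cells1 B" "Src B M = A" "Trg B M = C" "Src B N = A" "Trg B N = C"
  shows zero_Cells2: "zero A C M N \<in> Cells2 B M N"
    and add_Cells2: "\<lbrakk>f \<in> Cells2 B M N; h \<in> Cells2 B M N\<rbrakk> \<Longrightarrow> add A C M N f h \<in> Cells2 B M N"
    and add_zero2: "f \<in> Cells2 B M N \<Longrightarrow> add A C M N f (zero A C M N) = f"
    and add_commute2: "\<lbrakk>f \<in> Cells2 B M N; h \<in> Cells2 B M N\<rbrakk> \<Longrightarrow> add A C M N f h = add A C M N h f"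
    and VComp_add2: "\<lbrakk>f \<in> Cells2 B M N; h \<in> Cells2 B M N; k \<in> Cells2 B N P\<rbrakk>
      \<Longrightarrow> k \<cdot> add A C M N f h = add A C M P (k \<cdot> f) (k \<cdot> h)"
    and add_VComp2: "\<lbrakk>f \<in> Cells2 B M N; h \<in> Cells2 B M N; k \<in> Cells2 B P M\<rbrakk>
      \<Longrightarrow> add A C M N f h \<cdot> k = add A C P N (f \<cdot> k) (h \<cdot> k)"
    and VComp_zero2: "k \<in> Cells2 B N P \<Longrightarrow> k \<cdot> zero A C M N = zero A C M P"
    and zero_VComp2: "k \<in> Cells2 B P M \<Longrightarrow> zero A C M N \<cdot> k = zero A C P N"
proof -
  have AC: "A \<in> Cells0 B" "C \<in> Cells0 B" using assms by auto
  note p = preadditive_hom[OF AC]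
  have ob: "M \<in> hom1 B A C" "N \<in> hom1 B A C" and P: "k \<in> Cells2 B N P \<Longrightarrow> P \<in> hom1 B A C"
      "k \<in> Cells2 B P M \<Longrightarrow> P \<in> hom1 B A C"
    using assms Cells2_parallel[of k N P] Cells2_parallel[of k P M] by (auto simp: hom1_def)
  show "zero A C M N \<in> Cells2 B M N"
    "\<lbrakk>f \<in> Cells2 B M N; h \<in> Cells2 B M N\<rbrakk> \<Longrightarrow> add A C M N f h \<in> Cells2 B M N"
    "f \<in> Cells2 B M N \<Longrightarrow> add A C M N f (zero A C M N) = f"
    "\<lbrakk>f \<in> Cells2 B M N; h \<in> Cells2 B M N\<rbrakk> \<Longrightarrow> add A C M N f h = add A C M N h f"
    using preadditive_category.hom_group_rules[OF p, of M N] ob by (simp_all add: hom_category_def)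
  show "\<lbrakk>f \<in> Cells2 B M N; h \<in> Cells2 B M N; k \<in> Cells2 B N P\<rbrakk>
      \<Longrightarrow> k \<cdot> add A C M N f h = add A C M P (k \<cdot> f) (k \<cdot> h)"
    using preadditive_category.Comp_add[OF p, of M N P f h k] ob P by (simp add: hom_category_def)
  show "\<lbrakk>f \<in> Cells2 B M N; h \<in> Cells2 B M N; k \<in> Cells2 B P M\<rbrakk>
      \<Longrightarrow> add A C M N f h \<cdot> k = add A C P N (f \<cdot> k) (h \<cdot> k)"
    using preadditive_category.add_Comp[OF p, of P M N k f h] ob P by (simp add: hom_category_def)
  show "k \<in> Cells2 B N P \<Longrightarrow> k \<cdot> zero A C M N = zero A C M P"
    using preadditive_category.Comp_zero[OF p, of M N P k] ob P by (simp add: hom_category_def)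
  show "k \<in> Cells2 B P M \<Longrightarrow> zero A C M N \<cdot> k = zero A C P N"
    using preadditive_category.zero_Comp[OF p, of P M N k] ob P by (simp add: hom_category_def)
qed

abbreviation biproduct2 where
  "biproduct2 A C \<equiv> is_biproduct (hom_category B A C) (add A C) (zero A C)"

lemma biproduct2_iff:
  "biproduct2 A C X Y Z i j p q \<longleftrightarrow> X \<in> hom1 B A C \<and> Y \<in> hom1 B A C \<and> Z \<in> hom1 B A C \<and>
     i \<in> Cells2 B X Z \<and> j \<in> Cells2 B Y Z \<and> p \<in> Cells2 B Z X \<and> q \<in> Cells2 B Z Y \<and>
     p \<cdot> i = Id2 B X \<and> q \<cdot> j = Id2 B Y \<and> p \<cdot> j = zero A C Y X \<and> q \<cdot> i = zero A C X Y \<and>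
     add A C Z Z (i \<cdot> p) (j \<cdot> q) = Id2 B Z"
  by (simp add: is_biproduct_def hom_category_def)

lemma biproduct2_whisker:
  assumes "biproduct2 A C X Y Z i j p q" "A \<in> Cells0 B" "C \<in> Cells0 B" "D \<in> Cells0 B"
  shows "N \<in> hom1 B C D \<Longrightarrow> biproduct2 A D (X \<odot> N) (Y \<odot> N) (Z \<odot> N) (i \<star> Id2 B N) (j \<star> Id2 B N) (p \<star> Id2 B
      N) (q \<star> Id2 B N)"
    and "N \<in> hom1 B D A \<Longrightarrow> biproduct2 D C (N \<odot> X) (N \<odot> Y) (N \<odot> Z) (Id2 B N \<star> i) (Id2 B N \<star> j) (Id2 B N \<star>
        p) (Id2 B N \<star> q)"
  using hcomp_distributes assms unfolding hcomp_distributes_def preserves_biproducts_def by blast+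

lemma ex_biproduct2:
  assumes "X \<in> hom1 B A C" "Y \<in> hom1 B A C" "A \<in> Cells0 B" "C \<in> Cells0 B"
  shows "\<exists>Z i j p q. biproduct2 A C X Y Z i j p q"
  using additive_category.has_biproducts[OF additive_hom[OF assms(3,4)], of X Y] assms
      by (simp add: hom_category_def)

text \<open>In a biproduct of \<open>M\<close> and \<open>M'\<close> the zero 2-cell is the composite of an inclusion with the other
projection, and horizontal composition preserves biproduct diagrams. This settles the case of an
identity \<open>k\<close>, and the general case follows by whiskering.\<close>
lemma zero_HComp2:
  assumes M: "M \<in> hom1 B A C" "M' \<in> hom1 B A C" and k: "k \<in> Cells2 B N N'" and N: "N \<in> hom1 B C D"
  shows "zero A C M M' \<star> k = zero A D (M \<odot> N) (M' \<odot> N')"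
proof -
  have c: "A \<in> Cells0 B" "C \<in> Cells0 B" "D \<in> Cells0 B" using M N by (auto simp: hom1_def)
  have N': "N' \<in> hom1 B C D" using k N Cells2_parallel[of k N N'] by (auto simp: hom1_def)
  obtain Z i j p q where Z: "biproduct2 A C M M' Z i j p q" using ex_biproduct2 M c by blast
  have zk: "zero A C M M' \<in> Cells2 B M M'" using M by (intro zero_Cells2) (auto simp: hom1_def)
  have "zero A D (M \<odot> N) (M' \<odot> N) = (q \<star> Id2 B N) \<cdot> (i \<star> Id2 B N)"
    using biproduct2_whisker(1)[OF Z c N] by (simp add: biproduct2_iff)
  also have "\<dots> = zero A C M M' \<star> Id2 B N"
    using Z N M HComp2_Id2_VComp(1)[of i M Z q M' "Id2 B N" N N] Id2_closed[of N]
        by (simp add: biproduct2_iff hom1_def)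
  finally have "zero A C M M' \<star> k = (Id2 B M' \<star> k) \<cdot> zero A D (M \<odot> N) (M' \<odot> N)"
    using HComp2_VComp_Id2(2)[of "zero A C M M'" M M' "Id2 B N" N N k N'] M N k zk Id2_closed[of N]
        VComp_Id2[OF k] by (simp add: hom1_def)
  also have "\<dots> = zero A D (M \<odot> N) (M' \<odot> N')"
    using M N N' k Id2_closed[of M'] by (intro VComp_zero2 HComp2_closed) (auto simp: hom1_def)
  finally show ?thesis .
qed

lemma HComp2_zero:
  assumes M: "M \<in> hom1 B C D" "M' \<in> hom1 B C D" and k: "k \<in> Cells2 B N N'" and N: "N \<in> hom1 B A C"
  shows "k \<star> zero C D M M' = zero A D (N \<odot> M) (N' \<odot> M')"
proof -
  have c: "C \<in> Cells0 B" "D \<in> Cells0 B" "A \<in> Cells0 B" using M N by (auto simp: hom1_def)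
  have N': "N' \<in> hom1 B A C" using k N Cells2_parallel[of k N N'] by (auto simp: hom1_def)
  obtain Z i j p q where Z: "biproduct2 C D M M' Z i j p q" using ex_biproduct2 M c by blast
  have zk: "zero C D M M' \<in> Cells2 B M M'" using M by (intro zero_Cells2) (auto simp: hom1_def)
  have "zero A D (N \<odot> M) (N \<odot> M') = (Id2 B N \<star> q) \<cdot> (Id2 B N \<star> i)"
    using biproduct2_whisker(2)[OF Z c N] by (simp add: biproduct2_iff)
  also have "\<dots> = Id2 B N \<star> zero C D M M'"
    using Z N M HComp2_VComp_Id2(1)[of "Id2 B N" N N i M Z q M'] Id2_closed[of N]
        by (simp add: biproduct2_iff hom1_def)
  finally have "k \<star> zero C D M M' = (k \<star> Id2 B M') \<cdot> zero A D (N \<odot> M) (N \<odot> M')"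
    using HComp2_Id2_VComp(2)[of "Id2 B N" N N k N' "zero C D M M'" M M'] M N k zk Id2_closed[of N]
        VComp_Id2[OF k] by (simp add: hom1_def)
  also have "\<dots> = zero A D (N \<odot> M) (N' \<odot> M')"
    using M N N' k Id2_closed[of M'] by (intro VComp_zero2 HComp2_closed) (auto simp: hom1_def)
  finally show ?thesis .
qed

text \<open>The duality data of \<open>Z = X \<oplus> Y\<close> restrict on the summand \<open>X\<close> to those of \<open>X\<close>: in each of the four equations
the term that belongs to \<open>Y\<close> contains the composite of an inclusion with the other projection.\<close>
lemma biproduct_ev_coev:
  assumes Z: "biproduct2 A C X Y Z i j p q" and Z': "biproduct2 C A X' Y' Z' i' j' p' q'"
    and \<eta>: "\<eta>X \<in> Cells2 B (Unit1 B C) (X' \<odot> X)" "\<eta>Y \<in> Cells2 B (Unit1 B C) (Y' \<odot> Y)"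
    and \<epsilon>: "\<epsilon>X \<in> Cells2 B (X \<odot> X') (Unit1 B A)" "\<epsilon>Y \<in> Cells2 B (Y \<odot> Y') (Unit1 B A)"
  defines "\<eta> \<equiv> add C C (Unit1 B C) (Z' \<odot> Z) ((i' \<star> i) \<cdot> \<eta>X) ((j' \<star> j) \<cdot> \<eta>Y)"
    and "\<epsilon> \<equiv> add A A (Z \<odot> Z') (Unit1 B A) (\<epsilon>X \<cdot> (p \<star> p')) (\<epsilon>Y \<cdot> (q \<star> q'))"
  shows "\<eta> \<in> Cells2 B (Unit1 B C) (Z' \<odot> Z)" "\<epsilon> \<in> Cells2 B (Z \<odot> Z') (Unit1 B A)"
    and "\<epsilon> \<cdot> (i \<star> Id2 B Z') = \<epsilon>X \<cdot> (Id2 B X \<star> p')"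
    and "\<epsilon> \<cdot> (Id2 B Z \<star> i') = \<epsilon>X \<cdot> (p \<star> Id2 B X')"
    and "(p' \<star> Id2 B Z) \<cdot> \<eta> = (Id2 B X' \<star> i) \<cdot> \<eta>X"
    and "(Id2 B Z' \<star> p) \<cdot> \<eta> = (i' \<star> Id2 B X) \<cdot> \<eta>X"
proof -
  have ob: "X \<in> Cells1 B" "Y \<in> Cells1 B" "Z \<in> Cells1 B" "X' \<in> Cells1 B" "Y' \<in> Cells1 B" "Z' \<in> Cells1 B"
    "Src B X = A" "Trg B X = C" "Src B Y = A" "Trg B Y = C" "Src B Z = A" "Trg B Z = C"
    "Src B X' = C" "Trg B X' = A" "Src B Y' = C" "Trg B Y' = A" "Src B Z' = C" "Trg B Z' = A"
    and arr: "i \<in> Cells2 B X Z" "j \<in> Cells2 B Y Z" "p \<in> Cells2 B Z X" "q \<in> Cells2 B Z Y"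
    "i' \<in> Cells2 B X' Z'" "j' \<in> Cells2 B Y' Z'" "p' \<in> Cells2 B Z' X'" "q' \<in> Cells2 B Z' Y'"
    and eqs: "p \<cdot> i = Id2 B X" "q \<cdot> j = Id2 B Y" "p \<cdot> j = zero A C Y X" "q \<cdot> i = zero A C X Y"
      "p' \<cdot> i' = Id2 B X'" "q' \<cdot> j' = Id2 B Y'" "p' \<cdot> j' = zero C A Y' X'" "q' \<cdot> i' = zero C A X' Y'"
    using Z Z' by (auto simp: biproduct2_iff hom1_def)
  have c: "A \<in> Cells0 B" "C \<in> Cells0 B" using ob Src_closed Trg_closed by metis+
  note ids = Id2_closed[of X] Id2_closed[of Y] Id2_closed[of Z] Id2_closed[of X'] Id2_closed[of Y']
      Id2_closed[of Z']
  have t: "i' \<star> i \<in> Cells2 B (X' \<odot> X) (Z' \<odot> Z)" "j' \<star> j \<in> Cells2 B (Y' \<odot> Y) (Z' \<odot> Z)"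
    "p \<star> p' \<in> Cells2 B (Z \<odot> Z') (X \<odot> X')" "q \<star> q' \<in> Cells2 B (Z \<odot> Z') (Y \<odot> Y')"
    using arr ob by (auto intro!: HComp2_closed)
  have s: "(i' \<star> i) \<cdot> \<eta>X \<in> Cells2 B (Unit1 B C) (Z' \<odot> Z)" "(j' \<star> j) \<cdot> \<eta>Y \<in> Cells2 B (Unit1 B C) (Z' \<odot> Z)"
    "\<epsilon>X \<cdot> (p \<star> p') \<in> Cells2 B (Z \<odot> Z') (Unit1 B A)" "\<epsilon>Y \<cdot> (q \<star> q') \<in> Cells2 B (Z \<odot> Z') (Unit1 B A)"
    using t \<eta> \<epsilon> by (auto intro: VComp_closed)
  note [simp] = ob c
  show "\<eta> \<in> Cells2 B (Unit1 B C) (Z' \<odot> Z)" "\<epsilon> \<in> Cells2 B (Z \<odot> Z') (Unit1 B A)"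
    unfolding \<eta>_def \<epsilon>_def using s by (auto intro!: add_Cells2)
  have ev: "\<epsilon> \<cdot> k = \<epsilon>X \<cdot> x"
    if k: "k \<in> Cells2 B M (Z \<odot> Z')" and x: "(p \<star> p') \<cdot> k = x"
      and y: "(q \<star> q') \<cdot> k = zero A A M (Y \<odot> Y')" for M k x
  proof -
    have [simp]: "M \<in> Cells1 B" "Src B M = A" "Trg B M = A"
      using Cells2_parallel[OF k] by simp_all
    have "\<epsilon> \<cdot> k = add A A M (Unit1 B A) (\<epsilon>X \<cdot> (p \<star> p') \<cdot> k) (\<epsilon>Y \<cdot> (q \<star> q') \<cdot> k)"
      unfolding \<epsilon>_def using s k by (intro add_VComp2) simp_all
    also have "\<dots> = add A A M (Unit1 B A) (\<epsilon>X \<cdot> x) (zero A A M (Unit1 B A))"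
      using VComp_assoc[OF k t(3) \<epsilon>(1)] VComp_assoc[OF k t(4) \<epsilon>(2)] VComp_zero2[OF _ _ _ _ _ _ \<epsilon>(2), of M A A]
      by (simp add: x y)
    also have "\<dots> = \<epsilon>X \<cdot> x"
      using VComp_closed[OF VComp_closed[OF k t(3)] \<epsilon>(1)] by (intro add_zero2) (simp_all add: x)
    finally show ?thesis .
  qed
  have coev: "k \<cdot> \<eta> = x \<cdot> \<eta>X"
    if k: "k \<in> Cells2 B (Z' \<odot> Z) M" and x: "k \<cdot> (i' \<star> i) = x"
      and y: "k \<cdot> (j' \<star> j) = zero C C (Y' \<odot> Y) M" for M k x
  proof -
    have [simp]: "M \<in> Cells1 B" "Src B M = C" "Trg B M = C"
      using Cells2_parallel[OF k] by auto
    have "k \<cdot> \<eta> = add C C (Unit1 B C) M (k \<cdot> ((i' \<star> i) \<cdot> \<eta>X)) (k \<cdot> ((j' \<star> j) \<cdot> \<eta>Y))"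
      unfolding \<eta>_def using s k by (intro VComp_add2) simp_all
    also have "\<dots> = add C C (Unit1 B C) M (x \<cdot> \<eta>X) (zero C C (Unit1 B C) M)"
      using VComp_assoc[OF \<eta>(1) t(1) k] VComp_assoc[OF \<eta>(2) t(2) k] zero_VComp2[OF _ _ _ _ _ _ \<eta>(2), of M C C]
      by (simp add: x y)
    also have "\<dots> = x \<cdot> \<eta>X"
      using VComp_closed[OF \<eta>(1) VComp_closed[OF t(1) k]] by (intro add_zero2) (simp_all add: x)
    finally show ?thesis .
  qed
  show "\<epsilon> \<cdot> (i \<star> Id2 B Z') = \<epsilon>X \<cdot> (Id2 B X \<star> p')"
  proof (rule ev)
    show "i \<star> Id2 B Z' \<in> Cells2 B (X \<odot> Z') (Z \<odot> Z')" using arr ids by (intro HComp2_closed) simp_all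
    show "(p \<star> p') \<cdot> (i \<star> Id2 B Z') = Id2 B X \<star> p'"
      using HComp2_Id2_VComp(1)[of i X Z p X p' Z' X'] arr by (simp add: eqs)
    have "(q \<star> q') \<cdot> (i \<star> Id2 B Z') = zero A C X Y \<star> q'"
      using HComp2_Id2_VComp(1)[of i X Z q Y q' Z' Y'] arr by (simp add: eqs)
    also have "\<dots> = zero A A (X \<odot> Z') (Y \<odot> Y')" using arr by (intro zero_HComp2) (auto simp: hom1_def)
    finally show "(q \<star> q') \<cdot> (i \<star> Id2 B Z') = zero A A (X \<odot> Z') (Y \<odot> Y')" .
  qed
  show "\<epsilon> \<cdot> (Id2 B Z \<star> i') = \<epsilon>X \<cdot> (p \<star> Id2 B X')"
  proof (rule ev)
    show "Id2 B Z \<star> i' \<in> Cells2 B (Z \<odot> X') (Z \<odot> Z')" using arr ids by (intro HComp2_closed) simp_all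
    show "(p \<star> p') \<cdot> (Id2 B Z \<star> i') = p \<star> Id2 B X'"
      using HComp2_VComp_Id2(1)[of p Z X i' X' Z' p' X'] arr by (simp add: eqs)
    have "(q \<star> q') \<cdot> (Id2 B Z \<star> i') = q \<star> zero C A X' Y'"
      using HComp2_VComp_Id2(1)[of q Z Y i' X' Z' q' Y'] arr by (simp add: eqs)
    also have "\<dots> = zero A A (Z \<odot> X') (Y \<odot> Y')" using arr by (intro HComp2_zero) (auto simp: hom1_def)
    finally show "(q \<star> q') \<cdot> (Id2 B Z \<star> i') = zero A A (Z \<odot> X') (Y \<odot> Y')" .
  qed
  show "(p' \<star> Id2 B Z) \<cdot> \<eta> = (Id2 B X' \<star> i) \<cdot> \<eta>X"
  proof (rule coev)
    show "p' \<star> Id2 B Z \<in> Cells2 B (Z' \<odot> Z) (X' \<odot> Z)" using arr ids by (intro HComp2_closed) simp_all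
    show "(p' \<star> Id2 B Z) \<cdot> (i' \<star> i) = Id2 B X' \<star> i"
      using HComp2_Id2_VComp(2)[of i' X' Z' p' X' i X Z] arr by (simp add: eqs)
    have "(p' \<star> Id2 B Z) \<cdot> (j' \<star> j) = zero C A Y' X' \<star> j"
      using HComp2_Id2_VComp(2)[of j' Y' Z' p' X' j Y Z] arr by (simp add: eqs)
    also have "\<dots> = zero C C (Y' \<odot> Y) (X' \<odot> Z)" using arr by (intro zero_HComp2) (auto simp: hom1_def)
    finally show "(p' \<star> Id2 B Z) \<cdot> (j' \<star> j) = zero C C (Y' \<odot> Y) (X' \<odot> Z)" .
  qed
  show "(Id2 B Z' \<star> p) \<cdot> \<eta> = (i' \<star> Id2 B X) \<cdot> \<eta>X"
  proof (rule coev)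
    show "Id2 B Z' \<star> p \<in> Cells2 B (Z' \<odot> Z) (Z' \<odot> X)" using arr ids by (intro HComp2_closed) simp_all
    show "(Id2 B Z' \<star> p) \<cdot> (i' \<star> i) = i' \<star> Id2 B X"
      using HComp2_VComp_Id2(2)[of i' X' Z' i X Z p X] arr by (simp add: eqs)
    have "(Id2 B Z' \<star> p) \<cdot> (j' \<star> j) = j' \<star> zero A C Y X"
      using HComp2_VComp_Id2(2)[of j' Y' Z' j Y Z p X] arr by (simp add: eqs)
    also have "\<dots> = zero C C (Y' \<odot> Y) (Z' \<odot> X)" using arr by (intro HComp2_zero) (auto simp: hom1_def)
    finally show "(Id2 B Z' \<star> p) \<cdot> (j' \<star> j) = zero C C (Y' \<odot> Y) (Z' \<odot> X)" .
  qed
qed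

text \<open>By the transfer lemmas the triangle identities of \<open>Z\<close> hold after precomposition with the inclusions of
the summands, whiskered with a unit. These are again the inclusions of a biproduct, hence jointly epic.\<close>
theorem left_dualizable_biproduct:
  assumes Z: "biproduct2 A C X Y Z i j p q" and "left_dualizable B X" "left_dualizable B Y"
  shows "left_dualizable B Z"
proof -
  obtain X' \<eta>X \<epsilon>X Y' \<eta>Y \<epsilon>Y where X: "is_left_dual B X X' \<eta>X \<epsilon>X" and Y: "is_left_dual B Y Y' \<eta>Y \<epsilon>Y"
    using assms(2,3) by (auto simp: left_dualizable_def)
  have ob: "X \<in> Cells1 B" "Y \<in> Cells1 B" "Z \<in> Cells1 B" "Src B X = A" "Trg B X = C" "Src B Y = A"
      "Trg B Y = C" "Src B Z = A" "Trg B Z = C"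
    and arr: "i \<in> Cells2 B X Z" "j \<in> Cells2 B Y Z" "p \<in> Cells2 B Z X" "q \<in> Cells2 B Z Y"
    using Z by (auto simp: biproduct2_iff hom1_def)
  note [simp] = ob
  have c [simp]: "A \<in> Cells0 B" "C \<in> Cells0 B" using ob Src_closed Trg_closed by metis+
  have ob': "X' \<in> Cells1 B" "Y' \<in> Cells1 B" "Src B X' = C" "Trg B X' = A" "Src B Y' = C" "Trg B Y' = A"
    and \<eta>: "\<eta>X \<in> Cells2 B (Unit1 B C) (X' \<odot> X)" "\<eta>Y \<in> Cells2 B (Unit1 B C) (Y' \<odot> Y)"
    and \<epsilon>: "\<epsilon>X \<in> Cells2 B (X \<odot> X') (Unit1 B A)" "\<epsilon>Y \<in> Cells2 B (Y \<odot> Y') (Unit1 B A)"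
    using X Y by (auto simp: is_left_dual_def hom1_def)
  note [simp] = ob'
  obtain Z' i' j' p' q' where Z': "biproduct2 C A X' Y' Z' i' j' p' q'"
    using ex_biproduct2[of X' C A Y'] by (auto simp: hom1_def)
  have ob'' [simp]: "Z' \<in> Cells1 B" "Src B Z' = C" "Trg B Z' = A"
    and arr': "i' \<in> Cells2 B X' Z'" "j' \<in> Cells2 B Y' Z'" "p' \<in> Cells2 B Z' X'" "q' \<in> Cells2 B Z' Y'"
    using Z' by (auto simp: biproduct2_iff hom1_def)
  let ?\<eta> = "add C C (Unit1 B C) (Z' \<odot> Z) ((i' \<star> i) \<cdot> \<eta>X) ((j' \<star> j) \<cdot> \<eta>Y)"
  let ?\<epsilon> = "add A A (Z \<odot> Z') (Unit1 B A) (\<epsilon>X \<cdot> (p \<star> p')) (\<epsilon>Y \<cdot> (q \<star> q'))"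
  note EX = biproduct_ev_coev[OF Z Z' \<eta> \<epsilon>]
  \<comment> \<open>The statements about \<open>Y\<close> are those about \<open>X\<close> for the biproduct with its summands exchanged.\<close>
  have sw: "biproduct2 A C Y X Z j i q p" "biproduct2 C A Y' X' Z' j' i' q' p'"
    by (rule preadditive_category.is_biproduct_swap[OF preadditive_hom Z]
        preadditive_category.is_biproduct_swap[OF preadditive_hom Z'], simp_all)+
  have "?\<eta> = add C C (Unit1 B C) (Z' \<odot> Z) ((j' \<star> j) \<cdot> \<eta>Y) ((i' \<star> i) \<cdot> \<eta>X)"
    using arr arr' \<eta> by (intro add_commute2 VComp_closed[OF \<eta>(1)] VComp_closed[OF \<eta>(2)] HComp2_closed) simp_all
  moreover have "?\<epsilon> = add A A (Z \<odot> Z') (Unit1 B A) (\<epsilon>Y \<cdot> (q \<star> q')) (\<epsilon>X \<cdot> (p \<star> p'))"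
    using arr arr' \<epsilon> by (intro add_commute2 VComp_closed[OF _ \<epsilon>(1)] VComp_closed[OF _ \<epsilon>(2)]
        HComp2_closed) simp_all
  ultimately have EY: "?\<epsilon> \<cdot> (j \<star> Id2 B Z') = \<epsilon>Y \<cdot> (Id2 B Y \<star> q')" "?\<epsilon> \<cdot> (Id2 B Z \<star> j') = \<epsilon>Y \<cdot> (q \<star> Id2 B Y')"
    "(q' \<star> Id2 B Z) \<cdot> ?\<eta> = (Id2 B Y' \<star> j) \<cdot> \<eta>Y" "(Id2 B Z' \<star> q) \<cdot> ?\<eta> = (j' \<star> Id2 B Y) \<cdot> \<eta>Y"
    using biproduct_ev_coev(3-6)[OF sw \<eta>(2,1) \<epsilon>(2,1)] by simp_all
  define eta where "eta = Cell (Unit1 B C) ?\<eta> (Z' \<odot> Z)"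
  define eps where "eps = Cell (Z \<odot> Z') ?\<epsilon> (Unit1 B A)"
  have eta: "is_cell eta" "dm eta = Unit1 B C" "cd eta = Z' \<odot> Z" "raw eta = ?\<eta>"
    and eps: "is_cell eps" "dm eps = Z \<odot> Z'" "cd eps = Unit1 B A" "raw eps = ?\<epsilon>"
    using EX(1,2) by (simp_all add: eta_def eps_def is_cell_def)
  note [simp] = eta(1-3) eps(1-3)
  have transfer: "(lu Z \<circ>\<^sub>v (eps \<star>\<^sub>h idc Z) \<circ>\<^sub>v asci Z Z' Z \<circ>\<^sub>v (idc Z \<star>\<^sub>h eta)) \<circ>\<^sub>v (Cell M k Z \<star>\<^sub>h idc (Unit1 B C))
      = ru Z \<circ>\<^sub>v (Cell M k Z \<star>\<^sub>h idc (Unit1 B C))" (is ?L)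
    "(ru Z' \<circ>\<^sub>v (idc Z' \<star>\<^sub>h eps) \<circ>\<^sub>v asc Z' Z Z' \<circ>\<^sub>v (eta \<star>\<^sub>h idc Z')) \<circ>\<^sub>v (idc (Unit1 B C) \<star>\<^sub>h Cell M' k' Z')
      = lu Z' \<circ>\<^sub>v (idc (Unit1 B C) \<star>\<^sub>h Cell M' k' Z')" (is ?R)
    if M: "is_left_dual B M M' \<eta>M \<epsilon>M" "M \<in> hom1 B A C"
      and k: "k \<in> Cells2 B M Z" "l \<in> Cells2 B Z M" "k' \<in> Cells2 B M' Z'" "l' \<in> Cells2 B Z' M'"
      and E: "?\<epsilon> \<cdot> (k \<star> Id2 B Z') = \<epsilon>M \<cdot> (Id2 B M \<star> l')" "?\<epsilon> \<cdot> (Id2 B Z \<star> k') = \<epsilon>M \<cdot> (l \<star> Id2 B M')"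
      "(l' \<star> Id2 B Z) \<cdot> ?\<eta> = (Id2 B M' \<star> k) \<cdot> \<eta>M" "(Id2 B Z' \<star> l) \<cdot> ?\<eta> = (k' \<star> Id2 B M) \<cdot> \<eta>M"
    for M M' \<eta>M \<epsilon>M k l k' l'
  proof -
    have [simp]: "Src B M = A" "Trg B M = C" "M \<in> Cells1 B" "Src B M' = C" "Trg B M' = A" "M' \<in> Cells1 B"
      using M by (auto simp: is_left_dual_def hom1_def)
    have [simp]: "is_cell (Cell M k Z)" "is_cell (Cell Z l M)" "is_cell (Cell M' k' Z')"
        "is_cell (Cell Z' l' M')"
      "is_cell (Cell (Unit1 B C) \<eta>M (M' \<odot> M))" "is_cell (Cell (M \<odot> M') \<epsilon>M (Unit1 B A))"
      using k M by (auto simp: is_cell_def is_left_dual_def)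
    have d: "dual_pair M M' (Cell (Unit1 B C) \<eta>M (M' \<odot> M)) (Cell (M \<odot> M') \<epsilon>M (Unit1 B A))"
      using M(1) by (simp add: is_left_dual_iff)
    have AC: "Src B M = A" "Trg B M = C" by simp_all
    show ?L
    proof (rule triangle_left_transfer[OF d, of "Cell M k Z" Z "Cell Z' l' M'" Z' eta eps, unfolded AC])
      show "eps \<circ>\<^sub>v (Cell M k Z \<star>\<^sub>h idc Z') = Cell (M \<odot> M') \<epsilon>M (Unit1 B A) \<circ>\<^sub>v (idc M \<star>\<^sub>h Cell Z' l' M')"
        by (rule cell_eqI) (simp_all add: E eps)
      show "(Cell Z' l' M' \<star>\<^sub>h idc Z) \<circ>\<^sub>v eta = (idc M' \<star>\<^sub>h Cell M k Z) \<circ>\<^sub>v Cell (Unit1 B C) \<eta>M (M' \<odot> M)"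
        by (rule cell_eqI) (simp_all add: E eta)
    qed simp_all
    show ?R
    proof (rule triangle_right_transfer[OF d, of "Cell Z l M" Z "Cell M' k' Z'" Z' eta eps, unfolded AC])
      show "eps \<circ>\<^sub>v (idc Z \<star>\<^sub>h Cell M' k' Z') = Cell (M \<odot> M') \<epsilon>M (Unit1 B A) \<circ>\<^sub>v (Cell Z l M \<star>\<^sub>h idc M')"
        by (rule cell_eqI) (simp_all add: E eps)
      show "(idc Z' \<star>\<^sub>h Cell Z l M) \<circ>\<^sub>v eta = (Cell M' k' Z' \<star>\<^sub>h idc M) \<circ>\<^sub>v Cell (Unit1 B C) \<eta>M (M' \<odot> M)"
        by (rule cell_eqI) (simp_all add: E eta)
    qed simp_all
  qed
  have "lu Z \<circ>\<^sub>v (eps \<star>\<^sub>h idc Z) \<circ>\<^sub>v asci Z Z' Z \<circ>\<^sub>v (idc Z \<star>\<^sub>h eta) = ru Z" (is "?l = _")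
  proof (rule cell_eqI)
    have U: "Unit1 B C \<in> hom1 B C C" by (simp add: hom1_def)
    note bi = biproduct2_whisker(1)[OF Z c c(2) U]
    have "is_cell ?l" "dm ?l = Z \<odot> Unit1 B C" "cd ?l = Z" by simp_all
    hence l: "raw ?l \<in> Cells2 B (Z \<odot> Unit1 B C) Z" unfolding is_cell_def by metis
    have r: "RUnit B Z \<in> Cells2 B (Z \<odot> Unit1 B C) Z" using is_cell_unitors(3)[of Z] by (simp add: is_cell_def)
    have cells [simp]: "is_cell (Cell X i Z)" "is_cell (Cell Y j Z)" using arr by (simp_all add: is_cell_def)
    have "raw ?l \<cdot> (i \<star> Id2 B (Unit1 B C)) = RUnit B Z \<cdot> (i \<star> Id2 B (Unit1 B C))"
      using arg_cong[OF transfer(1)[OF X _ arr(1,3) arr'(1,3) EX(3,4,5,6)], of raw]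
          by (simp add: hom1_def del: vc_assoc)
    moreover have "raw ?l \<cdot> (j \<star> Id2 B (Unit1 B C)) = RUnit B Z \<cdot> (j \<star> Id2 B (Unit1 B C))"
      using arg_cong[OF transfer(1)[OF Y _ arr(2,4) arr'(2,4) EY], of raw] by (simp add: hom1_def del: vc_assoc)
    ultimately show "raw ?l = raw (ru Z)"
      using preadditive_category.biproduct_joint_epi[OF preadditive_hom[OF c] bi, of "raw ?l" Z "RUnit B Z"] l r
      by (simp add: hom_category_def hom1_def)
  qed simp_all
  moreover have "ru Z' \<circ>\<^sub>v (idc Z' \<star>\<^sub>h eps) \<circ>\<^sub>v asc Z' Z Z' \<circ>\<^sub>v (eta \<star>\<^sub>h idc Z') = lu Z'" (is "?l = _")
  proof (rule cell_eqI)
    have U: "Unit1 B C \<in> hom1 B C C" by (simp add: hom1_def)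
    note bi = biproduct2_whisker(2)[OF Z' c(2,1) c(2) U]
    have "is_cell ?l" "dm ?l = Unit1 B C \<odot> Z'" "cd ?l = Z'" by simp_all
    hence l: "raw ?l \<in> Cells2 B (Unit1 B C \<odot> Z') Z'" unfolding is_cell_def by metis
    have r: "LUnit B Z' \<in> Cells2 B (Unit1 B C \<odot> Z') Z'" using is_cell_unitors(1)[of Z']
        by (simp add: is_cell_def)
    have cells [simp]: "is_cell (Cell X' i' Z')" "is_cell (Cell Y' j' Z')" using arr'
        by (simp_all add: is_cell_def)
    have "raw ?l \<cdot> (Id2 B (Unit1 B C) \<star> i') = LUnit B Z' \<cdot> (Id2 B (Unit1 B C) \<star> i')"
      using arg_cong[OF transfer(2)[OF X _ arr(1,3) arr'(1,3) EX(3,4,5,6)], of raw]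
          by (simp add: hom1_def del: vc_assoc)
    moreover have "raw ?l \<cdot> (Id2 B (Unit1 B C) \<star> j') = LUnit B Z' \<cdot> (Id2 B (Unit1 B C) \<star> j')"
      using arg_cong[OF transfer(2)[OF Y _ arr(2,4) arr'(2,4) EY], of raw] by (simp add: hom1_def del: vc_assoc)
    ultimately show "raw ?l = raw (lu Z')"
      using preadditive_category.biproduct_joint_epi[OF preadditive_hom[OF c(2,1)] bi, of "raw ?l" Z' "LUnit B Z'"] l r
      by (simp add: hom_category_def hom1_def)
  qed simp_all
  ultimately have "is_left_dual B Z Z' ?\<eta> ?\<epsilon>"
    unfolding is_left_dual_iff ob eta_def[symmetric] eps_def[symmetric] by (simp add: dual_pair_def)
  thus ?thesis by (auto simp: left_dualizable_def)
qed

end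

section \<open>Mates\<close>

context bicategory
begin

text \<open>The mate \<open>h\<^sup>* : X' \<Rightarrow> Z'\<close> of \<open>h : Z \<Rightarrow> X\<close> under dualities of \<open>X\<close> and \<open>Z\<close>, that is, the composite
\<open>X' \<cong> U X' \<Rightarrow> (Z' Z) X' \<cong> Z' (Z X') \<Rightarrow> Z' (X X') \<Rightarrow> Z' U \<cong> Z'\<close>.\<close>
definition mate :: "'m \<Rightarrow> 'm \<Rightarrow> 'm \<Rightarrow> ('m, 'c) cell \<Rightarrow> ('m, 'c) cell \<Rightarrow> ('m, 'c) cell \<Rightarrow> ('m, 'c) cell" where
  "mate Z Z' X' \<eta>Z \<epsilon>X h = ru Z' \<circ>\<^sub>v (idc Z' \<star>\<^sub>h (\<epsilon>X \<circ>\<^sub>v (h \<star>\<^sub>h idc X'))) \<circ>\<^sub>v asc Z' Z X' \<circ>\<^sub>v (\<eta>Z \<star>\<^sub>h idc X') \<circ>\<^sub>v lui X'"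

text \<open>Inserting the definition of the mate into the first equation produces the first triangle identity of
\<open>Z\<close>, applied next to \<open>X'\<close>; in the second equation it produces the first triangle identity of \<open>X\<close>,
applied next to \<open>Z'\<close>.\<close>
lemma mate_laws:
  assumes X: "dual_pair X X' \<eta>X \<epsilon>X" and Z: "dual_pair Z Z' \<eta>Z \<epsilon>Z" and [simp]: "is_cell h" "dm h = Z" "cd h = X"
  shows "typed (mate Z Z' X' \<eta>Z \<epsilon>X h) X' Z'"
    and "\<epsilon>Z \<circ>\<^sub>v (idc Z \<star>\<^sub>h mate Z Z' X' \<eta>Z \<epsilon>X h) = \<epsilon>X \<circ>\<^sub>v (h \<star>\<^sub>h idc X')"
    and "(mate Z Z' X' \<eta>Z \<epsilon>X h \<star>\<^sub>h idc X) \<circ>\<^sub>v \<eta>X = (idc Z' \<star>\<^sub>h h) \<circ>\<^sub>v \<eta>Z"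
proof -
  have [simp]: "Src B Z = Src B X" "Trg B Z = Trg B X" using dm_cd[of h] by auto
  let ?U = "Unit1 B (Trg B X)" and ?V = "Unit1 B (Src B X)"
  have [simp]: "X \<in> Cells1 B" "X' \<in> Cells1 B" "Src B X' = Trg B X" "Trg B X' = Src B X"
    "is_cell \<eta>X" "dm \<eta>X = ?U" "cd \<eta>X = X' \<odot> X" "is_cell \<epsilon>X" "dm \<epsilon>X = X \<odot> X'" "cd \<epsilon>X = ?V"
    and triX: "lu X \<circ>\<^sub>v (\<epsilon>X \<star>\<^sub>h idc X) \<circ>\<^sub>v asci X X' X \<circ>\<^sub>v (idc X \<star>\<^sub>h \<eta>X) = ru X"
    using X by (auto simp: dual_pair_def)
  have [simp]: "Z \<in> Cells1 B" "Z' \<in> Cells1 B" "Src B Z' = Trg B X" "Trg B Z' = Src B X"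
    "is_cell \<eta>Z" "dm \<eta>Z = ?U" "cd \<eta>Z = Z' \<odot> Z" "is_cell \<epsilon>Z" "dm \<epsilon>Z = Z \<odot> Z'" "cd \<epsilon>Z = ?V"
    and triZ: "lu Z \<circ>\<^sub>v (\<epsilon>Z \<star>\<^sub>h idc Z) \<circ>\<^sub>v asci Z Z' Z \<circ>\<^sub>v (idc Z \<star>\<^sub>h \<eta>Z) = ru Z"
    using Z by (auto simp: dual_pair_def)
  show "typed (mate Z Z' X' \<eta>Z \<epsilon>X h) X' Z'" by (simp add: mate_def)
  \<comment> \<open>Both equations treat \<open>h\<close> and \<open>\<epsilon>X\<close> as one 2-cell \<open>k\<close> from \<open>Z \<odot> X'\<close> to the unit.\<close>
  define k where "k = \<epsilon>X \<circ>\<^sub>v (h \<star>\<^sub>h idc X')"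
  have [simp]: "is_cell k" "dm k = Z \<odot> X'" "cd k = ?V" by (simp_all add: k_def)
  show "\<epsilon>Z \<circ>\<^sub>v (idc Z \<star>\<^sub>h mate Z Z' X' \<eta>Z \<epsilon>X h) = \<epsilon>X \<circ>\<^sub>v (h \<star>\<^sub>h idc X')"
    unfolding k_def[symmetric]
  proof (rule invc_cancel_right[OF invc_hc[OF invc_idc[of Z] invc_lu[of X']]])
    note n1 = ru_HComp1_inv(1)[of Z Z', simplified, symmetric]
      and n2 = ru_natural[of \<epsilon>Z "Z \<odot> Z'" ?V, simplified, symmetric]
      and n3 = asci_natural[of "idc Z" Z Z "idc Z'" Z' Z' k "Z \<odot> X'" ?V, simplified]
      and n4 = whisker_exchange[of \<epsilon>Z "Z \<odot> Z'" ?V k "Z \<odot> X'" ?V, simplified]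
      and n5 = lu_natural[of k "Z \<odot> X'" ?V, simplified]
      and p = asc_pentagon_inv(2)[of Z Z' Z X', simplified, symmetric]
      and n6 = asci_natural[of "idc Z" Z Z \<eta>Z ?U "Z' \<odot> Z" "idc X'" X' X', simplified]
      and n7 = asc_natural[of \<epsilon>Z "Z \<odot> Z'" ?V "idc Z" Z Z "idc X'" X' X', simplified, symmetric]
      and l = lu_HComp1[of Z X', simplified]
      and tri = arg_cong[OF triZ, of "\<lambda>x. x \<star>\<^sub>h idc X'", simplified]
      and t = whiskered_triangle_inv[of Z X', simplified]
      and c = invcD(5,7)[OF invc_hc[OF invc_idc invc_lu], of Z X', simplified]
    show "(\<epsilon>Z \<circ>\<^sub>v (idc Z \<star>\<^sub>h mate Z Z' X' \<eta>Z \<epsilon>X h)) \<circ>\<^sub>v (idc Z \<star>\<^sub>h lu X') = k \<circ>\<^sub>v (idc Z \<star>\<^sub>h lu X')"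
      unfolding mate_def k_def[symmetric]
      by (simp add: n1 n2[THEN vc_assoc_eq2] n3[THEN vc_assoc_eq2] n4[THEN vc_assoc_eq2]
          lu_Unit1[symmetric] n5[THEN vc_assoc_eq2]
        p[THEN vc_assoc_eq2] n6 n7[THEN vc_assoc_eq2] l[THEN vc_assoc_eq2] tri[THEN vc_assoc_eq4] t c)
  qed (simp_all add: mate_def)
  have bracket: "lu X \<circ>\<^sub>v (k \<star>\<^sub>h idc X) \<circ>\<^sub>v asci Z X' X \<circ>\<^sub>v (idc Z \<star>\<^sub>h \<eta>X) = h \<circ>\<^sub>v ru Z"
  proof -
    note n1 = asci_natural[of h Z X "idc X'" X' X' "idc X" X X, simplified, symmetric]
      and n2 = whisker_exchange[of h Z X \<eta>X ?U "X' \<odot> X", simplified]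
      and n3 = ru_natural[of h Z X, simplified]
    show ?thesis by (simp add: k_def n1[THEN vc_assoc_eq2] n2 triX[THEN vc_assoc_eq4] n3)
  qed
  note n1 = lu_natural[of \<eta>X ?U "X' \<odot> X", simplified]
    and n2 = asci_natural[of \<eta>Z ?U "Z' \<odot> Z" "idc X'" X' X' "idc X" X X, simplified, symmetric]
    and n3 = whisker_exchange[of \<eta>Z ?U "Z' \<odot> Z" \<eta>X ?U "X' \<odot> X", simplified]
    and p = asc_pentagon_inv(1)[of Z' Z X' X, simplified]
    and n4 = asc_natural[of "idc Z'" Z' Z' "idc Z" Z Z \<eta>X ?U "X' \<odot> X", simplified]
    and n5 = asci_natural[of "idc Z'" Z' Z' k "Z \<odot> X'" ?V "idc X" X X, simplified, symmetric]
    and t = whiskered_triangle_inv[of Z' X, simplified]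
    and b = arg_cong[OF bracket, of "\<lambda>x. idc Z' \<star>\<^sub>h x", simplified]
    and r = ru_HComp1[of Z' Z, simplified]
    and n6 = ru_natural[of \<eta>Z ?U "Z' \<odot> Z", simplified]
  have l: "lui X' \<star>\<^sub>h idc X = asci ?U X' X \<circ>\<^sub>v lui (X' \<odot> X)"
    by (simp flip: lu_HComp1_inv(2)[of X' X, simplified])
  have u: "lui (X' \<odot> X) \<circ>\<^sub>v \<eta>X = (idc ?U \<star>\<^sub>h \<eta>X) \<circ>\<^sub>v lui ?U"
    by (rule invc_cancel_left[OF invc_lu[of "X' \<odot> X"]]) (simp_all add: n1[THEN vc_assoc_eq2])
  show "(mate Z Z' X' \<eta>Z \<epsilon>X h \<star>\<^sub>h idc X) \<circ>\<^sub>v \<eta>X = (idc Z' \<star>\<^sub>h h) \<circ>\<^sub>v \<eta>Z"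
    unfolding mate_def k_def[symmetric]
    by (simp add: l u n2[THEN vc_assoc_eq2] n3[THEN vc_assoc_eq2] p[THEN vc_assoc_eq2] n4[THEN vc_assoc_eq2]
      n5[THEN vc_assoc_eq2] t[THEN vc_assoc_eq2] b[THEN vc_assoc_eq4] r[THEN vc_assoc_eq2]
          n6[THEN vc_assoc_eq2] lu_Unit1[symmetric])
qed

end

section \<open>Cyclicity of the twisted trace\<close>

context category
begin

definition arr :: "'a \<Rightarrow> 'o \<Rightarrow> 'o \<Rightarrow> bool" where
  "arr f X Y \<longleftrightarrow> X \<in> Ob C \<and> Y \<in> Ob C \<and> f \<in> Hom C X Y"

lemma arr_Comp: "\<lbrakk>arr f X Y; arr h Y Z\<rbrakk> \<Longrightarrow> arr (h \<bullet> f) X Z"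
  by (auto simp: arr_def intro: Comp_closed)

lemma arr_assoc: "\<lbrakk>arr f X Y; arr h Y Z; arr k Z V\<rbrakk> \<Longrightarrow> k \<bullet> h \<bullet> f = k \<bullet> (h \<bullet> f)"
  by (auto simp: arr_def intro: Comp_assoc)

lemma paste_squares:
  assumes "arr a X X'" "arr f X Y" "arr h Y Z" "arr f' X' Y'" "arr h' Y' Z'" "arr b Y Y'" "arr c Z Z'"
    and "f' \<bullet> a = b \<bullet> f" "h' \<bullet> b = c \<bullet> h"
  shows "(h' \<bullet> f') \<bullet> a = c \<bullet> (h \<bullet> f)"
  using assms arr_assoc[of a X X' f' Y' h' Z'] arr_assoc[of f X Y b Y' h' Z']
      arr_assoc[of f X Y h Z c Z'] by simp

end

locale twisted_shadow = twisting B G W + shadow B T S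
  for B :: "('o, 'm, 'c) bicategory" (structure) and G :: "'g monoid" and W :: "('g, 'o, 'm, 'c) twisting"
    and T :: "('t, 'u) category" and S :: "('o, 'm, 'c, 't, 'u) shadow" +
  fixes g :: 'g
  assumes g: "g \<in> carrier G"
begin

lemma ginv [simp]: "inv\<^bsub>G\<^esub> g \<in> carrier G" using g by simp

abbreviation Th :: "'o \<Rightarrow> 'm" where "Th A \<equiv> Theta W A (inv\<^bsub>G\<^esub> g)"

definition Shc :: "'o \<Rightarrow> ('m, 'c) cell \<Rightarrow> 'u" where "Shc R c = ShArr S R (raw c)"

lemma arr_Shc:
  assumes "is_cell c" "Src B (dm c) = R" "Trg B (dm c) = R" "dm c = M" "cd c = N"
  shows "T.arr (Shc R c) (ShOb S R M) (ShOb S R N)"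
proof -
  have "R \<in> Cells0 B" using assms(1,2) by auto
  thus ?thesis using Sh_functor[of R] assms dm_cd[of c]
    by (auto simp: T.arr_def Shc_def is_functor_def hom_category_def hom1_def is_cell_def)
qed

lemma Shc_vc:
  assumes "is_cell c" "is_cell d" "dm c = cd d" "Src B (dm d) = R" "Trg B (dm d) = R"
  shows "Shc R (c \<circ>\<^sub>v d) = Shc R c \<bullet>\<^bsub>T\<^esub> Shc R d"
proof -
  have "R \<in> Cells0 B" using assms(2,4) by auto
  moreover have "dm d \<in> hom1 B R R" "cd d \<in> hom1 B R R" "cd c \<in> hom1 B R R"
    "raw d \<in> Cells2 B (dm d) (cd d)" "raw c \<in> Cells2 B (cd d) (cd c)"
    using assms dm_cd[of c] dm_cd[of d] by (auto simp: hom1_def is_cell_def)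
  ultimately have "ShArr S R (raw c \<cdot> raw d) = ShArr S R (raw c) \<bullet>\<^bsub>T\<^esub> ShArr S R (raw d)"
    using Sh_functor[of R] unfolding is_functor_def by (auto simp: hom_category_def)
  thus ?thesis using assms by (simp add: Shc_def)
qed

definition transport_cell :: "'m \<times> ('g \<Rightarrow> 'c) \<Rightarrow> ('m, 'c) cell" where
  "transport_cell X = Cell (fst X \<odot> Th (Trg B (fst X))) (transport B G W g X) (Th (Src B (fst X)) \<odot> fst X)"

lemma invc_transport_cell:
  assumes X: "X \<in> twist_cells1 B G W"
  shows "invc (twist_cell X (inv\<^bsub>G\<^esub> g)) (transport_cell X)"
proof -
  obtain k where k: "invc (twist_cell X (inv\<^bsub>G\<^esub> g)) k" using twist_cells1D(3)[OF X ginv] by blast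
  have kc: "k = Cell (fst X \<odot> Th (Trg B (fst X))) (raw k) (Th (Src B (fst X)) \<odot> fst X)"
    using invcD[OF k] by (cases k) auto
  hence "inverse2 (Th (Src B (fst X)) \<odot> fst X) (fst X \<odot> Th (Trg B (fst X))) (snd X (inv\<^bsub>G\<^esub> g)) (raw k)"
    using k unfolding twist_cell_def by (metis invc_iff_inverse2)
  hence "transport B G W g X = raw k"
    by (simp add: transport_def split_beta inv2_eqI)
  thus ?thesis using k kc by (simp add: transport_cell_def)
qed

lemma transport_cell_simps [simp]:
  "dm (transport_cell X) = fst X \<odot> Th (Trg B (fst X))"
      "cd (transport_cell X) = Th (Src B (fst X)) \<odot> fst X" "raw (transport_cell X) = transport B G W g X"
  "X \<in> twist_cells1 B G W \<Longrightarrow> is_cell (transport_cell X)"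
  using invcD(2)[OF invc_transport_cell] by (simp_all add: transport_cell_def)

lemma transport_cell_natural:
  assumes X: "X \<in> twist_cells1 B G W" and Z: "Z \<in> twist_cells1 B G W" and [simp]: "is_cell F"
      "dm F = fst X" "cd F = fst Z"
    and F: "\<forall>g\<in>carrier G. twist_cell Z g \<circ>\<^sub>v (idc (Theta W (Src B (fst X)) g) \<star>\<^sub>h F)
        = (F \<star>\<^sub>h idc (Theta W (Trg B (fst X)) g)) \<circ>\<^sub>v twist_cell X g"
  shows "transport_cell Z \<circ>\<^sub>v (F \<star>\<^sub>h idc (Th (Trg B (fst X)))) = (idc (Th (Src B (fst X))) \<star>\<^sub>h F)
      \<circ>\<^sub>v transport_cell X"
  by (rule invc_square[OF invc_transport_cell[OF Z] invc_transport_cell[OF X]])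
    (use F dm_cd[of F] twist_cells1D(1)[OF X] in auto)

text \<open>The part of the twisted cyclicity isomorphism that follows \<open>\<theta>\<close>: with \<open>X = (N, \<tau>)\<close>, it moves
\<open>\<Theta>(g\<^sup>-\<^sup>1)\<close> to the front, \<open>N \<odot> (\<Theta> \<odot> M) \<Rightarrow> \<Theta> \<odot> (N \<odot> M)\<close>, by the transport map of \<open>X\<close>.\<close>
definition rotation :: "'m \<Rightarrow> 'm \<times> ('g \<Rightarrow> 'c) \<Rightarrow> ('m, 'c) cell" where
  "rotation M X = asc (Th (Src B (fst X))) (fst X) M \<circ>\<^sub>v (transport_cell X \<star>\<^sub>h idc M)
      \<circ>\<^sub>v asci (fst X) (Th (Trg B (fst X))) M"

lemma typed_rotation [simp]:
  assumes "X \<in> twist_cells1 B G W" "M \<in> Cells1 B" "Src B M = Trg B (fst X)"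
  shows "is_cell (rotation M X)" "dm (rotation M X) = fst X \<odot> (Th (Trg B (fst X)) \<odot> M)"
    "cd (rotation M X) = Th (Src B (fst X)) \<odot> (fst X \<odot> M)"
  using assms twist_cells1D(1)[OF assms(1)] by (simp_all add: rotation_def)

lemma rotation_natural:
  assumes X: "X \<in> twist_cells1 B G W" and Z: "Z \<in> twist_cells1 B G W" and [simp]: "is_cell F"
      "dm F = fst X" "cd F = fst Z"
    and F: "\<forall>g\<in>carrier G. twist_cell Z g \<circ>\<^sub>v (idc (Theta W (Src B (fst X)) g) \<star>\<^sub>h F)
        = (F \<star>\<^sub>h idc (Theta W (Trg B (fst X)) g)) \<circ>\<^sub>v twist_cell X g"
    and [simp]: "is_cell a" "dm a = M" "cd a = M'" "Src B M = Trg B (fst X)"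
  shows "rotation M' Z \<circ>\<^sub>v (F \<star>\<^sub>h (idc (Th (Trg B (fst X))) \<star>\<^sub>h a))
      = (idc (Th (Src B (fst X))) \<star>\<^sub>h (F \<star>\<^sub>h a)) \<circ>\<^sub>v rotation M X"
proof -
  let ?A = "Th (Src B (fst X))" and ?C = "Th (Trg B (fst X))"
  have [simp]: "fst X \<in> Cells1 B" "fst Z \<in> Cells1 B" "Src B (fst Z) = Src B (fst X)"
      "Trg B (fst Z) = Trg B (fst X)"
     "M \<in> Cells1 B" "M' \<in> Cells1 B" "Src B M' = Trg B (fst X)" "is_cell (transport_cell X)"
         "is_cell (transport_cell Z)"
    using dm_cd[of F] dm_cd[of a] X Z by auto
  note n1 = asci_natural[of F "fst X" "fst Z" "idc ?C" ?C ?C a M M', simplified]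
    and n2 = asc_natural[of "idc ?A" ?A ?A F "fst X" "fst Z" a M M', simplified]
  have sq: "(transport_cell Z \<star>\<^sub>h idc M') \<circ>\<^sub>v ((F \<star>\<^sub>h idc ?C) \<star>\<^sub>h a) = ((idc ?A \<star>\<^sub>h F) \<star>\<^sub>h a)
      \<circ>\<^sub>v (transport_cell X \<star>\<^sub>h idc M)"
    using transport_cell_natural[OF X Z _ _ _ F] hc_vc[of "F \<star>\<^sub>h idc ?C" "transport_cell Z" a "idc M'"]
        hc_vc[of "transport_cell X" "idc ?A \<star>\<^sub>h F" "idc M" a]
    by simp
  show ?thesis by (simp add: rotation_def n1 sq[THEN vc_assoc_eq2] n2[THEN vc_assoc_eq2])
qed

lemma twShTheta_eq:
  assumes X: "X \<in> twist_cells1 B G W" and [simp]: "fst X' \<in> Cells1 B" "Src B (fst X') = Trg B (fst X)"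
      "Trg B (fst X') = Src B (fst X)"
  shows "twShTheta B G W T S g X' X =
     (Shc (Src B (fst X)) (rotation (fst X') X) \<bullet>\<^bsub>T\<^esub> ShTheta S (Th (Trg B (fst X)) \<odot> fst X') (fst X))
      \<bullet>\<^bsub>T\<^esub> Shc (Trg B (fst X)) (asci (Th (Trg B (fst X))) (fst X') (fst X))"
proof -
  let ?A = "Src B (fst X)" and ?C = "Trg B (fst X)"
  have [simp]: "fst X \<in> Cells1 B" "is_cell (transport_cell X)" using X twist_cells1D(1)[OF X] by simp_all
  have "Shc ?A (rotation (fst X') X) = Shc ?A (asc (Th ?A) (fst X) (fst X'))
      \<bullet>\<^bsub>T\<^esub> Shc ?A (transport_cell X \<star>\<^sub>h idc (fst X')) \<bullet>\<^bsub>T\<^esub>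
     Shc ?A (asci (fst X) (Th ?C) (fst X'))"
    unfolding rotation_def vc_assoc[symmetric] by (simp add: Shc_vc del: vc_assoc)
  thus ?thesis by (simp add: twShTheta_def Let_def) (simp add: Shc_def)
qed

lemma arr_ShTheta:
  assumes "M \<in> Cells1 B" "N \<in> Cells1 B" "Src B N = Trg B M" "Trg B N = Src B M"
  shows "T.arr (ShTheta S M N) (ShOb S (Src B M) (M \<odot> N)) (ShOb S (Trg B M) (N \<odot> M))"
proof -
  have "is_iso T (ShOb S (Src B M) (M \<odot> N)) (ShOb S (Trg B M) (N \<odot> M)) (ShTheta S M N)"
    using assms by (intro theta_iso) (auto simp: hom1_def)
  hence "ShTheta S M N \<in> Hom T (ShOb S (Src B M) (M \<odot> N)) (ShOb S (Trg B M) (N \<odot> M))"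
      by (auto simp: is_iso_def is_inverse_def)
  thus ?thesis using arr_Shc[of "idc (M \<odot> N)" "Src B M"] arr_Shc[of "idc (N \<odot> M)" "Trg B M"] assms
      by (simp add: T.arr_def)
qed

definition twSh :: "'o \<Rightarrow> ('m, 'c) cell \<Rightarrow> 'u" where "twSh R c = Shc R (idc (Th R) \<star>\<^sub>h c)"

lemma arr_twSh:
  assumes "is_cell c" "Src B (dm c) = R" "Trg B (dm c) = R" "dm c = M" "cd c = N"
  shows "T.arr (twSh R c) (ShOb S R (Th R \<odot> M)) (ShOb S R (Th R \<odot> N))"
proof -
  have "R \<in> Cells0 B" using assms(1,2) by auto
  thus ?thesis using assms unfolding twSh_def by (intro arr_Shc) auto
qed

lemma twSh_vc:
  assumes "is_cell c" "is_cell d" "dm c = cd d" "Src B (dm d) = R" "Trg B (dm d) = R"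
  shows "twSh R (c \<circ>\<^sub>v d) = twSh R c \<bullet>\<^bsub>T\<^esub> twSh R d"
proof -
  have "R \<in> Cells0 B" using assms(2,4) by auto
  thus ?thesis using assms dm_cd[of c] dm_cd[of d] by (simp add: twSh_def Shc_vc)
qed

lemma twSh_raw: "\<lbrakk>is_cell c; Src B (dm c) = R; Trg B (dm c) = R\<rbrakk> \<Longrightarrow> twSh R c = twShArr B G W S g R (raw c)"
  using dm_cd(1)[of c] Src_closed[of "dm c"] by (simp add: twSh_def Shc_def twShArr_def)

lemma arr_twShTheta:
  assumes X: "X \<in> twist_cells1 B G W" and [simp]: "fst X' \<in> Cells1 B" "Src B (fst X') = Trg B (fst X)"
      "Trg B (fst X') = Src B (fst X)"
  shows "T.arr (twShTheta B G W T S g X' X) (ShOb S (Trg B (fst X)) (Th (Trg B (fst X)) \<odot> (fst X' \<odot> fst X)))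
     (ShOb S (Src B (fst X)) (Th (Src B (fst X)) \<odot> (fst X \<odot> fst X')))"
proof -
  have [simp]: "fst X \<in> Cells1 B" using twist_cells1D(1)[OF X] .
  show ?thesis unfolding twShTheta_eq[OF assms]
    using arr_ShTheta[of "Th (Trg B (fst X)) \<odot> fst X'" "fst X"] X
    by (intro T.arr_Comp[OF arr_Shc T.arr_Comp[OF _ arr_Shc]]) auto
qed

text \<open>Three naturality squares are pasted: those of the associator, of \<open>\<theta>\<close>, and of \<open>rotation\<close>. Only the
last one involves twists, and only that of the argument that is moved past \<open>\<Theta>(g\<^sup>-\<^sup>1)\<close>. Hence \<open>a\<close> ranges over
2-cells of \<open>B\<close>, while \<open>F\<close> commutes with the twists.\<close>
lemma twShTheta_natural:
  assumes X: "X \<in> twist_cells1 B G W" and Z: "Z \<in> twist_cells1 B G W" and F[simp]: "is_cell F"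
      "dm F = fst X" "cd F = fst Z"
    and F': "\<forall>g\<in>carrier G. twist_cell Z g \<circ>\<^sub>v (idc (Theta W (Src B (fst X)) g) \<star>\<^sub>h F)
        = (F \<star>\<^sub>h idc (Theta W (Trg B (fst X)) g)) \<circ>\<^sub>v twist_cell X g"
    and a[simp]: "is_cell a" "dm a = fst X'" "cd a = fst Z'"
    and X'[simp]: "Src B (fst X') = Trg B (fst X)" "Trg B (fst X') = Src B (fst X)"
  shows "twShTheta B G W T S g Z' Z \<bullet>\<^bsub>T\<^esub> twSh (Trg B (fst X)) (a \<star>\<^sub>h F) = twSh (Src B (fst X)) (F \<star>\<^sub>h a)
      \<bullet>\<^bsub>T\<^esub> twShTheta B G W T S g X' X"
proof -
  let ?A = "Src B (fst X)" and ?C = "Trg B (fst X)"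
  let ?M = "fst X'" and ?N = "fst X" and ?M' = "fst Z'" and ?N' = "fst Z"
  have [simp]: "fst X \<in> Cells1 B" "fst Z \<in> Cells1 B" "Src B (fst Z) = Src B (fst X)"
      "Trg B (fst Z) = Trg B (fst X)"
     "?M \<in> Cells1 B" "?M' \<in> Cells1 B" "Src B ?M' = ?C" "Trg B ?M' = ?A"
    using dm_cd[of F] dm_cd[of a] by auto
  have sq1: "Shc ?C (asci (Th ?C) ?M' ?N') \<bullet>\<^bsub>T\<^esub> twSh ?C (a \<star>\<^sub>h F) = Shc ?C ((idc (Th ?C) \<star>\<^sub>h a) \<star>\<^sub>h F)
      \<bullet>\<^bsub>T\<^esub> Shc ?C (asci (Th ?C) ?M ?N)"
    unfolding twSh_def using asci_natural[of "idc (Th ?C)" "Th ?C" "Th ?C" a ?M ?M' F ?N ?N']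
    by (simp flip: Shc_vc)
  have sq2: "ShTheta S (Th ?C \<odot> ?M') ?N' \<bullet>\<^bsub>T\<^esub> Shc ?C ((idc (Th ?C) \<star>\<^sub>h a) \<star>\<^sub>h F)
     = Shc ?A (F \<star>\<^sub>h (idc (Th ?C) \<star>\<^sub>h a)) \<bullet>\<^bsub>T\<^esub> ShTheta S (Th ?C \<odot> ?M) ?N"
  proof -
    have "typed (idc (Th ?C) \<star>\<^sub>h a) (Th ?C \<odot> ?M) (Th ?C \<odot> ?M')" by simp
    hence "raw (idc (Th ?C) \<star>\<^sub>h a) \<in> Cells2 B (Th ?C \<odot> ?M) (Th ?C \<odot> ?M')" "raw F \<in> Cells2 B ?N ?N'"
      using F unfolding is_cell_def by metis+
    hence "ShTheta S (Th ?C \<odot> ?M') ?N' \<bullet>\<^bsub>T\<^esub> ShArr S ?C (raw (idc (Th ?C) \<star>\<^sub>h a) \<star> raw F)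
       = ShArr S ?A (raw F \<star> raw (idc (Th ?C) \<star>\<^sub>h a)) \<bullet>\<^bsub>T\<^esub> ShTheta S (Th ?C \<odot> ?M) ?N"
      by (intro theta_natural) (simp_all add: hom1_def)
    thus ?thesis by (simp add: Shc_def)
  qed
  have sq3: "Shc ?A (rotation ?M' Z) \<bullet>\<^bsub>T\<^esub> Shc ?A (F \<star>\<^sub>h (idc (Th ?C) \<star>\<^sub>h a)) = twSh ?A (F \<star>\<^sub>h a)
      \<bullet>\<^bsub>T\<^esub> Shc ?A (rotation ?M X)"
    unfolding twSh_def using rotation_natural[OF X Z F F' a X'(1)] by (simp add: X Z flip: Shc_vc)
  let ?O1 = "ShOb S ?C (Th ?C \<odot> ?M \<odot> ?N)" and ?O2 = "ShOb S ?A (?N \<odot> (Th ?C \<odot> ?M))" and ?O3 =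
      "ShOb S ?A (Th ?A \<odot> (?N \<odot> ?M))"
  let ?P1 = "ShOb S ?C (Th ?C \<odot> ?M' \<odot> ?N')" and ?P2 = "ShOb S ?A (?N' \<odot> (Th ?C \<odot> ?M'))" and ?P3 =
      "ShOb S ?A (Th ?A \<odot> (?N' \<odot> ?M'))"
  have arrs: "T.arr (Shc ?C ((idc (Th ?C) \<star>\<^sub>h a) \<star>\<^sub>h F)) ?O1 ?P1"
      "T.arr (Shc ?A (F \<star>\<^sub>h (idc (Th ?C) \<star>\<^sub>h a))) ?O2 ?P2"
    "T.arr (twSh ?A (F \<star>\<^sub>h a)) ?O3 ?P3" "T.arr (Shc ?A (rotation ?M X)) ?O2 ?O3"
        "T.arr (Shc ?A (rotation ?M' Z)) ?P2 ?P3"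
    "T.arr (ShTheta S (Th ?C \<odot> ?M) ?N) ?O1 ?O2" "T.arr (ShTheta S (Th ?C \<odot> ?M') ?N') ?P1 ?P2"
    "T.arr (Shc ?C (asci (Th ?C) ?M ?N)) (ShOb S ?C (Th ?C \<odot> (?M \<odot> ?N))) ?O1"
        "T.arr (Shc ?C (asci (Th ?C) ?M' ?N')) (ShOb S ?C (Th ?C \<odot> (?M' \<odot> ?N'))) ?P1"
    "T.arr (twSh ?C (a \<star>\<^sub>h F)) (ShOb S ?C (Th ?C \<odot> (?M \<odot> ?N))) (ShOb S ?C (Th ?C \<odot> (?M' \<odot> ?N')))"
    using arr_ShTheta[of "Th ?C \<odot> ?M" ?N] arr_ShTheta[of "Th ?C \<odot> ?M'" ?N']
    by (auto intro!: arr_Shc arr_twSh simp: X Z)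
  note sq23 = T.paste_squares[OF arrs(1,6,4,7,5,2,3) sq2 sq3]
  note all = T.paste_squares[OF arrs(10) arrs(8) T.arr_Comp[OF arrs(6,4)] arrs(9) T.arr_Comp[OF arrs(7,5)] arrs(1) arrs(3) sq1 sq23]
  show ?thesis using all twShTheta_eq[OF X, of X'] twShTheta_eq[OF Z, of Z'] by simp
qed

text \<open>With \<open>m\<close> the mate of \<open>h\<close>, and \<open>\<theta>\<close> for the twisted cyclicity isomorphism,
\<open>tr(f h) = \<epsilon>\<^sub>Z \<theta> (Z' \<star> f h) \<eta>\<^sub>Z = \<epsilon>\<^sub>Z \<theta> (m \<star> f) \<eta>\<^sub>X = \<epsilon>\<^sub>Z (f \<star> m) \<theta> \<eta>\<^sub>X = \<epsilon>\<^sub>X (h f \<star> X') \<theta> \<eta>\<^sub>X = \<epsilon>\<^sub>X \<theta> (X' \<star> h f) \<eta>\<^sub>X = tr(h f)\<close>,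
where the second and fourth steps are the mate equations and the third and fifth are naturality.\<close>
lemma twisted_trace_cyclic:
  assumes X: "is_left_dual B (fst X) (fst X') \<eta>X \<epsilon>X" and Z: "is_left_dual B (fst Z) (fst Z') \<eta>Z \<epsilon>Z"
    and f: "f \<in> twist_cells2 B G W X Z" and h: "h \<in> twist_cells2 B G W Z X"
  shows "twisted_trace B G W T S g X X' \<eta>X \<epsilon>X (h \<cdot> f) = twisted_trace B G W T S g Z Z' \<eta>Z \<epsilon>Z (f \<cdot> h)"
proof -
  let ?A = "Src B (fst X)" and ?C = "Trg B (fst X)"
  obtain F where F [simp]: "f = raw F" "is_cell F" "dm F = fst X" "cd F = fst Z"
    and FX: "X \<in> twist_cells1 B G W" "Z \<in> twist_cells1 B G W"
    and F': "\<forall>g\<in>carrier G. twist_cell Z g \<circ>\<^sub>v (idc (Theta W ?A g) \<star>\<^sub>h F) = (F \<star>\<^sub>h idc (Theta W ?C g))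
        \<circ>\<^sub>v twist_cell X g"
    and [simp]: "fst X \<in> Cells1 B" "fst Z \<in> Cells1 B" "Src B (fst Z) = ?A" "Trg B (fst Z) = ?C"
    using twist_cells2_cell[OF f] by blast
  obtain H where H [simp]: "h = raw H" "is_cell H" "dm H = fst Z" "cd H = fst X"
    and H': "\<forall>g\<in>carrier G. twist_cell X g \<circ>\<^sub>v (idc (Theta W (Src B (fst Z)) g) \<star>\<^sub>h H)
        = (H \<star>\<^sub>h idc (Theta W (Trg B (fst Z)) g)) \<circ>\<^sub>v twist_cell Z g"
    using twist_cells2_cell[OF h] by blast
  have HF': "\<forall>g\<in>carrier G. twist_cell X g \<circ>\<^sub>v (idc (Theta W ?A g) \<star>\<^sub>h (H \<circ>\<^sub>v F)) = ((H
      \<circ>\<^sub>v F) \<star>\<^sub>h idc (Theta W ?C g)) \<circ>\<^sub>v twist_cell X g"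
    using F' by (simp add: H'[simplified, rule_format, THEN vc_assoc_eq2])
  define etX where "etX = Cell (Unit1 B ?C) \<eta>X (fst X' \<odot> fst X)"
  define epX where "epX = Cell (fst X \<odot> fst X') \<epsilon>X (Unit1 B ?A)"
  define etZ where "etZ = Cell (Unit1 B ?C) \<eta>Z (fst Z' \<odot> fst Z)"
  define epZ where "epZ = Cell (fst Z \<odot> fst Z') \<epsilon>Z (Unit1 B ?A)"
  have dX: "dual_pair (fst X) (fst X') etX epX" and dZ: "dual_pair (fst Z) (fst Z') etZ epZ"
    using X Z by (simp_all add: is_left_dual_iff etX_def epX_def etZ_def epZ_def)
  have [simp]: "fst X' \<in> Cells1 B" "Src B (fst X') = ?C" "Trg B (fst X') = ?A" "fst Z' \<in> Cells1 B"
      "Src B (fst Z') = ?C" "Trg B (fst Z') = ?A"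
    "is_cell etX" "dm etX = Unit1 B ?C" "cd etX = fst X' \<odot> fst X" "is_cell epX"
        "dm epX = fst X \<odot> fst X'" "cd epX = Unit1 B ?A"
    "is_cell etZ" "dm etZ = Unit1 B ?C" "cd etZ = fst Z' \<odot> fst Z" "is_cell epZ"
        "dm epZ = fst Z \<odot> fst Z'" "cd epZ = Unit1 B ?A"
    using dX dZ by (auto simp: dual_pair_def)
  have raws: "raw etX = \<eta>X" "raw epX = \<epsilon>X" "raw etZ = \<eta>Z" "raw epZ = \<epsilon>Z"
    by (simp_all add: etX_def epX_def etZ_def epZ_def)
  define m where "m = mate (fst Z) (fst Z') (fst X') etZ epX H"
  have [simp]: "is_cell m" "dm m = fst X'" "cd m = fst Z'"
    and ev: "epZ \<circ>\<^sub>v (idc (fst Z) \<star>\<^sub>h m) = epX \<circ>\<^sub>v (H \<star>\<^sub>h idc (fst X'))"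
    and coev: "(m \<star>\<^sub>h idc (fst X)) \<circ>\<^sub>v etX = (idc (fst Z') \<star>\<^sub>h H) \<circ>\<^sub>v etZ"
    using mate_laws[OF dX dZ H(2,3,4)] by (simp_all add: m_def)
  let ?tX = "twShTheta B G W T S g X' X" and ?tZ = "twShTheta B G W T S g Z' Z"
  have trX: "twisted_trace B G W T S g X X' \<eta>X \<epsilon>X (h \<cdot> f) =
    twSh ?A epX \<bullet>\<^bsub>T\<^esub> ?tX \<bullet>\<^bsub>T\<^esub> twSh ?C (idc (fst X') \<star>\<^sub>h (H \<circ>\<^sub>v F)) \<bullet>\<^bsub>T\<^esub> twSh ?C etX"
    by (simp add: twisted_trace_def Let_def twSh_raw raws flip: idc_hc_vc)
  have trZ: "twisted_trace B G W T S g Z Z' \<eta>Z \<epsilon>Z (f \<cdot> h) =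
    twSh ?A epZ \<bullet>\<^bsub>T\<^esub> ?tZ \<bullet>\<^bsub>T\<^esub> twSh ?C (idc (fst Z') \<star>\<^sub>h (F \<circ>\<^sub>v H)) \<bullet>\<^bsub>T\<^esub> twSh ?C etZ"
    by (simp add: twisted_trace_def Let_def twSh_raw raws flip: idc_hc_vc)
  let ?U = "ShOb S ?C (Th ?C \<odot> Unit1 B ?C)" and ?V = "ShOb S ?A (Th ?A \<odot> Unit1 B ?A)"
    and ?X = "ShOb S ?C (Th ?C \<odot> (fst X' \<odot> fst X))" and ?Z = "ShOb S ?C (Th ?C \<odot> (fst Z' \<odot> fst Z))"
    and ?X' = "ShOb S ?A (Th ?A \<odot> (fst X \<odot> fst X'))" and ?Z' = "ShOb S ?A (Th ?A \<odot> (fst Z \<odot> fst Z'))"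
  have a: "T.arr (twSh ?A epX) ?X' ?V" "T.arr (twSh ?A epZ) ?Z' ?V" "T.arr (twSh ?C etX) ?U ?X"
      "T.arr (twSh ?C etZ) ?U ?Z"
    "T.arr ?tX ?X ?X'" "T.arr ?tZ ?Z ?Z'" "T.arr (twSh ?C (m \<star>\<^sub>h F)) ?X ?Z" "T.arr (twSh ?A (F \<star>\<^sub>h m)) ?X' ?Z'"
    "T.arr (twSh ?C (idc (fst X') \<star>\<^sub>h (H \<circ>\<^sub>v F))) ?X ?X" "T.arr (twSh ?A ((H \<circ>\<^sub>v F) \<star>\<^sub>h idc (fst X'))) ?X' ?X'"
    "T.arr (twSh ?C (idc (fst Z') \<star>\<^sub>h (F \<circ>\<^sub>v H))) ?Z ?Z"
    using arr_twShTheta[OF FX(1), of X'] arr_twShTheta[OF FX(2), of Z'] by (auto intro!: arr_twSh)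
  have 1: "twSh ?C (idc (fst Z') \<star>\<^sub>h (F \<circ>\<^sub>v H)) \<bullet>\<^bsub>T\<^esub> twSh ?C etZ = twSh ?C (m \<star>\<^sub>h F) \<bullet>\<^bsub>T\<^esub> twSh ?C etX"
  proof -
    have "(idc (fst Z') \<star>\<^sub>h (F \<circ>\<^sub>v H)) \<circ>\<^sub>v etZ = (m \<star>\<^sub>h F) \<circ>\<^sub>v etX"
      using hc_eq_whiskers(2)[of m F] coev by simp
    thus ?thesis by (simp flip: twSh_vc idc_hc_vc)
  qed
  have 2: "?tZ \<bullet>\<^bsub>T\<^esub> twSh ?C (m \<star>\<^sub>h F) = twSh ?A (F \<star>\<^sub>h m) \<bullet>\<^bsub>T\<^esub> ?tX"
    using F' by (intro twShTheta_natural FX) simp_all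
  have 3: "twSh ?A epZ \<bullet>\<^bsub>T\<^esub> twSh ?A (F \<star>\<^sub>h m) = twSh ?A epX \<bullet>\<^bsub>T\<^esub> twSh ?A ((H \<circ>\<^sub>v F) \<star>\<^sub>h idc (fst X'))"
  proof -
    have "epZ \<circ>\<^sub>v (F \<star>\<^sub>h m) = epX \<circ>\<^sub>v ((H \<circ>\<^sub>v F) \<star>\<^sub>h idc (fst X'))"
      using hc_eq_whiskers(2)[of F m] by (simp add: ev[THEN vc_assoc_eq2])
    thus ?thesis by (simp flip: twSh_vc vc_hc_idc)
  qed
  have 4: "?tX \<bullet>\<^bsub>T\<^esub> twSh ?C (idc (fst X') \<star>\<^sub>h (H \<circ>\<^sub>v F)) = twSh ?A ((H \<circ>\<^sub>v F) \<star>\<^sub>h idc (fst X')) \<bullet>\<^bsub>T\<^esub> ?tX"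
    using HF' by (intro twShTheta_natural FX) simp_all
  have "twisted_trace B G W T S g Z Z' \<eta>Z \<epsilon>Z (f \<cdot> h) = twSh ?A epZ \<bullet>\<^bsub>T\<^esub> ?tZ \<bullet>\<^bsub>T\<^esub> (twSh ?C (m \<star>\<^sub>h F)
      \<bullet>\<^bsub>T\<^esub> twSh ?C etX)"
    unfolding trZ by (subst T.arr_assoc[OF a(4) a(11) T.arr_Comp[OF a(6) a(2)]]) (simp only: 1)
  also have "\<dots> = twSh ?A epZ \<bullet>\<^bsub>T\<^esub> (?tZ \<bullet>\<^bsub>T\<^esub> twSh ?C (m \<star>\<^sub>h F)) \<bullet>\<^bsub>T\<^esub> twSh ?C etX"
    using T.arr_assoc[OF a(3) a(7) T.arr_Comp[OF a(6) a(2)]] T.arr_assoc[OF a(7) a(6) a(2)] by simp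
  also have "\<dots> = twSh ?A epZ \<bullet>\<^bsub>T\<^esub> twSh ?A (F \<star>\<^sub>h m) \<bullet>\<^bsub>T\<^esub> ?tX \<bullet>\<^bsub>T\<^esub> twSh ?C etX"
    unfolding 2 using T.arr_assoc[OF a(5) a(8) a(2)] by simp
  also have "\<dots> = twSh ?A epX \<bullet>\<^bsub>T\<^esub> (twSh ?A ((H \<circ>\<^sub>v F) \<star>\<^sub>h idc (fst X')) \<bullet>\<^bsub>T\<^esub> ?tX) \<bullet>\<^bsub>T\<^esub> twSh ?C etX"
    unfolding 3 using T.arr_assoc[OF a(5) a(10) a(1)] by simp
  also have "\<dots> = twisted_trace B G W T S g X X' \<eta>X \<epsilon>X (h \<cdot> f)"
    unfolding 4[symmetric] trX using T.arr_assoc[OF a(9) a(5) a(1)] by simp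
  finally show ?thesis ..
qed

end

section \<open>Additivity of the twisted trace\<close>

context twisted_shadow
begin

lemma is_functor_twSh_whisker:
  assumes A: "A \<in> Cells0 B" and C: "C \<in> Cells0 B" and N: "N \<in> hom1 Tw C A"
  shows "is_functor (hom_category Tw A C) T (\<lambda>X. twShOb B G W S g C (N \<odot>\<^bsub>Tw\<^esub> X))
    (\<lambda>f. twShArr B G W S g C (Id2 Tw N \<star>\<^bsub>Tw\<^esub> f))"
proof -
  have N': "N \<in> twist_cells1 B G W" "fst N \<in> Cells1 B" "Src B (fst N) = C" "Trg B (fst N) = A"
    using N twist_cells1D(1)[of N] by (simp_all add: hom1_Tw)
  note [simp] = A C N'(2-4)
  have cell: "twShArr B G W S g C (Id2 B (fst N) \<star> raw F) = twSh C (idc (fst N) \<star>\<^sub>h F)"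
    if "is_cell F" "Src B (dm F) = A" "Trg B (dm F) = C" for F
    using that by (simp add: twSh_raw)
  have ob: "twShOb B G W S g C (twist_hcomp1 B G W N X) = ShOb S C (Th C \<odot> (fst N \<odot> fst X))" for X
    by (simp add: twShOb_def)
  have arr: "T.arr (twSh C (idc (fst N) \<star>\<^sub>h F)) (ShOb S C (Th C \<odot> (fst N \<odot> dm F))) (ShOb S C (Th C \<odot> (fst
      N \<odot> cd F)))"
    if "is_cell F" "Src B (dm F) = A" "Trg B (dm F) = C" for F
    using that by (intro arr_twSh) simp_all
  show ?thesis
    unfolding is_functor_def
  proof (intro conjI ballI; (unfold hom_category_def category.simps)?)
    fix X assume "X \<in> hom1 Tw A C"
    hence X: "fst X \<in> Cells1 B" "Src B (fst X) = A" "Trg B (fst X) = C" using twist_cells1D(1)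
        by (auto simp: hom1_Tw)
    show "twShOb B G W S g C (N \<odot>\<^bsub>Tw\<^esub> X) \<in> Ob T"
      using arr[of "idc (fst X)"] X by (simp add: ob T.arr_def)
    show "twShArr B G W S g C (Id2 Tw N \<star>\<^bsub>Tw\<^esub> Id2 Tw X) = category.Id T (twShOb B G W S g C (N \<odot>\<^bsub>Tw\<^esub> X))"
    proof -
      have "Th C \<odot> (fst N \<odot> fst X) \<in> hom1 B C C" using X by (simp add: hom1_def)
      hence "ShArr S C (Id2 B (Th C \<odot> (fst N \<odot> fst X))) = category.Id T (ShOb S C (Th C \<odot> (fst N \<odot> fst X)))"
        using Sh_functor[OF C] by (simp add: is_functor_def hom_category_def)
      thus ?thesis using X by (simp add: ob twShArr_def HComp2_Id)
    qed
    fix Y f assume "Y \<in> hom1 Tw A C" and f: "f \<in> Cells2 Tw X Y"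
    obtain F where F: "f = raw F" "is_cell F" "dm F = fst X" "cd F = fst Y"
      using twist_cells2_cell[of f X Y] f by auto
    show "twShArr B G W S g C (Id2 Tw N \<star>\<^bsub>Tw\<^esub> f) \<in> Hom T (twShOb B G W S g C (N \<odot>\<^bsub>Tw\<^esub> X)) (twShOb B G W
        S g C (N \<odot>\<^bsub>Tw\<^esub> Y))"
      using arr[of F] F X by (simp add: ob cell T.arr_def)
    fix Z h assume "Z \<in> hom1 Tw A C" and h: "h \<in> Cells2 Tw Y Z"
    obtain H where H: "h = raw H" "is_cell H" "dm H = fst Y" "cd H = fst Z"
      using twist_cells2_cell[of h Y Z] h by auto
    have "twSh C (idc (fst N) \<star>\<^sub>h (H \<circ>\<^sub>v F)) = twSh C (idc (fst N) \<star>\<^sub>h H) \<bullet>\<^bsub>T\<^esub> twSh C (idc (fst N) \<star>\<^sub>h F)"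
      using F H X dm_cd[of F] by (simp add: twSh_vc)
    moreover have "raw (H \<circ>\<^sub>v F) = h \<cdot> f" "is_cell (H \<circ>\<^sub>v F)" using F H by simp_all
    ultimately show "twShArr B G W S g C (Id2 Tw N \<star>\<^bsub>Tw\<^esub> (h \<cdot>\<^bsub>Tw\<^esub> f)) =
      twShArr B G W S g C (Id2 Tw N \<star>\<^bsub>Tw\<^esub> h) \<bullet>\<^bsub>T\<^esub> twShArr B G W S g C (Id2 Tw N \<star>\<^bsub>Tw\<^esub> f)"
      using cell[of "H \<circ>\<^sub>v F"] cell[of F] cell[of H] F H X dm_cd[of F] by simp
  qed
qed

text \<open>The trace is \<open>L F(f) R\<close> with \<open>F\<close> the twisted shadow of \<open>Z' \<odot> -\<close>. Splitting \<open>F\<close> of the sum leaves the traces of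
\<open>i f\<^sub>X p\<close> and \<open>j f\<^sub>Y q\<close> on \<open>Z\<close>, which cyclicity identifies with the traces on the summands.\<close>
theorem twisted_trace_biproduct_endo:
  assumes add: "additive_bicategory Tw add zero" and addT: "preadditive_category T addT zeroT"
    and pres: "preserves_biproducts (hom_category Tw C C) (add C C) (zero C C) T addT zeroT
             (twShOb B G W S g C) (twShArr B G W S g C)"
    and c: "A \<in> Cells0 B" "C \<in> Cells0 B"
    and Z: "is_biproduct (hom_category Tw A C) (add A C) (zero A C) X Y Z i j p q"
    and fX: "fX \<in> Cells2 Tw X X" and fY: "fY \<in> Cells2 Tw Y Y"
    and dX: "is_left_dual Tw X X' \<eta>X \<epsilon>X" and dY: "is_left_dual Tw Y Y' \<eta>Y \<epsilon>Y" and dZ: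
        "is_left_dual Tw Z Z' \<eta>Z \<epsilon>Z"
  shows "twisted_trace B G W T S g Z Z' \<eta>Z \<epsilon>Z (biproduct_endo (hom_category Tw A C) (add A C) Z i j p q fX fY)
    = addT (twShOb B G W S g C (Unit1 Tw C)) (twShOb B G W S g A (Unit1 Tw A))
       (twisted_trace B G W T S g X X' \<eta>X \<epsilon>X fX) (twisted_trace B G W T S g Y Y' \<eta>Y \<epsilon>Y fY)"
proof -
  interpret Twa: additive_bicategory Tw add zero by (rule add)
  interpret T: preadditive_category T addT zeroT by (rule addT)
  interpret H: preadditive_category "hom_category Tw A C" "add A C" "zero A C"
    using c by (intro Twa.preadditive_hom) simp_all
  let ?F = "\<lambda>f. twShArr B G W S g C (Id2 Tw Z' \<star>\<^bsub>Tw\<^esub> f)" and ?Fo = "\<lambda>X. twShOb B G W S g C (Z' \<odot>\<^bsub>Tw\<^esub> X)"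
  let ?s = "biproduct_endo (hom_category Tw A C) (add A C) Z i j p q fX fY"
  have ob: "X \<in> hom1 Tw A C" "Y \<in> hom1 Tw A C" "Z \<in> hom1 Tw A C"
    and arr: "i \<in> twist_cells2 B G W X Z" "j \<in> twist_cells2 B G W Y Z" "p \<in> twist_cells2 B G W Z X"
        "q \<in> twist_cells2 B G W Z Y"
    and pi: "p \<cdot> i = Id2 B (fst X)" "q \<cdot> j = Id2 B (fst Y)"
    using Z by (auto simp: is_biproduct_def hom_category_def)
  have ob': "Z \<in> twist_cells1 B G W" "fst Z \<in> Cells1 B" "Src B (fst Z) = A" "Trg B (fst Z) = C"
    using ob(3) twist_cells1D(1)[of Z] by (auto simp: hom1_Tw)
  have Z': "Z' \<in> hom1 Tw C A" using dZ ob' by (simp add: is_left_dual_def)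
  hence Z'': "fst Z' \<in> Cells1 B" "Src B (fst Z') = C" "Trg B (fst Z') = A"
    using twist_cells1D(1)[of Z'] by (auto simp: hom1_Tw)
  note [simp] = c ob' Z''
  have fX': "fX \<in> twist_cells2 B G W X X" and fY': "fY \<in> twist_cells2 B G W Y Y" using fX fY by simp_all
  have "is_biproduct T addT zeroT (?Fo X) (?Fo Y) (?Fo Z) (?F i) (?F j) (?F p) (?F q)"
    using pres Twa.biproduct2_whisker(2)[OF Z _ _ _ Z'] c unfolding preserves_biproducts_def
    by (metis Tw_simps(1))
  hence F: "?F ?s = addT (?Fo Z) (?Fo Z) (?F (i \<cdot> fX \<cdot> p)) (?F (j \<cdot> fY \<cdot> q))"
    using H.functor_biproduct_endo[OF addT is_functor_twSh_whisker[OF c Z'] Z] fX fY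
    by (simp add: hom_category_def)
  have fi: "i \<cdot> fX \<in> twist_cells2 B G W X Z" "j \<cdot> fY \<in> twist_cells2 B G W Y Z"
    using arr fX' fY' by (auto intro: twist_cells2_VComp)
  have fip: "i \<cdot> fX \<cdot> p \<in> twist_cells2 B G W Z Z" "j \<cdot> fY \<cdot> q \<in> twist_cells2 B G W Z Z"
    using fi arr by (auto intro: twist_cells2_VComp)
  have FH: "?F k \<in> Hom T (?Fo Z) (?Fo Z)" if "k \<in> twist_cells2 B G W Z Z" for k
    using is_functor_twSh_whisker[OF c Z'] that ob(3) unfolding is_functor_def by (simp add: hom_category_def)
  define L where "L = twShArr B G W S g A \<epsilon>Z \<bullet>\<^bsub>T\<^esub> twShTheta B G W T S g Z' Z"
  define R where "R = twShArr B G W S g C \<eta>Z"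
  let ?UA = "twShOb B G W S g A (Unit1 Tw A)" and ?UC = "twShOb B G W S g C (Unit1 Tw C)"
  have tr: "twisted_trace B G W T S g Z Z' \<eta>Z \<epsilon>Z k = L \<bullet>\<^bsub>T\<^esub> ?F k \<bullet>\<^bsub>T\<^esub> R" for k
    by (simp add: twisted_trace_def L_def R_def)
  have dZ': "is_left_dual B (fst Z) (fst Z') \<eta>Z \<epsilon>Z" by (rule is_left_dual_Tw_imp[OF dZ])
  have cells: "is_cell (Cell (Unit1 B C) \<eta>Z (fst Z' \<odot> fst Z))" "is_cell (Cell (fst Z \<odot> fst Z') \<epsilon>Z (Unit1 B A))"
    using dZ' by (simp_all add: is_left_dual_def is_cell_def)
  have "T.arr (twSh A (Cell (fst Z \<odot> fst Z') \<epsilon>Z (Unit1 B A))) (ShOb S A (Th A \<odot> (fst Z \<odot> fst Z'))) (ShOb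
      S A (Th A \<odot> Unit1 B A))"
    "T.arr (twSh C (Cell (Unit1 B C) \<eta>Z (fst Z' \<odot> fst Z))) (ShOb S C (Th C \<odot> Unit1 B C)) (ShOb S C (Th C
        \<odot> (fst Z' \<odot> fst Z)))"
    using cells by (auto intro!: arr_twSh)
  moreover have "T.arr (twShTheta B G W T S g Z' Z) (ShOb S C (Th C \<odot> (fst Z' \<odot> fst Z))) (ShOb S A (Th A
      \<odot> (fst Z \<odot> fst Z')))"
    using arr_twShTheta[of Z Z'] by simp
  ultimately have LR: "T.arr L (?Fo Z) ?UA" "T.arr R ?UC (?Fo Z)"
    using cells unfolding L_def R_def by (auto simp: twShOb_def twSh_raw intro: T.arr_Comp)
  have "twisted_trace B G W T S g Z Z' \<eta>Z \<epsilon>Z ?s =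
    L \<bullet>\<^bsub>T\<^esub> addT (?Fo Z) (?Fo Z) (?F (i \<cdot> fX \<cdot> p)) (?F (j \<cdot> fY \<cdot> q)) \<bullet>\<^bsub>T\<^esub> R"
    unfolding tr F ..
  also have "\<dots> = addT ?UC ?UA (L \<bullet>\<^bsub>T\<^esub> ?F (i \<cdot> fX \<cdot> p) \<bullet>\<^bsub>T\<^esub> R) (L \<bullet>\<^bsub>T\<^esub> ?F (j \<cdot> fY \<cdot> q) \<bullet>\<^bsub>T\<^esub> R)"
  proof -
    have LR': "L \<in> Hom T (?Fo Z) ?UA" "R \<in> Hom T ?UC (?Fo Z)" "?Fo Z \<in> Ob T" "?UA \<in> Ob T" "?UC \<in> Ob T"
      using LR by (simp_all add: T.arr_def)
    have LF: "L \<bullet>\<^bsub>T\<^esub> ?F k \<in> Hom T (?Fo Z) ?UA" if "k \<in> twist_cells2 B G W Z Z" for k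
      using T.Comp_closed[OF LR'(3,3,4) FH[OF that] LR'(1)] .
    show ?thesis
      unfolding T.Comp_add[OF LR'(3,3,4) FH[OF fip(1)] FH[OF fip(2)] LR'(1)]
      by (rule T.add_Comp[OF LR'(5,3,4,2) LF[OF fip(1)] LF[OF fip(2)]])
  qed
  also have "\<dots> = addT ?UC ?UA (twisted_trace B G W T S g X X' \<eta>X \<epsilon>X (p \<cdot> (i \<cdot> fX))) (twisted_trace B G W
      T S g Y Y' \<eta>Y \<epsilon>Y (q \<cdot> (j \<cdot> fY)))"
    using twisted_trace_cyclic[OF is_left_dual_Tw_imp[OF dX] dZ' fi(1) arr(3)]
      twisted_trace_cyclic[OF is_left_dual_Tw_imp[OF dY] dZ' fi(2) arr(4)] by (simp add: tr)
  also have "p \<cdot> (i \<cdot> fX) = fX"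
    using VComp_assoc[of fX "fst X" "fst X" i "fst Z" p "fst X"] arr fX' twist_cells2_Cells2
        Id2_VComp[of fX "fst X" "fst X"]
    by (metis pi(1))
  also have "q \<cdot> (j \<cdot> fY) = fY"
    using VComp_assoc[of fY "fst Y" "fst Y" j "fst Z" q "fst Y"] arr fY' twist_cells2_Cells2
        Id2_VComp[of fY "fst Y" "fst Y"]
    by (metis pi(2))
  finally show ?thesis .
qed

end

theorem proposition6p8:
  fixes B :: "('o, 'm, 'c) bicategory"
    and G :: "'g monoid"
    and W :: "('g, 'o, 'm, 'c) twisting"
    and T :: "('t, 'u) category"
    and S :: "('o, 'm, 'c, 't, 'u) shadow"
    and Tw :: "('o, 'm \<times> ('g \<Rightarrow> 'c), 'c) bicategory"
    and add zero addT zeroT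
  assumes "Tw = twist_bicategory B G W"
    and "group G" and "g \<in> carrier G"
    and "bicategory B"
    and "shadow B T S"
    and "twisting B G W"
    and "homs_additive Tw add zero"
    and "hcomp_distributes Tw add zero"
    and "additive_category T addT zeroT"
    and "\<And>R. R \<in> Cells0 Tw \<Longrightarrow>
           preserves_biproducts (hom_category Tw R R) (add R R) (zero R R) T addT zeroT
             (twShOb B G W S g R) (twShArr B G W S g R)"
    and "A \<in> Cells0 Tw" and "C \<in> Cells0 Tw"
    and "X \<in> hom1 Tw A C" and "Y \<in> hom1 Tw A C"
    and "left_dualizable Tw X" and "left_dualizable Tw Y"
    and "fX \<in> Cells2 Tw X X" and "fY \<in> Cells2 Tw Y Y"
    and "is_biproduct (hom_category Tw A C) (add A C) (zero A C) X Y XY iX iY pX pY"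
  shows "left_dualizable Tw XY \<and>
    (\<forall>X' \<eta>X \<epsilon>X Y' \<eta>Y \<epsilon>Y XY' \<eta>XY \<epsilon>XY.
       is_left_dual Tw X X' \<eta>X \<epsilon>X \<and> is_left_dual Tw Y Y' \<eta>Y \<epsilon>Y \<and>
       is_left_dual Tw XY XY' \<eta>XY \<epsilon>XY \<longrightarrow>
       twisted_trace B G W T S g XY XY' \<eta>XY \<epsilon>XY
           (biproduct_endo (hom_category Tw A C) (add A C) XY iX iY pX pY fX fY) =
         addT (twShOb B G W S g C (Unit1 Tw C)) (twShOb B G W S g A (Unit1 Tw A))
           (twisted_trace B G W T S g X X' \<eta>X \<epsilon>X fX)
           (twisted_trace B G W T S g Y Y' \<eta>Y \<epsilon>Y fY))"
proof -
  interpret twisting B G W by fact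
  interpret shadow B T S by fact
  interpret twisted_shadow B G W T S g
    by unfold_locales fact
  note Tw_def = \<open>Tw = twist_bicategory B G W\<close>
  have add: "additive_bicategory Tw add zero"
    unfolding additive_bicategory_def additive_bicategory_axioms_def
    using bicategory_Tw assms(7,8) by (simp add: Tw_def)
  have addT: "preadditive_category T addT zeroT"
    using assms(9) by (rule additive_category.axioms(1))
  have "left_dualizable Tw XY"
    using additive_bicategory.left_dualizable_biproduct[OF add assms(19,15,16)] .
  thus ?thesis
    using twisted_trace_biproduct_endo[OF _ addT, of add zero C A X Y XY iX iY pX pY fX fY] add
        assms(10)[OF assms(12)] assms(11,12,17,18,19)
    unfolding Tw_def by simp
qed

end
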